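(* Let $p,n$ be positive integers and let $X\sim N_p(\theta,\sigma^2I_p)$ and $S\sim \sigma^2\chi^2_n$ be independent, with $\theta\in\mathbb{R}^p$ and $\sigma^2\in(0,\infty)$ both unknown. Consider estimation of $\theta$ under the loss $L(d;\{\theta,\sigma^2\})=\|d-\theta\|^2/\sigma^2$. Suppose $n\ge3$ and $p>4n/(n-2)$. Then the estimator $$\left(1-\frac{2(p-2)/(n+2)}{\|X\|^2/S+1+2(p-2)/(n+2)}\right)X$$ is admissible and minimax.
   Context: An estimator is a measurable map $\delta:\mathbb{R}^p\times(0,\infty)\to\mathbb{R}^p$ with risk $R(\theta,\sigma^2,\delta)=E_{\theta,\sigma^2}[\|\delta(X,S)-\theta\|^2/\sigma^2]$. $\delta$ is admissible if there is no estimator $\delta'$ with $R(\theta,\sigma^2,\delta')\le R(\theta,\sigma^2,\delta)$ for all $(\theta,\sigma^2)\in\mathbb{R}^p\times(0,\infty)$ and strict inequality for some $(\theta,\sigma^2)$. $\delta$ is minimax if $\sup_{\theta,\sigma^2}R(\theta,\sigma^2,\delta)=\inf_{\delta'}\sup_{\theta,\sigma^2}R(\theta,\sigma^2,\delta')$, the infimum being over all estimators. *)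

theory Defs
  imports "HOL-Probability.Probability"
begin

text \<open>The law \<open>N\<^sub>p(\<theta>, v I\<^sub>p)\<close>, where \<open>p = CARD('p)\<close> and \<open>v = \<sigma>\<^sup>2 > 0\<close>.\<close>

definition mvnormal :: "real ^ 'p \<Rightarrow> real \<Rightarrow> (real ^ 'p) measure" where
  "mvnormal \<theta> v = density lborel (\<lambda>x. ennreal
     ((2 * pi * v) powr (- (real CARD('p) / 2)) * exp (- ((norm (x - \<theta>))\<^sup>2 / (2 * v)))))"

text \<open>The law \<open>\<chi>\<^sup>2\<^sub>n\<close> (for \<open>n > 0\<close>), as a measure whose underlying space is \<open>(0, \<infinity>)\<close>.\<close>

definition chi_square :: "nat \<Rightarrow> real measure" where
  "chi_square n = density (restrict_space lborel {0<..}) (\<lambda>s. ennreal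
     (s powr (real n / 2 - 1) * exp (- (s / 2)) / (2 powr (real n / 2) * Gamma (real n / 2))))"

text \<open>
  The joint law of independent \<open>X \<sim> N\<^sub>p(\<theta>, v I\<^sub>p)\<close> and \<open>S \<sim> v \<chi>\<^sup>2\<^sub>n\<close>, living on
  \<open>\<real>\<^sup>p \<times> (0, \<infinity>)\<close>; independence is expressed by the product measure.
\<close>

definition sample_law :: "nat \<Rightarrow> real ^ 'p \<Rightarrow> real \<Rightarrow> ((real ^ 'p) \<times> real) measure" where
  "sample_law n \<theta> v =
     mvnormal \<theta> v \<Otimes>\<^sub>M distr (chi_square n) (restrict_space borel {0<..}) (\<lambda>s. v * s)"

text \<open>
  Only the values on \<open>\<real>\<^sup>p \<times> (0, \<infinity>)\<close> matter: measurability is required on that space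
  alone, and the sample laws above give no weight to anything outside it.
\<close>

definition estimator :: "((real ^ 'p) \<times> real \<Rightarrow> real ^ 'p) \<Rightarrow> bool" where
  "estimator \<delta> \<longleftrightarrow> \<delta> \<in> borel \<Otimes>\<^sub>M restrict_space borel {0<..} \<rightarrow>\<^sub>M borel"

definition loss :: "real ^ 'p \<Rightarrow> real ^ 'p \<Rightarrow> real \<Rightarrow> real" where
  "loss d \<theta> v = (norm (d - \<theta>))\<^sup>2 / v"

text \<open>The risk may be infinite, hence it takes extended nonnegative values.\<close>

definition risk :: "nat \<Rightarrow> real ^ 'p \<Rightarrow> real \<Rightarrow> ((real ^ 'p) \<times> real \<Rightarrow> real ^ 'p) \<Rightarrow> ennreal" where
  "risk n \<theta> v \<delta> = (\<integral>\<^sup>+ z. ennreal (loss (\<delta> z) \<theta> v) \<partial>sample_law n \<theta> v)"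

definition admissible :: "nat \<Rightarrow> ((real ^ 'p) \<times> real \<Rightarrow> real ^ 'p) \<Rightarrow> bool" where
  "admissible n \<delta> \<longleftrightarrow> estimator \<delta> \<and>
     \<not> (\<exists>\<delta>'. estimator \<delta>' \<and>
          (\<forall>\<theta>. \<forall>v>0. risk n \<theta> v \<delta>' \<le> risk n \<theta> v \<delta>) \<and>
          (\<exists>\<theta>. \<exists>v>0. risk n \<theta> v \<delta>' < risk n \<theta> v \<delta>))"

definition max_risk :: "nat \<Rightarrow> ((real ^ 'p) \<times> real \<Rightarrow> real ^ 'p) \<Rightarrow> ennreal" where
  "max_risk n \<delta> = (SUP (\<theta>, v) \<in> UNIV \<times> {0<..}. risk n \<theta> v \<delta>)"

definition minimax :: "nat \<Rightarrow> ((real ^ 'p) \<times> real \<Rightarrow> real ^ 'p) \<Rightarrow> bool" where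
  "minimax n \<delta> \<longleftrightarrow> estimator \<delta> \<and>
     max_risk n \<delta> =
       (INF \<delta>' \<in> {\<delta>' :: (real ^ 'p) \<times> real \<Rightarrow> real ^ 'p. estimator \<delta>'}. max_risk n \<delta>')"

definition shrinkage_estimator :: "nat \<Rightarrow> (real ^ 'p) \<times> real \<Rightarrow> real ^ 'p" where
  "shrinkage_estimator n = (\<lambda>(x, s).
     (1 - (2 * (real CARD('p) - 2) / (real n + 2)) /
          ((norm x)\<^sup>2 / s + 1 + 2 * (real CARD('p) - 2) / (real n + 2))) *\<^sub>R x)"

end

theory Submission
  imports Defs
begin

text \<open>
  Write \<open>p\<close> for the dimension, \<open>v\<close> for the variance, \<open>w = \<parallel>x\<parallel>\<^sup>2 / s\<close> and
  \<open>\<alpha> = 2 (p - 2) / (n + 2)\<close>; the estimator multiplies \<open>x\<close> by \<open>1 - \<alpha> / (w + 1 + \<alpha>)\<close>.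

  Minimaxity. Stein's integration by parts, once in \<open>x\<close> and once in \<open>s\<close>, turns the risk into
  the expectation of an explicit function that is at most \<open>p\<close> pointwise; the value of
  \<open>\<alpha>\<close> is just small enough for this (\<open>risk_shrinkage_le\<close>). Both integrations by parts come from
  one identity for dilations, \<open>integral_divergence_radial\<close>. Conversely, for fixed \<open>v\<close> and the prior
  \<open>N(0, v (1 - t) / t)\<close> on \<open>\<theta>\<close> every estimator has Bayes risk at least \<open>p (1 - t)\<close>
  (\<open>bayes_risk_normal_prior\<close>), and \<open>t \<rightarrow> 0\<close> gives \<open>p\<close> as a lower bound of every maximal risk
  (\<open>max_risk_ge\<close>).

  Admissibility. The estimator is generalised Bayes. Let \<open>v = e\<^sup>y\<close>, let \<open>\<theta>\<close> given \<open>t\<close> and \<open>v\<close> be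
  \<open>N(0, v (1 - t) / t)\<close>, let \<open>t\<close> have density \<open>t\<^sup>a (1 - t)\<^sup>b\<close> on \<open>(0, 1)\<close> with \<open>b = n / 2 - a - 2\<close>, and
  let \<open>y\<close> have Lebesgue measure. Given \<open>t\<close>, \<open>y\<close> and the data, \<open>\<theta>\<close> has mean \<open>(1 - t) x\<close>; and the
  posterior mean of \<open>t\<close>, with the factor \<open>1 / v\<close> of the loss counted in the weight, is
  \<open>\<alpha>' / (w + 1 + \<alpha>')\<close> with \<open>\<alpha>' = (p / 2 + a + 1) / (b + 1)\<close> (\<open>posterior_balance\<close>).
  Solving \<open>\<alpha>' = \<alpha>\<close> for \<open>a\<close> gives a root with \<open>a > -1\<close> exactly when \<open>p > 4 n / (n - 2)\<close>. So the
  hypothesis says that the prior of \<open>t\<close> is proper, and the whole prior is improper only along the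
  one-dimensional group of scale changes.

  Impropriety along one real line is harmless, by Blyth's method. Replace Lebesgue measure for \<open>y\<close> by
  the finite measure with density \<open>h(y) = exp (- \<epsilon> \<bar>y\<bar>)\<close>. Since \<open>h\<close> varies by a relative amount
  \<open>O(\<epsilon>)\<close> over the range of \<open>y\<close> that is compatible with the data, the estimator misses the optimal
  Bayes risk by \<open>O(\<epsilon>\<^sup>2)\<close> times the mass \<open>O(1 / \<epsilon>)\<close> of the prior, hence by \<open>O(\<epsilon>)\<close> (\<open>excess_risk_bound\<close>).
  An estimator with nowhere larger risk then lies within \<open>O(\<epsilon>)\<close> of the shrinkage estimator in the
  integrated squared distance (\<open>integrated_distance_bound\<close>). Letting \<open>\<epsilon> \<rightarrow> 0\<close> forces the two
  to agree almost everywhere, so that no risk is strictly smaller.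
\<close>

section \<open>Dilations and the radial divergence identity\<close>

lemma nn_integral_lborel_affine:
  fixes t :: "'a::euclidean_space" and f :: "'a \<Rightarrow> ennreal"
  assumes [measurable]: "f \<in> borel_measurable borel" and c: "c \<noteq> 0"
  shows "(\<integral>\<^sup>+x. f x \<partial>lborel) = ennreal (\<bar>c\<bar> ^ DIM('a)) * (\<integral>\<^sup>+x. f (t + c *\<^sub>R x) \<partial>lborel)"
  by (subst lborel_affine[OF c, of t])
     (simp add: nn_integral_density nn_integral_distr nn_integral_cmult)

lemma lborel_integral_dilation:
  fixes f :: "'a::euclidean_space \<Rightarrow> real"
  assumes [measurable]: "f \<in> borel_measurable borel" and c: "c > 0"
  shows "(\<integral>x. f x \<partial>lborel) = c ^ DIM('a) * (\<integral>x. f (c *\<^sub>R x) \<partial>lborel)"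
  using c
  by (subst lborel_affine[of c 0])
     (simp_all add: integral_density integral_distr)

lemma lborel_integrable_dilation:
  fixes f :: "'a::euclidean_space \<Rightarrow> real"
  assumes f: "integrable lborel f" and c: "c > 0"
  shows "integrable lborel (\<lambda>x. f (c *\<^sub>R x))"
proof -
  have [measurable]: "f \<in> borel_measurable borel" using f by simp
  have "(\<integral>\<^sup>+x. ennreal (norm (f x)) \<partial>lborel)
      = ennreal (\<bar>c\<bar> ^ DIM('a)) * (\<integral>\<^sup>+x. ennreal (norm (f (0 + c *\<^sub>R x))) \<partial>lborel)"
    by (rule nn_integral_lborel_affine) (use c in auto)
  moreover have "(\<integral>\<^sup>+x. ennreal (norm (f x)) \<partial>lborel) < \<infinity>"
    using f by (simp add: integrable_iff_bounded)
  ultimately have "(\<integral>\<^sup>+x. ennreal (norm (f (c *\<^sub>R x))) \<partial>lborel) < \<infinity>"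
    using c by (auto simp: ennreal_mult_less_top)
  then show ?thesis by (simp add: integrable_iff_bounded)
qed

text \<open>
  The divergence of the radial field \<open>x \<mapsto> u(x) x\<close> is \<open>p u + w\<close>, where \<open>w\<close> is the derivative of \<open>u\<close>
  along dilations. Its integral vanishes because \<open>exp (p \<tau>) u(e\<^sup>\<tau> x)\<close> has the same integral for all
  \<open>\<tau>\<close>. Radial fields suffice for shrinkage, and one derivative along a ray replaces the
  partial derivatives in all coordinates.
\<close>

lemma integral_divergence_radial:
  fixes u w :: "'a::euclidean_space \<Rightarrow> real"
  assumes u: "integrable lborel u" and w: "integrable lborel w"
    and deriv: "\<And>x \<tau>. ((\<lambda>\<tau>. u (exp \<tau> *\<^sub>R x)) has_real_derivative w (exp \<tau> *\<^sub>R x)) (at \<tau>)"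
    and cont: "\<And>x. continuous_on UNIV (\<lambda>\<tau>. w (exp \<tau> *\<^sub>R x))"
  shows "real DIM('a) * (\<integral>x. u x \<partial>lborel) + (\<integral>x. w x \<partial>lborel) = 0"
proof -
  let ?p = "real DIM('a)"
  define G where "G = (\<lambda>x. ?p * u x + w x)"
  define F where "F = (\<lambda>\<tau> x. exp (?p * \<tau>) * u (exp \<tau> *\<^sub>R x))"
  define F' where "F' = (\<lambda>\<tau> x. exp (?p * \<tau>) * G (exp \<tau> *\<^sub>R x))"
  have [measurable]: "u \<in> borel_measurable borel" "w \<in> borel_measurable borel"
    using u w by simp_all
  have G: "integrable lborel G" unfolding G_def using u w by simp
  then have [measurable]: "G \<in> borel_measurable borel" by simp
  have pow: "exp \<tau> ^ DIM('a) = exp (?p * \<tau>)" for \<tau> :: real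
    by (simp add: exp_of_nat_mult)
  have flow: "integrable lborel (\<lambda>x. exp (?p * \<tau>) * f (exp \<tau> *\<^sub>R x))"
    "(\<integral>x. exp (?p * \<tau>) * f (exp \<tau> *\<^sub>R x) \<partial>lborel) = (\<integral>x. f x \<partial>lborel)"
    if f: "integrable lborel f" for f :: "'a \<Rightarrow> real" and \<tau>
    using lborel_integrable_dilation[OF f, of "exp \<tau>"]
      lborel_integral_dilation[of f "exp \<tau>"] f by (auto simp: pow)
  have F_deriv: "((\<lambda>\<tau>. F \<tau> x) has_vector_derivative F' \<tau> x) (at \<tau> within A)" for \<tau> x A
  proof -
    have "((\<lambda>\<tau>. F \<tau> x) has_real_derivative F' \<tau> x) (at \<tau>)"
      unfolding F_def F'_def G_def
      by (auto intro!: derivative_eq_intros deriv simp: algebra_simps)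
    then show ?thesis
      by (simp add: has_real_derivative_iff_has_vector_derivative has_vector_derivative_at_within)
  qed
  have ucont: "continuous_on UNIV (\<lambda>\<tau>. u (exp \<tau> *\<^sub>R x))" for x
    by (intro continuous_at_imp_continuous_on ballI DERIV_isCont[OF deriv])
  have F'_cont: "continuous_on A (\<lambda>\<tau>. F' \<tau> x)" for x A
    unfolding F'_def G_def
    by (intro continuous_intros continuous_on_subset[OF ucont] continuous_on_subset[OF cont]) auto
  have FTC: "(\<integral>\<tau>. indicator {0..1} \<tau> *\<^sub>R F' \<tau> x \<partial>lborel) = F 1 x - F 0 x" for x
    by (rule integral_FTC_atLeastAtMost) (auto intro: F_deriv F'_cont)
  let ?J = "\<lambda>\<tau> x. indicator {0..1::real} \<tau> *\<^sub>R F' \<tau> x"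
  have [measurable]: "case_prod F' \<in> borel_measurable (lborel \<Otimes>\<^sub>M lborel)"
    unfolding F'_def by measurable
  have norm_int: "(\<integral>x. norm (?J \<tau> x) \<partial>lborel) = indicator {0..1} \<tau> * (\<integral>x. norm (G x) \<partial>lborel)" for \<tau>
    using flow(2)[OF integrable_norm[OF G], of \<tau>]
    by (auto simp: F'_def abs_mult split: split_indicator)
  have J: "integrable (lborel \<Otimes>\<^sub>M lborel) (case_prod ?J)"
  proof (rule lborel_pair.Fubini_integrable)
    show "integrable lborel (\<lambda>\<tau>. \<integral>x. norm (case_prod ?J (\<tau>, x)) \<partial>lborel)"
      unfolding prod.case norm_int by simp
    show "AE \<tau> in lborel. integrable lborel (\<lambda>x. case_prod ?J (\<tau>, x))"
      using flow(1)[OF G] by (auto simp: F'_def)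
  qed measurable
  have "(\<integral>x. (\<integral>\<tau>. ?J \<tau> x \<partial>lborel) \<partial>lborel) = (\<integral>\<tau>. (\<integral>x. ?J \<tau> x \<partial>lborel) \<partial>lborel)"
    by (rule lborel_pair.Fubini_integral[OF J])
  also have "\<dots> = (\<integral>\<tau>. indicator {0..1::real} \<tau> * (\<integral>x. G x \<partial>lborel) \<partial>lborel)"
    using flow(2)[OF G] by (simp add: F'_def content_real)
  also have "\<dots> = (\<integral>x. G x \<partial>lborel)" by (simp add: content_real)
  finally have "(\<integral>x. G x \<partial>lborel) = (\<integral>x. F 1 x - F 0 x \<partial>lborel)"
    by (simp add: FTC del: real_scaleR_def)
  also have "\<dots> = 0"
    using flow[OF u, of 1] u by (simp add: F_def)
  finally show ?thesis using u w by (simp add: G_def)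
qed

section \<open>Spherical normal densities\<close>

definition gauss :: "real ^ 'p \<Rightarrow> real \<Rightarrow> real ^ 'p \<Rightarrow> real" where
  "gauss \<mu> v x = (2 * pi * v) powr (- (real CARD('p) / 2)) * exp (- ((norm (x - \<mu>))\<^sup>2 / (2 * v)))"

lemma gauss_nonneg [simp]: "0 \<le> gauss \<mu> v x"
  by (simp add: gauss_def)

lemma gauss_pos: "v > 0 \<Longrightarrow> 0 < gauss \<mu> v x"
  by (simp add: gauss_def)

lemma borel_measurable_gauss [measurable (raw)]:
  assumes [measurable]: "f \<in> M \<rightarrow>\<^sub>M borel" "g \<in> borel_measurable M" "h \<in> M \<rightarrow>\<^sub>M borel"
  shows "(\<lambda>z. gauss (f z) (g z) (h z)) \<in> borel_measurable M"
  unfolding gauss_def by measurable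

lemma nn_integral_gauss:
  fixes \<mu> :: "real ^ 'p"
  assumes v: "v > 0"
  shows "(\<integral>\<^sup>+x. gauss \<mu> v x \<partial>lborel) = 1"
proof -
  have nd: "normal_density m (sqrt v) y = (1 / sqrt (2 * pi * v)) * exp (- ((y - m)\<^sup>2 / (2 * v)))" for m y
    using v by (simp add: normal_density_def)
  have dens: "gauss (\<mu> :: real ^ 'p) v x = (\<Prod>b\<in>Basis. normal_density (\<mu> \<bullet> b) (sqrt v) (x \<bullet> b))" for x
  proof -
    have "(\<Prod>b\<in>Basis. normal_density (\<mu> \<bullet> b) (sqrt v) (x \<bullet> b))
        = (1 / sqrt (2 * pi * v)) ^ DIM(real^'p) * exp (\<Sum>b\<in>Basis. - ((x \<bullet> b - \<mu> \<bullet> b)\<^sup>2 / (2 * v)))"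
      by (simp only: nd prod.distrib prod_constant exp_sum finite_Basis)
    also have "(\<Sum>b\<in>Basis. - ((x \<bullet> b - \<mu> \<bullet> b)\<^sup>2 / (2 * v))) = - ((norm (x - \<mu>))\<^sup>2 / (2 * v))"
    proof -
      have "(norm (x - \<mu>))\<^sup>2 = (\<Sum>b\<in>Basis. ((x - \<mu>) \<bullet> b) * ((x - \<mu>) \<bullet> b))"
        unfolding power2_norm_eq_inner by (rule euclidean_inner)
      then show ?thesis
        by (simp only: sum_divide_distrib sum_negf power2_eq_square inner_diff_left)
    qed
    also have "(1 / sqrt (2 * pi * v)) ^ DIM(real^'p) = (2 * pi * v) powr (- (real CARD('p) / 2))"
    proof -
      have "1 / sqrt (2 * pi * v) = (2 * pi * v) powr (- (1 / 2))"
        using v by (simp add: powr_half_sqrt powr_minus_divide)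
      then have "(1 / sqrt (2 * pi * v)) ^ DIM(real^'p) = ((2 * pi * v) powr (- (1 / 2))) powr real CARD('p)"
        using v by (simp only: ) (simp add: powr_realpow)
      then show ?thesis
        by (simp only: powr_powr) simp
    qed
    finally show ?thesis by (simp add: gauss_def)
  qed
  have one: "(\<integral>\<^sup>+y. ennreal (normal_density m (sqrt v) y) \<partial>lborel) = 1" for m
    using v by (subst nn_integral_eq_integral) auto
  have "(\<integral>\<^sup>+x. gauss \<mu> v x \<partial>lborel)
      = (\<integral>\<^sup>+x. (\<Prod>b\<in>Basis. ennreal (normal_density (\<mu> \<bullet> b) (sqrt v) (x \<bullet> b))) \<partial>lborel)"
    by (simp add: dens prod_ennreal)
  also have "\<dots> = (\<Prod>b\<in>Basis. \<integral>\<^sup>+y. ennreal (normal_density (\<mu> \<bullet> b) (sqrt v) y) \<partial>lborel)"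
    by (rule nn_integral_lborel_prod) auto
  also have "\<dots> = 1"
    by (simp only: one prod.neutral_const)
  finally show ?thesis .
qed

lemma integrable_gauss: "v > 0 \<Longrightarrow> integrable lborel (gauss \<mu> v)"
  using nn_integral_gauss[of v \<mu>] by (auto simp: integrable_iff_bounded)

lemma integral_gauss: "v > 0 \<Longrightarrow> (\<integral>x. gauss \<mu> v x \<partial>lborel) = 1"
  using nn_integral_gauss[of v \<mu>] by (simp add: integral_eq_nn_integral)

text \<open>
  The radial divergence identity for the density itself: its dilation derivative is
  \<open>- \<parallel>x\<parallel>\<^sup>2 / v\<close> times the density.
\<close>

lemma nn_integral_gauss_norm_sq:
  fixes v :: real
  assumes v: "v > 0"
  shows "(\<integral>\<^sup>+x. ennreal (gauss (0 :: real ^ 'p) v x * (norm x)\<^sup>2) \<partial>lborel) = ennreal (real CARD('p) * v)"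
proof -
  let ?g = "gauss (0 :: real ^ 'p) v"
  \<comment> \<open>\<open>q \<le> e\<^sup>q\<close> trades the factor \<open>\<parallel>x\<parallel>\<^sup>2\<close> for a doubled variance, which gives integrability.\<close>
  have bound: "?g x * (norm x)\<^sup>2 \<le> (4 * v * 2 powr (real CARD('p) / 2)) * gauss 0 (2 * v) x" for x
  proof -
    let ?q = "(norm x)\<^sup>2 / (4 * v)"
    have "?q \<le> exp ?q" using exp_ge_add_one_self[of ?q] by linarith
    then have "?q * exp (- (2 * ?q)) \<le> exp ?q * exp (- (2 * ?q))" by (intro mult_right_mono) auto
    also have "\<dots> = exp (- ?q)" by (simp add: exp_add[symmetric])
    finally have *: "(norm x)\<^sup>2 * exp (- (2 * ?q)) \<le> 4 * v * exp (- ?q)"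
      using v by (simp add: field_simps)
    have "(2 * pi * v) powr (- (real CARD('p) / 2))
        = 2 powr (real CARD('p) / 2) * (2 * pi * (2 * v)) powr (- (real CARD('p) / 2))"
    proof -
      have "(2 * pi * (2 * v)) powr (- (real CARD('p) / 2))
          = (2 * (2 * pi * v)) powr (- (real CARD('p) / 2))"
        by (simp add: mult_ac)
      also have "\<dots> = 2 powr (- (real CARD('p) / 2)) * (2 * pi * v) powr (- (real CARD('p) / 2))"
        by (rule powr_mult)
      finally show ?thesis by (simp add: powr_minus)
    qed
    then show ?thesis
      using mult_left_mono[OF *, of "(2 * pi * v) powr (- (real CARD('p) / 2))"] v
      by (simp add: gauss_def mult_ac)
  qed
  have int: "integrable lborel (\<lambda>x. ?g x * (norm x)\<^sup>2)"
  proof (rule Bochner_Integration.integrable_bound)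
    show "integrable lborel (\<lambda>x. (4 * v * 2 powr (real CARD('p) / 2)) * gauss (0 :: real ^ 'p) (2 * v) x)"
      using v by (intro integrable_mult_right integrable_gauss) auto
    show "AE x in lborel. norm (?g x * (norm x)\<^sup>2)
        \<le> norm ((4 * v * 2 powr (real CARD('p) / 2)) * gauss 0 (2 * v) x)"
      using v by (intro AE_I2) (auto simp: abs_mult intro!: order.trans[OF bound])
  qed measurable
  have "real DIM(real ^ 'p) * (\<integral>x. ?g x \<partial>lborel) + (\<integral>x. - (?g x * (norm x)\<^sup>2) / v \<partial>lborel) = 0"
  proof (rule integral_divergence_radial)
    show "integrable lborel ?g" by (rule integrable_gauss[OF v])
    show "integrable lborel (\<lambda>x. - (?g x * (norm x)\<^sup>2) / v)" using int by simp
    fix x :: "real ^ 'p" and \<tau>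
    show "((\<lambda>\<tau>. ?g (exp \<tau> *\<^sub>R x)) has_real_derivative
        - (?g (exp \<tau> *\<^sub>R x) * (norm (exp \<tau> *\<^sub>R x))\<^sup>2) / v) (at \<tau>)"
      using v unfolding gauss_def
      by (auto intro!: derivative_eq_intros simp: power_mult_distrib power2_eq_square field_simps)
    show "continuous_on UNIV (\<lambda>\<tau>. - (?g (exp \<tau> *\<^sub>R x) * (norm (exp \<tau> *\<^sub>R x))\<^sup>2) / v)"
      using v unfolding gauss_def by (intro continuous_intros) auto
  qed
  then have "(\<integral>x. ?g x * (norm x)\<^sup>2 \<partial>lborel) = real CARD('p) * v"
    using v by (simp add: integral_gauss field_simps)
  with int show ?thesis by (subst nn_integral_eq_integral) auto
qed

lemma nn_integral_gauss_shift:
  fixes \<mu> :: "real ^ 'p"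
  assumes [measurable]: "f \<in> borel_measurable borel"
  shows "(\<integral>\<^sup>+x. ennreal (gauss \<mu> v x) * f x \<partial>lborel) = (\<integral>\<^sup>+x. ennreal (gauss 0 v x) * f (\<mu> + x) \<partial>lborel)"
  by (subst nn_integral_lborel_affine[of _ 1 \<mu>]) (auto simp: gauss_def)

lemma nn_integral_gauss_reflect:
  fixes f :: "real ^ 'p \<Rightarrow> ennreal"
  assumes [measurable]: "f \<in> borel_measurable borel"
  shows "(\<integral>\<^sup>+x. ennreal (gauss 0 v x) * f x \<partial>lborel) = (\<integral>\<^sup>+x. ennreal (gauss 0 v x) * f (- x) \<partial>lborel)"
  by (subst nn_integral_lborel_affine[of _ "-1" 0]) (auto simp: gauss_def)

text \<open>
  The bias-variance decomposition. Averaging over the reflection of \<open>x - \<mu>\<close> removes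
  the cross term by the parallelogram law, so that only non-negative integrands occur.
\<close>

lemma nn_integral_gauss_dist_sq:
  fixes d \<mu> :: "real ^ 'p"
  assumes v: "v > 0"
  shows "(\<integral>\<^sup>+x. ennreal (gauss \<mu> v x * (norm (d - x))\<^sup>2) \<partial>lborel)
    = ennreal ((norm (d - \<mu>))\<^sup>2 + real CARD('p) * v)"
proof -
  let ?g = "gauss (0 :: real ^ 'p) v"
  define e where "e = d - \<mu>"
  define I where "I = (\<integral>\<^sup>+x. ennreal (?g x) * ennreal ((norm (e - x))\<^sup>2) \<partial>lborel)"
  have "(\<integral>\<^sup>+x. ennreal (gauss \<mu> v x * (norm (d - x))\<^sup>2) \<partial>lborel)
      = (\<integral>\<^sup>+x. ennreal (gauss \<mu> v x) * ennreal ((norm (d - x))\<^sup>2) \<partial>lborel)"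
    by (simp add: ennreal_mult)
  also have "\<dots> = I"
    unfolding I_def e_def
    by (subst nn_integral_gauss_shift) (auto simp: algebra_simps)
  finally have 1: "(\<integral>\<^sup>+x. ennreal (gauss \<mu> v x * (norm (d - x))\<^sup>2) \<partial>lborel) = I" .
  have "I = (\<integral>\<^sup>+x. ennreal (?g x) * ennreal ((norm (e + x))\<^sup>2) \<partial>lborel)"
    unfolding I_def by (subst nn_integral_gauss_reflect) auto
  then have "I + I = (\<integral>\<^sup>+x. ennreal (?g x) * ennreal ((norm (e - x))\<^sup>2)
      + ennreal (?g x) * ennreal ((norm (e + x))\<^sup>2) \<partial>lborel)"
    by (subst nn_integral_add) (auto simp: I_def)
  also have "\<dots> = (\<integral>\<^sup>+x. ennreal (2 * (norm e)\<^sup>2) * ennreal (?g x) + 2 * ennreal (?g x * (norm x)\<^sup>2) \<partial>lborel)"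
  proof (rule nn_integral_cong)
    fix x
    have "(norm (e - x))\<^sup>2 + (norm (e + x))\<^sup>2 = 2 * (norm e)\<^sup>2 + 2 * (norm x)\<^sup>2"
      by (simp add: power2_norm_eq_inner inner_simps inner_commute)
    then have "?g x * ((norm (e - x))\<^sup>2 + (norm (e + x))\<^sup>2) = ?g x * (2 * (norm e)\<^sup>2 + 2 * (norm x)\<^sup>2)"
      by (rule arg_cong)
    then have "?g x * (norm (e - x))\<^sup>2 + ?g x * (norm (e + x))\<^sup>2
        = 2 * (norm e)\<^sup>2 * ?g x + 2 * (?g x * (norm x)\<^sup>2)"
      by (simp add: algebra_simps)
    from arg_cong[OF this, of ennreal]
    show "ennreal (?g x) * ennreal ((norm (e - x))\<^sup>2) + ennreal (?g x) * ennreal ((norm (e + x))\<^sup>2)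
        = ennreal (2 * (norm e)\<^sup>2) * ennreal (?g x) + 2 * ennreal (?g x * (norm x)\<^sup>2)"
      by (simp add: ennreal_mult ennreal_plus)
  qed
  also have "\<dots> = ennreal (2 * (norm e)\<^sup>2) + 2 * ennreal (real CARD('p) * v)"
    by (simp add: nn_integral_add nn_integral_cmult nn_integral_gauss[OF v] nn_integral_gauss_norm_sq[OF v])
  also have "\<dots> = 2 * ennreal ((norm e)\<^sup>2 + real CARD('p) * v)"
    using v by (simp add: ennreal_mult ennreal_plus distrib_left)
  finally have "2 * I = 2 * ennreal ((norm e)\<^sup>2 + real CARD('p) * v)"
    by (simp only: mult_2[of I])
  then have "I = ennreal ((norm e)\<^sup>2 + real CARD('p) * v)"
    by (subst (asm) ennreal_mult_cancel_left) auto
  with 1 show ?thesis by (simp add: e_def)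
qed

text \<open>
  Bayes' rule for the normal prior with variance \<open>v (1 - t) / t\<close>: prior times likelihood is marginal
  times posterior. In this parametrisation \<open>t\<close> is the posterior shrinkage factor.
\<close>

lemma gauss_bayes:
  fixes x \<theta> :: "real ^ 'p"
  assumes v: "v > 0" and t: "0 < t" "t < 1"
  shows "gauss 0 (v * (1 - t) / t) \<theta> * gauss \<theta> v x
    = gauss 0 (v / t) x * gauss ((1 - t) *\<^sub>R x) (v * (1 - t)) \<theta>"
proof -
  let ?m = "- (real CARD('p) / 2)"
  have E: "(2 * pi * (v * (1 - t) / t)) * (2 * pi * v) = (2 * pi * (v / t)) * (2 * pi * (v * (1 - t)))"
    by (simp add: field_simps)
  have 1: "(2 * pi * (v * (1 - t) / t)) powr ?m * (2 * pi * v) powr ?m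
      = (2 * pi * (v / t)) powr ?m * (2 * pi * (v * (1 - t))) powr ?m"
    by (subst (1 2) powr_mult[symmetric]) (simp only: E)
  have 2: "(norm \<theta>)\<^sup>2 / (2 * (v * (1 - t) / t)) + (norm (x - \<theta>))\<^sup>2 / (2 * v)
      = (norm x)\<^sup>2 / (2 * (v / t)) + (norm (\<theta> - (1 - t) *\<^sub>R x))\<^sup>2 / (2 * (v * (1 - t)))"
    using v t
    by (simp add: power2_norm_eq_inner inner_simps inner_commute divide_simps)
       (simp add: algebra_simps power2_eq_square)
  have 3: "exp (- ((norm \<theta>)\<^sup>2 / (2 * (v * (1 - t) / t)))) * exp (- ((norm (x - \<theta>))\<^sup>2 / (2 * v)))
      = exp (- ((norm x)\<^sup>2 / (2 * (v / t)))) * exp (- ((norm (\<theta> - (1 - t) *\<^sub>R x))\<^sup>2 / (2 * (v * (1 - t)))))"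
    using 2 by (simp add: exp_add[symmetric])
  show ?thesis
  proof -
    have "a * b * (c * d) = a' * b' * (c' * d')" if "a * c = a' * c'" "b * d = b' * d'" for a b c d a' b' c' d' :: real
      using that by (metis mult.assoc mult.left_commute)
    from this[OF 1 3] show ?thesis unfolding gauss_def by simp
  qed
qed

section \<open>Chi-square densities and the density of the sample\<close>

definition chi_dens :: "nat \<Rightarrow> real \<Rightarrow> real" where
  "chi_dens n u = (if u > 0 then
     u powr (real n / 2 - 1) * exp (- (u / 2)) / (2 powr (real n / 2) * Gamma (real n / 2)) else 0)"

lemma chi_dens_nonneg [simp]: "0 \<le> chi_dens n u"
  by (cases "n = 0") (auto simp: chi_dens_def Gamma_real_pos intro!: divide_nonneg_nonneg less_imp_le)

lemma chi_dens_pos: "n > 0 \<Longrightarrow> u > 0 \<Longrightarrow> 0 < chi_dens n u"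
  by (auto simp: chi_dens_def intro!: divide_pos_pos mult_pos_pos Gamma_real_pos)

lemma borel_measurable_chi_dens [measurable]: "chi_dens n \<in> borel_measurable borel"
  unfolding chi_dens_def by measurable

lemma nn_integral_chi_dens_powr:
  assumes n: "n > 0" and m: "real n / 2 + m > 0"
  shows "(\<integral>\<^sup>+u. ennreal (chi_dens n u * u powr m) \<partial>lborel)
    = ennreal (2 powr m * Gamma (real n / 2 + m) / Gamma (real n / 2))"
proof -
  let ?a = "real n / 2 + m"
  let ?c = "2 powr m / Gamma (real n / 2)"
  let ?f = "\<lambda>t. ennreal (indicator {0..} t * t powr (?a - 1) / exp t)"
  have G: "Gamma (real n / 2) > 0" using n by (intro Gamma_real_pos) auto
  have eq: "ennreal (chi_dens n u * u powr m) = ennreal (?c / 2) * ?f (0 + (1 / 2) * u)" for u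
  proof (cases "u > 0")
    case True
    have "chi_dens n u * u powr m = (u powr (real n / 2 - 1) * u powr m) * exp (- (u / 2)) / (2 powr (real n / 2) * Gamma (real n / 2))"
      using True by (simp add: chi_dens_def)
    also have "u powr (real n / 2 - 1) * u powr m = 2 powr (?a - 1) * (u / 2) powr (?a - 1)"
      using True by (simp add: powr_add[symmetric] powr_divide algebra_simps)
    also have "2 powr (?a - 1) = 2 powr (real n / 2) * 2 powr m / 2"
      by (simp add: powr_add powr_diff)
    also have "2 powr (real n / 2) * 2 powr m / 2 * (u / 2) powr (?a - 1) * exp (- (u / 2)) / (2 powr (real n / 2) * Gamma (real n / 2))
        = ?c / 2 * (indicator {0..} (0 + (1 / 2) * u) * (0 + (1 / 2) * u) powr (?a - 1) / exp (0 + (1 / 2) * u))"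
      using True by (simp add: exp_minus field_simps)
    finally show ?thesis
      using G by (simp only: ) (subst ennreal_mult', auto)
  next
    case False
    then show ?thesis by (cases "u = 0") (auto simp: chi_dens_def)
  qed
  have "(\<integral>\<^sup>+u. ennreal (chi_dens n u * u powr m) \<partial>lborel)
      = ennreal ?c * (ennreal \<bar>1 / 2\<bar> * (\<integral>\<^sup>+u. ?f (0 + (1 / 2) * u) \<partial>lborel))"
  proof -
    have "ennreal (?c / 2) = ennreal ?c * ennreal \<bar>1 / 2\<bar>"
      using G by (subst ennreal_mult[symmetric]) auto
    then show ?thesis
      unfolding eq by (subst nn_integral_cmult) (auto simp only: mult.assoc, measurable)
  qed
  also have "ennreal \<bar>1 / 2\<bar> * (\<integral>\<^sup>+u. ?f (0 + (1 / 2) * u) \<partial>lborel) = (\<integral>\<^sup>+t. ?f t \<partial>lborel)"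
    by (rule nn_integral_real_affine[symmetric]) auto
  also have "(\<integral>\<^sup>+t. ?f t \<partial>lborel) = ennreal (Gamma ?a)"
    by (rule Gamma_conv_nn_integral_real[OF m, symmetric])
  finally show ?thesis
    using G m by (simp add: ennreal_mult[symmetric] Gamma_real_pos less_imp_le)
qed

lemma nn_integral_chi_dens: "n > 0 \<Longrightarrow> (\<integral>\<^sup>+u. ennreal (chi_dens n u) \<partial>lborel) = 1"
proof -
  assume n: "n > 0"
  have "(\<lambda>u. ennreal (chi_dens n u * u powr 0)) = (\<lambda>u. ennreal (chi_dens n u))"
    by (auto simp: chi_dens_def)
  moreover have "Gamma (real n / 2) > 0" using n by (intro Gamma_real_pos) auto
  moreover have "(\<integral>\<^sup>+u. ennreal (chi_dens n u * u powr 0) \<partial>lborel)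
      = ennreal (2 powr 0 * Gamma (real n / 2 + 0) / Gamma (real n / 2))"
    by (rule nn_integral_chi_dens_powr) (use n in auto)
  ultimately show ?thesis by simp
qed

lemma nn_integral_chi_dens_scale:
  assumes v: "v > 0" and [measurable]: "f \<in> borel_measurable borel"
  shows "(\<integral>\<^sup>+s. ennreal (chi_dens n (s / v) / v) * f s \<partial>lborel)
    = (\<integral>\<^sup>+u. ennreal (chi_dens n u) * f (v * u) \<partial>lborel)"
proof -
  have "(\<integral>\<^sup>+s. ennreal (chi_dens n (s / v) / v) * f s \<partial>lborel)
     = ennreal \<bar>v\<bar> * (\<integral>\<^sup>+u. ennreal (chi_dens n ((0 + v * u) / v) / v) * f (0 + v * u) \<partial>lborel)"
    by (rule nn_integral_real_affine) (use v in auto)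
  also have "\<dots> = (\<integral>\<^sup>+u. ennreal v * (ennreal (chi_dens n u / v) * f (v * u)) \<partial>lborel)"
    using v by (subst nn_integral_cmult) auto
  also have "\<dots> = (\<integral>\<^sup>+u. ennreal (chi_dens n u) * f (v * u) \<partial>lborel)"
    using v by (intro nn_integral_cong) (simp add: mult.assoc[symmetric] ennreal_mult[symmetric])
  finally show ?thesis .
qed

definition sample_dens :: "nat \<Rightarrow> real ^ 'p \<Rightarrow> real \<Rightarrow> real \<Rightarrow> (real ^ 'p) \<times> real \<Rightarrow> real" where
  "sample_dens n \<mu> \<tau> v z = gauss \<mu> \<tau> (fst z) * (chi_dens n (snd z / v) / v)"

lemma sample_dens_nonneg [simp]: "v > 0 \<Longrightarrow> 0 \<le> sample_dens n \<mu> \<tau> v z"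
  by (simp add: sample_dens_def)

lemma borel_measurable_sample_dens [measurable (raw)]:
  assumes [measurable]: "f \<in> M \<rightarrow>\<^sub>M borel" "g \<in> borel_measurable M" "h \<in> borel_measurable M"
    "k \<in> M \<rightarrow>\<^sub>M borel"
  shows "(\<lambda>z. sample_dens n (f z) (g z) (h z) (k z)) \<in> borel_measurable M"
proof -
  have [measurable]: "k \<in> M \<rightarrow>\<^sub>M borel \<Otimes>\<^sub>M borel"
    using assms(4) by (simp add: borel_prod)
  show ?thesis unfolding sample_dens_def by measurable
qed

lemma nn_integral_sample_dens:
  fixes f :: "(real ^ 'p) \<times> real \<Rightarrow> ennreal"
  assumes v: "v > 0" and [measurable]: "f \<in> borel_measurable borel"
  shows "(\<integral>\<^sup>+z. ennreal (sample_dens n \<mu> \<tau> v z) * f z \<partial>lborel)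
    = (\<integral>\<^sup>+x. ennreal (gauss \<mu> \<tau> x) * (\<integral>\<^sup>+u. ennreal (chi_dens n u) * f (x, v * u) \<partial>lborel) \<partial>lborel)"
proof -
  have "(\<integral>\<^sup>+z. ennreal (sample_dens n \<mu> \<tau> v z) * f z \<partial>lborel)
      = (\<integral>\<^sup>+z. ennreal (sample_dens n \<mu> \<tau> v z) * f z \<partial>(lborel \<Otimes>\<^sub>M lborel))"
    by (simp add: lborel_prod)
  also have "\<dots> = (\<integral>\<^sup>+x. \<integral>\<^sup>+s. ennreal (sample_dens n \<mu> \<tau> v (x, s)) * f (x, s) \<partial>lborel \<partial>lborel)"
    by (rule lborel.nn_integral_fst[symmetric]) (simp add: lborel_prod)
  also have "\<dots> = (\<integral>\<^sup>+x. ennreal (gauss \<mu> \<tau> x) * (\<integral>\<^sup>+s. ennreal (chi_dens n (s / v) / v) * f (x, s) \<partial>lborel) \<partial>lborel)"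
  proof (intro nn_integral_cong)
    fix x
    have "ennreal (sample_dens n \<mu> \<tau> v (x, s)) = ennreal (gauss \<mu> \<tau> x) * ennreal (chi_dens n (s / v) / v)" for s
      unfolding sample_dens_def fst_conv snd_conv using v by (intro ennreal_mult) auto
    then show "(\<integral>\<^sup>+s. ennreal (sample_dens n \<mu> \<tau> v (x, s)) * f (x, s) \<partial>lborel)
        = ennreal (gauss \<mu> \<tau> x) * (\<integral>\<^sup>+s. ennreal (chi_dens n (s / v) / v) * f (x, s) \<partial>lborel)"
      by (simp only: mult.assoc) (rule nn_integral_cmult, measurable)
  qed
  also have "\<dots> = (\<integral>\<^sup>+x. ennreal (gauss \<mu> \<tau> x) * (\<integral>\<^sup>+u. ennreal (chi_dens n u) * f (x, v * u) \<partial>lborel) \<partial>lborel)"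
    using v by (intro nn_integral_cong, subst nn_integral_chi_dens_scale) auto
  finally show ?thesis .
qed

lemma nn_integral_sample_dens_1:
  assumes "v > 0" "\<tau> > 0" "n > 0"
  shows "(\<integral>\<^sup>+z. ennreal (sample_dens n (\<mu> :: real ^ 'p) \<tau> v z) \<partial>lborel) = 1"
  using nn_integral_sample_dens[of v "\<lambda>_. 1" n \<mu> \<tau>] assms
  by (simp add: nn_integral_chi_dens nn_integral_gauss)

text \<open>
  Expectations under the sample law become Lebesgue integrals over all of \<open>\<real>\<^sup>p \<times> \<real>\<close>; the density
  vanishes off \<open>\<real>\<^sup>p \<times> (0, \<infinity>)\<close>, so any Borel extension of the integrand serves.
\<close>

lemma nn_integral_sample_law:
  fixes f :: "(real ^ 'p) \<times> real \<Rightarrow> ennreal"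
  assumes v: "v > 0" and n: "n > 0"
    and f [measurable]: "f \<in> borel_measurable (borel \<Otimes>\<^sub>M restrict_space borel {0<..})"
    and g [measurable]: "g \<in> borel_measurable borel"
    and fg: "\<And>x s. s > 0 \<Longrightarrow> f (x, s) = g (x, s)"
  shows "(\<integral>\<^sup>+z. f z \<partial>sample_law n \<theta> v) = (\<integral>\<^sup>+z. ennreal (sample_dens n \<theta> v v z) * g z \<partial>lborel)"
proof -
  let ?R = "restrict_space borel {0<..} :: real measure"
  let ?S = "distr (chi_square n) ?R (\<lambda>s. v * s)"
  let ?c = "\<lambda>s. ennreal (s powr (real n / 2 - 1) * exp (- (s / 2)) / (2 powr (real n / 2) * Gamma (real n / 2)))"
  have [measurable]: "?c \<in> borel_measurable (restrict_space lborel {0<..})"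
    by (rule measurable_restrict_space1) measurable
  have chi: "(\<integral>\<^sup>+s. h s \<partial>chi_square n) = (\<integral>\<^sup>+s. ennreal (chi_dens n s) * h s \<partial>lborel)"
    if [measurable]: "h \<in> borel_measurable ?R" for h
  proof -
    have [measurable]: "h \<in> borel_measurable (restrict_space lborel {0<..})"
      using that by (simp add: measurable_def space_restrict_space sets_restrict_space)
    have "(\<integral>\<^sup>+s. h s \<partial>chi_square n) = (\<integral>\<^sup>+s. ?c s * h s \<partial>restrict_space lborel {0<..})"
      unfolding chi_square_def by (rule nn_integral_density) auto
    also have "\<dots> = (\<integral>\<^sup>+s. ?c s * h s * indicator {0<..} s \<partial>lborel)"
      by (rule nn_integral_restrict_space) auto
    also have "\<dots> = (\<integral>\<^sup>+s. ennreal (chi_dens n s) * h s \<partial>lborel)"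
      by (intro nn_integral_cong) (auto simp: chi_dens_def)
    finally show ?thesis .
  qed
  have scale [measurable]: "(\<lambda>s. v * s) \<in> chi_square n \<rightarrow>\<^sub>M ?R"
  proof -
    have "(\<lambda>s. v * s) \<in> restrict_space borel {0<..} \<rightarrow>\<^sub>M ?R"
      using v by (intro measurable_restrict_space3) auto
    then show ?thesis
      by (simp add: chi_square_def measurable_def space_restrict_space sets_restrict_space)
  qed
  have "prob_space (chi_square n)"
  proof
    have "emeasure (chi_square n) (space (chi_square n)) = (\<integral>\<^sup>+s. 1 \<partial>chi_square n)" by simp
    also have "\<dots> = 1" using chi[of "\<lambda>_. 1"] n by (simp add: nn_integral_chi_dens)
    finally show "emeasure (chi_square n) (space (chi_square n)) = 1" .
  qed
  then interpret C: prob_space "chi_square n" .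
  interpret S: prob_space ?S by (rule C.prob_space_distr) (rule scale)
  have sets_mv: "sets (mvnormal \<theta> v) = sets borel" by (simp add: mvnormal_def)
  have fm: "f \<in> borel_measurable (mvnormal \<theta> v \<Otimes>\<^sub>M ?S)"
    using f by (simp add: measurable_cong_sets[OF sets_pair_measure_cong[OF sets_mv sets_distr] refl])
  have fx: "(\<lambda>s. f (x, s)) \<in> borel_measurable ?R" for x
    by (rule measurable_compose[OF measurable_Pair1' f]) simp
  have "(\<integral>\<^sup>+z. f z \<partial>sample_law n \<theta> v) = (\<integral>\<^sup>+x. \<integral>\<^sup>+s. f (x, s) \<partial>?S \<partial>mvnormal \<theta> v)"
    unfolding sample_law_def by (rule S.nn_integral_fst[symmetric, OF fm])
  also have "(\<lambda>x. \<integral>\<^sup>+s. f (x, s) \<partial>?S) = (\<lambda>x. \<integral>\<^sup>+u. ennreal (chi_dens n u) * g (x, v * u) \<partial>lborel)"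
  proof
    fix x
    have "(\<integral>\<^sup>+s. f (x, s) \<partial>?S) = (\<integral>\<^sup>+u. f (x, v * u) \<partial>chi_square n)"
      by (rule nn_integral_distr[OF scale]) (use fx in simp)
    also have "\<dots> = (\<integral>\<^sup>+u. ennreal (chi_dens n u) * f (x, v * u) \<partial>lborel)"
      by (rule chi) (rule measurable_compose[OF _ fx], use v in \<open>auto intro!: measurable_restrict_space3\<close>)
    also have "\<dots> = (\<integral>\<^sup>+u. ennreal (chi_dens n u) * g (x, v * u) \<partial>lborel)"
      using v by (intro nn_integral_cong) (auto simp: chi_dens_def fg)
    finally show "(\<integral>\<^sup>+s. f (x, s) \<partial>?S) = (\<integral>\<^sup>+u. ennreal (chi_dens n u) * g (x, v * u) \<partial>lborel)" .
  qed
  also have "(\<integral>\<^sup>+x. \<integral>\<^sup>+u. ennreal (chi_dens n u) * g (x, v * u) \<partial>lborel \<partial>mvnormal \<theta> v)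
      = (\<integral>\<^sup>+x. ennreal (gauss \<theta> v x) * (\<integral>\<^sup>+u. ennreal (chi_dens n u) * g (x, v * u) \<partial>lborel) \<partial>lborel)"
    unfolding mvnormal_def gauss_def[symmetric]
    by (rule nn_integral_density) (auto simp: gauss_def borel_prod[symmetric])
  also have "\<dots> = (\<integral>\<^sup>+z. ennreal (sample_dens n \<theta> v v z) * g z \<partial>lborel)"
    by (rule nn_integral_sample_dens[OF v g, symmetric])
  finally show ?thesis .
qed

lemma borel_measurable_fst_snd_borel [measurable]:
  "(\<lambda>z :: 'a::euclidean_space \<times> 'b::euclidean_space. fst z) \<in> borel \<rightarrow>\<^sub>M borel"
  "(\<lambda>z :: 'a::euclidean_space \<times> 'b::euclidean_space. snd z) \<in> borel \<rightarrow>\<^sub>M borel"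
  by (intro borel_measurable_continuous_onI continuous_intros)+

text \<open>
  Extension by zero turns measurability on \<open>\<real>\<^sup>p \<times> (0, \<infinity>)\<close> into Borel measurability on the
  whole product.
\<close>

definition borel_version :: "((real ^ 'p) \<times> real \<Rightarrow> real ^ 'p) \<Rightarrow> (real ^ 'p) \<times> real \<Rightarrow> real ^ 'p" where
  "borel_version \<delta> z = (if snd z > 0 then \<delta> z else 0)"

lemma borel_measurable_borel_version:
  assumes "estimator \<delta>"
  shows "borel_version \<delta> \<in> borel_measurable borel"
proof -
  let ?M = "restrict_space (borel :: ((real ^ 'p) \<times> real) measure) {z. snd z > 0}"
  have id: "(\<lambda>z. (fst z, snd z)) \<in> ?M \<rightarrow>\<^sub>M borel \<Otimes>\<^sub>M restrict_space borel {0<..}"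
  proof (rule measurable_Pair)
    show "fst \<in> ?M \<rightarrow>\<^sub>M borel" by (rule measurable_restrict_space1) (intro borel_measurable_continuous_onI continuous_intros)
    show "snd \<in> ?M \<rightarrow>\<^sub>M restrict_space borel {0<..}"
    proof (rule measurable_restrict_space3)
      show "snd \<in> borel_measurable (borel :: ((real ^ 'p) \<times> real) measure)"
        by (intro borel_measurable_continuous_onI continuous_intros)
    qed auto
  qed
  have "\<delta> \<in> ?M \<rightarrow>\<^sub>M borel"
    using measurable_compose[OF id assms[unfolded estimator_def]] by simp
  moreover have "{z :: (real ^ 'p) \<times> real. snd z > 0} \<in> sets borel"
    by (intro borel_open open_Collect_less continuous_intros)
  ultimately show ?thesis
    unfolding borel_version_def by (subst measurable_If_restrict_space_iff) auto
qed

lemma risk_eq: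
  fixes \<delta> :: "(real ^ 'p) \<times> real \<Rightarrow> real ^ 'p"
  assumes v: "v > 0" and n: "n > 0" and \<delta>: "estimator \<delta>"
  shows "risk n \<theta> v \<delta> = (\<integral>\<^sup>+z. ennreal (sample_dens n \<theta> v v z) * ennreal (loss (borel_version \<delta> z) \<theta> v) \<partial>lborel)"
proof -
  note [measurable] = borel_measurable_borel_version[OF \<delta>] \<delta>[unfolded estimator_def]
  show ?thesis
    unfolding risk_def
  proof (rule nn_integral_sample_law[OF v n])
    show "(\<lambda>z. ennreal (loss (\<delta> z) \<theta> v)) \<in> borel_measurable (borel \<Otimes>\<^sub>M restrict_space borel {0<..})"
      unfolding loss_def by measurable
    show "(\<lambda>z. ennreal (loss (borel_version \<delta> z) \<theta> v)) \<in> borel_measurable borel"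
      unfolding loss_def by measurable
  qed (auto simp: borel_version_def)
qed

section \<open>Stein identities for the normal and chi-square laws\<close>

lemma integrable_gauss_dist_sq:
  fixes d \<mu> :: "real ^ 'p"
  assumes "v > 0"
  shows "integrable lborel (\<lambda>x. gauss \<mu> v x * (norm (d - x))\<^sup>2)"
  using nn_integral_gauss_dist_sq[OF assms, of \<mu> d] by (auto simp: integrable_iff_bounded)

lemma integral_gauss_dist_sq:
  fixes d \<mu> :: "real ^ 'p"
  assumes "v > 0"
  shows "(\<integral>x. gauss \<mu> v x * (norm (d - x))\<^sup>2 \<partial>lborel) = (norm (d - \<mu>))\<^sup>2 + real CARD('p) * v"
  using nn_integral_gauss_dist_sq[OF assms, of \<mu> d] assms
  by (simp add: integral_eq_nn_integral ennreal_plus[symmetric] del: ennreal_plus)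

text \<open>
  Stein's identity for the field \<open>x \<mapsto> r(\<parallel>x\<parallel>\<^sup>2) x\<close>: the right-hand side integrates its divergence
  \<open>p r + 2 \<parallel>x\<parallel>\<^sup>2 r'\<close>. The radial divergence identity is applied to \<open>r(\<parallel>x\<parallel>\<^sup>2)\<close> times the density.
\<close>

lemma gauss_stein_radial:
  fixes \<theta> :: "real ^ 'p" and r r' :: "real \<Rightarrow> real"
  assumes v: "v > 0"
    and r: "\<And>q. q \<ge> 0 \<Longrightarrow> (r has_real_derivative r' q) (at q)"
    and bd: "\<And>q. q \<ge> 0 \<Longrightarrow> \<bar>r q\<bar> \<le> B" "\<And>q. q \<ge> 0 \<Longrightarrow> \<bar>q * r' q\<bar> \<le> B"
    and cont: "continuous_on {0..} r'"
    and [measurable]: "r \<in> borel_measurable borel" "r' \<in> borel_measurable borel"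
  shows "integrable lborel (\<lambda>x. gauss \<theta> v x * (r ((norm x)\<^sup>2) * ((x - \<theta>) \<bullet> x) / v))"
    and "integrable lborel (\<lambda>x. gauss \<theta> v x * (real CARD('p) * r ((norm x)\<^sup>2) + 2 * (norm x)\<^sup>2 * r' ((norm x)\<^sup>2)))"
    and "(\<integral>x. gauss \<theta> v x * (r ((norm x)\<^sup>2) * ((x - \<theta>) \<bullet> x) / v) \<partial>lborel)
       = (\<integral>x. gauss \<theta> v x * (real CARD('p) * r ((norm x)\<^sup>2) + 2 * (norm x)\<^sup>2 * r' ((norm x)\<^sup>2)) \<partial>lborel)"
proof -
  let ?q = "\<lambda>x :: real ^ 'p. (norm x)\<^sup>2"
  let ?a = "\<lambda>x. gauss \<theta> v x * r (?q x)"
  let ?b = "\<lambda>x. gauss \<theta> v x * (?q x * r' (?q x))"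
  let ?c = "\<lambda>x. gauss \<theta> v x * (r (?q x) * ((x - \<theta>) \<bullet> x) / v)"
  have B: "B \<ge> 0" using bd(1)[of 0] by linarith
  have g: "integrable lborel (\<lambda>x. B * gauss \<theta> v x)" using integrable_gauss[OF v, of \<theta>] by simp
  have a: "integrable lborel ?a"
    by (rule Bochner_Integration.integrable_bound[OF g])
       (use bd(1) B in \<open>auto simp: abs_mult mult.commute[of B] intro!: AE_I2 mult_left_mono\<close>)
  have b: "integrable lborel ?b"
    by (rule Bochner_Integration.integrable_bound[OF g])
       (use bd(2) B in \<open>auto simp: abs_mult mult.commute[of B] intro!: AE_I2 mult_left_mono\<close>)
  have dist: "integrable lborel (\<lambda>x. (B / v) * (gauss \<theta> v x * (norm (\<theta> - x))\<^sup>2 + gauss \<theta> v x * (norm (0 - x))\<^sup>2))"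
    using integrable_gauss_dist_sq[OF v, of \<theta> \<theta>] integrable_gauss_dist_sq[OF v, of \<theta> 0] by simp
  have c: "integrable lborel ?c"
  proof (rule Bochner_Integration.integrable_bound[OF dist])
    show "AE x in lborel. norm (?c x) \<le> norm ((B / v) * (gauss \<theta> v x * (norm (\<theta> - x))\<^sup>2 + gauss \<theta> v x * (norm (0 - x))\<^sup>2))"
    proof (rule AE_I2)
      fix x
      have "\<bar>(x - \<theta>) \<bullet> x\<bar> \<le> norm (x - \<theta>) * norm x" by (rule Cauchy_Schwarz_ineq2)
      also have "\<dots> \<le> (norm (x - \<theta>))\<^sup>2 + (norm x)\<^sup>2"
        using sum_squares_bound[of "norm (x - \<theta>)" "norm x"]
          mult_nonneg_nonneg[OF norm_ge_zero[of "x - \<theta>"] norm_ge_zero[of x]] by linarith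
      finally have "\<bar>r (?q x)\<bar> * \<bar>(x - \<theta>) \<bullet> x\<bar> \<le> B * ((norm (x - \<theta>))\<^sup>2 + (norm x)\<^sup>2)"
        by (intro mult_mono bd B) auto
      then have "gauss \<theta> v x * (\<bar>r (?q x)\<bar> * \<bar>(x - \<theta>) \<bullet> x\<bar> / v)
          \<le> gauss \<theta> v x * (B * ((norm (x - \<theta>))\<^sup>2 + (norm x)\<^sup>2) / v)"
        using v by (intro mult_left_mono divide_right_mono) auto
      then show "norm (?c x) \<le> norm ((B / v) * (gauss \<theta> v x * (norm (\<theta> - x))\<^sup>2 + gauss \<theta> v x * (norm (0 - x))\<^sup>2))"
        using v B by (simp add: abs_mult norm_minus_commute distrib_left add_divide_distrib mult_ac)
    qed
  qed measurable
  have nsq: "(norm (exp \<tau> *\<^sub>R x))\<^sup>2 = exp (2 * \<tau>) * ?q x" for \<tau> and x :: "real ^ 'p"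
    by (simp add: power_mult_distrib exp_double)
  have ex: "exp (2 * \<tau>) = exp \<tau> * exp \<tau>" for \<tau> :: real
    by (simp add: exp_add[symmetric])
  have dsq: "(norm (exp \<tau> *\<^sub>R x - \<theta>))\<^sup>2 = exp (2 * \<tau>) * ?q x - 2 * (exp \<tau> * (x \<bullet> \<theta>)) + (norm \<theta>)\<^sup>2" for \<tau> x
    unfolding ex power2_norm_eq_inner by (simp add: inner_simps inner_commute algebra_simps)
  have inn: "(exp \<tau> *\<^sub>R x - \<theta>) \<bullet> (exp \<tau> *\<^sub>R x) = exp (2 * \<tau>) * ?q x - exp \<tau> * (x \<bullet> \<theta>)" for \<tau> x
    unfolding ex power2_norm_eq_inner by (simp add: inner_simps inner_commute algebra_simps)
  have "real DIM(real ^ 'p) * (\<integral>x. ?a x \<partial>lborel) + (\<integral>x. 2 * ?b x - ?c x \<partial>lborel) = 0"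
  proof (rule integral_divergence_radial)
    show "integrable lborel ?a" by (rule a)
    show "integrable lborel (\<lambda>x. 2 * ?b x - ?c x)" using b c by simp
    fix x :: "real ^ 'p" and \<tau> :: real
    have dr: "((\<lambda>\<tau>. r (exp (2 * \<tau>) * ?q x)) has_real_derivative
        r' (exp (2 * \<tau>) * ?q x) * (2 * exp (2 * \<tau>) * ?q x)) (at \<tau>)"
      by (rule DERIV_chain2[OF r]) (auto intro!: derivative_eq_intros)
    have dg: "((\<lambda>\<tau>. gauss \<theta> v (exp \<tau> *\<^sub>R x)) has_real_derivative
        - gauss \<theta> v (exp \<tau> *\<^sub>R x) * ((exp \<tau> *\<^sub>R x - \<theta>) \<bullet> (exp \<tau> *\<^sub>R x)) / v) (at \<tau>)"
      unfolding gauss_def dsq inn using v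
      by (auto intro!: derivative_eq_intros simp: field_simps)
    show "((\<lambda>\<tau>. ?a (exp \<tau> *\<^sub>R x)) has_real_derivative 2 * ?b (exp \<tau> *\<^sub>R x) - ?c (exp \<tau> *\<^sub>R x)) (at \<tau>)"
      unfolding nsq
      by (rule DERIV_cong[OF DERIV_mult[OF dg dr]]) (simp add: field_simps)
    have cr: "continuous_on UNIV (\<lambda>\<tau>. r (exp (2 * \<tau>) * ?q x))"
      by (rule continuous_on_compose2[of "{0..}" r])
         (auto intro!: continuous_intros continuous_at_imp_continuous_on DERIV_isCont[OF r])
    have cr': "continuous_on UNIV (\<lambda>\<tau>. r' (exp (2 * \<tau>) * ?q x))"
      by (rule continuous_on_compose2[OF cont]) (auto intro!: continuous_intros)
    show "continuous_on UNIV (\<lambda>\<tau>. 2 * ?b (exp \<tau> *\<^sub>R x) - ?c (exp \<tau> *\<^sub>R x))"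
      unfolding nsq gauss_def using v by (intro continuous_intros cr cr') auto
  qed
  then have "(\<integral>x. ?c x \<partial>lborel) = real CARD('p) * (\<integral>x. ?a x \<partial>lborel) + 2 * (\<integral>x. ?b x \<partial>lborel)"
    using b c by simp
  also have "\<dots> = (\<integral>x. real CARD('p) * ?a x + 2 * ?b x \<partial>lborel)"
    using a b by simp
  finally have eq: "(\<integral>x. ?c x \<partial>lborel) = (\<integral>x. real CARD('p) * ?a x + 2 * ?b x \<partial>lborel)" .
  have ab: "(\<lambda>x. real CARD('p) * ?a x + 2 * ?b x)
      = (\<lambda>x. gauss \<theta> v x * (real CARD('p) * r (?q x) + 2 * ?q x * r' (?q x)))"
    by (simp add: fun_eq_iff algebra_simps)
  show "integrable lborel ?c" by (rule c)
  show "integrable lborel (\<lambda>x. gauss \<theta> v x * (real CARD('p) * r (?q x) + 2 * ?q x * r' (?q x)))"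
    unfolding ab[symmetric] using a b by simp
  show "(\<integral>x. ?c x \<partial>lborel) = (\<integral>x. gauss \<theta> v x * (real CARD('p) * r (?q x) + 2 * ?q x * r' (?q x)) \<partial>lborel)"
    using eq unfolding ab .
qed

lemma integrable_chi_dens: "n > 0 \<Longrightarrow> integrable lborel (chi_dens n)"
  using nn_integral_chi_dens[of n] by (auto simp: integrable_iff_bounded)

lemma integrable_chi_dens_id: "n > 0 \<Longrightarrow> integrable lborel (\<lambda>u. chi_dens n u * u)"
proof -
  assume n: "n > 0"
  have "norm (chi_dens n u * u) = chi_dens n u * u powr 1" for u
  proof (cases "u > 0")
    case True
    then show ?thesis by (simp add: abs_mult)
  qed (simp add: chi_dens_def)
  then show ?thesis
    using nn_integral_chi_dens_powr[of n 1] n by (auto simp: integrable_iff_bounded)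
qed

text \<open>
  The chi-square analogue of Stein's identity, from the same dilation argument on the half-line:
  the dilation derivative of the density is \<open>n / 2 - 1 - u / 2\<close> times the density.
\<close>

lemma chi_stein:
  fixes h h' :: "real \<Rightarrow> real"
  assumes n: "n > 0"
    and h: "\<And>u. u > 0 \<Longrightarrow> (h has_real_derivative h' u) (at u)"
    and bd: "\<And>u. u > 0 \<Longrightarrow> \<bar>h u\<bar> \<le> B" "\<And>u. u > 0 \<Longrightarrow> \<bar>u * h' u\<bar> \<le> B"
    and cont: "continuous_on {0<..} h'"
    and [measurable]: "h \<in> borel_measurable borel" "h' \<in> borel_measurable borel"
  shows "integrable lborel (\<lambda>u. chi_dens n u * (u * h u))"
    and "integrable lborel (\<lambda>u. chi_dens n u * (real n * h u + 2 * (u * h' u)))"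
    and "(\<integral>u. chi_dens n u * (u * h u) \<partial>lborel) = (\<integral>u. chi_dens n u * (real n * h u + 2 * (u * h' u)) \<partial>lborel)"
proof -
  let ?a = "\<lambda>u. chi_dens n u * h u"
  let ?b = "\<lambda>u. chi_dens n u * (u * h' u)"
  let ?c = "\<lambda>u. chi_dens n u * (u * h u)"
  have B: "B \<ge> 0" using bd(1)[of 1] by linarith
  have g: "integrable lborel (\<lambda>x. B * chi_dens n x)" using integrable_chi_dens[OF n] by simp
  have g1: "integrable lborel (\<lambda>x. B * (chi_dens n x * x))" using integrable_chi_dens_id[OF n] by simp
  have chi0: "chi_dens n u = 0" if "u \<le> 0" for u using that by (simp add: chi_dens_def)
  have a: "integrable lborel ?a"
  proof (rule Bochner_Integration.integrable_bound[OF g])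
    show "AE u in lborel. norm (?a u) \<le> norm (B * chi_dens n u)"
    proof (rule AE_I2)
      fix u show "norm (?a u) \<le> norm (B * chi_dens n u)"
        using mult_left_mono[OF bd(1), of u "chi_dens n u"] B chi0[of u]
        by (cases "u > 0") (auto simp: abs_mult mult.commute)
    qed
  qed measurable
  have b: "integrable lborel ?b"
  proof (rule Bochner_Integration.integrable_bound[OF g])
    show "AE u in lborel. norm (?b u) \<le> norm (B * chi_dens n u)"
    proof (rule AE_I2)
      fix u show "norm (?b u) \<le> norm (B * chi_dens n u)"
        using mult_left_mono[OF bd(2), of u "chi_dens n u"] B chi0[of u]
        by (cases "u > 0") (auto simp: abs_mult mult.commute)
    qed
  qed measurable
  have c: "integrable lborel ?c"
  proof (rule Bochner_Integration.integrable_bound[OF g1])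
    show "AE u in lborel. norm (?c u) \<le> norm (B * (chi_dens n u * u))"
    proof (rule AE_I2)
      fix u show "norm (?c u) \<le> norm (B * (chi_dens n u * u))"
        using mult_left_mono[OF bd(1), of u "chi_dens n u * u"] B chi0[of u]
        by (cases "u > 0") (auto simp: abs_mult mult_ac)
    qed
  qed measurable
  have "real DIM(real) * (\<integral>x. ?a x \<partial>lborel) + (\<integral>x. (real n / 2 - 1) * ?a x - ?c x / 2 + ?b x \<partial>lborel) = 0"
  proof (rule integral_divergence_radial)
    show "integrable lborel ?a" by (rule a)
    show "integrable lborel (\<lambda>x. (real n / 2 - 1) * ?a x - ?c x / 2 + ?b x)" using a b c by simp
    fix s :: real
    let ?w = "\<lambda>\<tau>. (real n / 2 - 1) * ?a (exp \<tau> *\<^sub>R s) - ?c (exp \<tau> *\<^sub>R s) / 2 + ?b (exp \<tau> *\<^sub>R s)"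
    have chis: "chi_dens n (exp \<tau> *\<^sub>R s) = exp ((real n / 2 - 1) * \<tau>) * s powr (real n / 2 - 1)
        * exp (- (exp \<tau> * s / 2)) / (2 powr (real n / 2) * Gamma (real n / 2))" if "s > 0" for \<tau>
      using that by (simp add: chi_dens_def powr_mult powr_def[of "exp \<tau>"])
    have G: "Gamma (real n / 2) \<noteq> 0" using Gamma_real_pos[of "real n / 2"] n by (metis divide_pos_pos less_irrefl of_nat_0_less_iff zero_less_numeral)
    show "((\<lambda>\<tau>. ?a (exp \<tau> *\<^sub>R s)) has_real_derivative ?w \<tau>) (at \<tau>)" for \<tau>
    proof (cases "s > 0")
      case True
      have dh: "((\<lambda>\<tau>. h (exp \<tau> * s)) has_real_derivative h' (exp \<tau> * s) * (exp \<tau> * s)) (at \<tau>)"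
        using True by (intro DERIV_chain2[OF h]) (auto intro!: derivative_eq_intros)
      have dc: "((\<lambda>\<tau>. chi_dens n (exp \<tau> *\<^sub>R s)) has_real_derivative
          (real n / 2 - 1 - exp \<tau> * s / 2) * chi_dens n (exp \<tau> *\<^sub>R s)) (at \<tau>)"
        unfolding chis[OF True] using G
        by (auto intro!: derivative_eq_intros simp: field_simps)
      show ?thesis
        using DERIV_cong[OF DERIV_mult[OF dc[unfolded real_scaleR_def] dh]]
        by (simp add: field_simps)
    next
      case False
      then have "exp \<tau> * s \<le> 0" for \<tau> by (simp add: mult_nonneg_nonpos)
      then show ?thesis by (simp add: chi0)
    qed
    show "continuous_on UNIV ?w"
    proof (cases "s > 0")
      case True
      have ch: "continuous_on UNIV (\<lambda>\<tau>. h (exp \<tau> *\<^sub>R s))"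
        by (rule continuous_on_compose2[of "{0<..}" h])
           (use True in \<open>auto intro!: continuous_intros continuous_at_imp_continuous_on DERIV_isCont[OF h]\<close>)
      have ch': "continuous_on UNIV (\<lambda>\<tau>. h' (exp \<tau> *\<^sub>R s))"
        by (rule continuous_on_compose2[OF cont]) (use True in \<open>auto intro!: continuous_intros\<close>)
      show ?thesis
        unfolding chis[OF True] using G by (intro continuous_intros ch ch') auto
    next
      case False
      then have "exp \<tau> * s \<le> 0" for \<tau> by (simp add: mult_nonneg_nonpos)
      then show ?thesis by (simp add: chi0)
    qed
  qed
  moreover have "(\<integral>x. (real n / 2 - 1) * ?a x - ?c x / 2 + ?b x \<partial>lborel)
      = (real n / 2 - 1) * (\<integral>x. ?a x \<partial>lborel) - (\<integral>x. ?c x \<partial>lborel) / 2 + (\<integral>x. ?b x \<partial>lborel)"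
    using a b c by simp
  ultimately have "(\<integral>x. ?c x \<partial>lborel) = real n * (\<integral>x. ?a x \<partial>lborel) + 2 * (\<integral>x. ?b x \<partial>lborel)"
    by (simp add: algebra_simps)
  also have "\<dots> = (\<integral>x. real n * ?a x + 2 * ?b x \<partial>lborel)"
    using a b by simp
  finally have eq: "(\<integral>x. ?c x \<partial>lborel) = (\<integral>x. real n * ?a x + 2 * ?b x \<partial>lborel)" .
  have ab: "(\<lambda>x. real n * ?a x + 2 * ?b x) = (\<lambda>u. chi_dens n u * (real n * h u + 2 * (u * h' u)))"
    by (simp add: fun_eq_iff algebra_simps)
  show "integrable lborel ?c" by (rule c)
  show "integrable lborel (\<lambda>u. chi_dens n u * (real n * h u + 2 * (u * h' u)))"
    unfolding ab[symmetric] using a b by simp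
  show "(\<integral>x. ?c x \<partial>lborel) = (\<integral>u. chi_dens n u * (real n * h u + 2 * (u * h' u)) \<partial>lborel)"
    using eq unfolding ab .
qed

section \<open>The risk of the shrinkage estimator\<close>

text \<open>
  Stein's identity in \<open>x\<close> for fixed \<open>s\<close> removes \<open>\<theta>\<close> from the loss. The
  constant \<open>p\<close> is added on both sides because \<open>p\<close> plus the transformed integrand is non-negative,
  which allows the order of integration to be exchanged afterwards.
\<close>

lemma shrinkage_x_step:
  fixes \<theta> :: "real ^ 'p"
  assumes v: "v > 0" and s: "s > 0" and \<alpha>: "\<alpha> > 0"
  defines "D \<equiv> (\<lambda>x :: real ^ 'p. (norm x)\<^sup>2 + (1 + \<alpha>) * s)"
  shows "(\<integral>\<^sup>+x. ennreal (gauss \<theta> v x) * ennreal (loss ((1 - \<alpha> * s / D x) *\<^sub>R x) \<theta> v + real CARD('p)) \<partial>lborel)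
    = (\<integral>\<^sup>+x. ennreal (gauss \<theta> v x) * ennreal (2 * real CARD('p)
        - 2 * (real CARD('p) * (\<alpha> * s / D x) - 2 * (norm x)\<^sup>2 * (\<alpha> * s / (D x)\<^sup>2))
        + (\<alpha> * s / D x)\<^sup>2 * (norm x)\<^sup>2 / v) \<partial>lborel)"
proof -
  let ?p = "real CARD('p)"
  define r where "r = (\<lambda>q. \<alpha> * s / (q + (1 + \<alpha>) * s))"
  define r' where "r' = (\<lambda>q. - (\<alpha> * s / (q + (1 + \<alpha>) * s)\<^sup>2))"
  let ?q = "\<lambda>x :: real ^ 'p. (norm x)\<^sup>2"
  have D0: "q + (1 + \<alpha>) * s > 0" if "q \<ge> 0" for q
    using that s \<alpha> by (intro add_nonneg_pos) auto
  have rD: "\<alpha> * s / D x = r (?q x)" "\<alpha> * s / (D x)\<^sup>2 = - r' (?q x)" for x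
    by (simp_all add: D_def r_def r'_def)
  have r1: "0 \<le> r q" "r q \<le> 1" if "q \<ge> 0" for q
  proof -
    have "\<alpha> * s \<le> q + (1 + \<alpha>) * s" using that s by (simp add: algebra_simps)
    then show "0 \<le> r q" "r q \<le> 1"
      unfolding r_def using D0[OF that] s \<alpha> by (simp_all add: divide_le_eq_1)
  qed
  have r'1: "- 1 \<le> q * r' q" "q * r' q \<le> 0" if "q \<ge> 0" for q
  proof -
    have "q * r' q = - ((q / (q + (1 + \<alpha>) * s)) * r q)"
      by (simp add: r_def r'_def power2_eq_square)
    moreover have "0 \<le> q / (q + (1 + \<alpha>) * s)" "q / (q + (1 + \<alpha>) * s) \<le> 1"
      using D0[OF that] that s \<alpha> by (auto simp: divide_le_eq_1)
    ultimately show "- 1 \<le> q * r' q" "q * r' q \<le> 0"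
      using r1[OF that] mult_le_one[of "q / (q + (1 + \<alpha>) * s)" "r q"]
        mult_nonneg_nonneg[of "q / (q + (1 + \<alpha>) * s)" "r q"] by linarith+
  qed
  note stein = gauss_stein_radial[of v r r' 1 \<theta>]
  have cond: "v > 0" "\<And>q. q \<ge> 0 \<Longrightarrow> (r has_real_derivative r' q) (at q)"
    "\<And>q. q \<ge> 0 \<Longrightarrow> \<bar>r q\<bar> \<le> 1" "\<And>q. q \<ge> 0 \<Longrightarrow> \<bar>q * r' q\<bar> \<le> 1"
    "continuous_on {0..} r'" "r \<in> borel_measurable borel" "r' \<in> borel_measurable borel"
  proof -
    show "(r has_real_derivative r' q) (at q)" if "q \<ge> 0" for q
      unfolding r_def r'_def using D0[OF that]
      by (auto intro!: derivative_eq_intros simp: power2_eq_square divide_simps)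
    show "\<bar>r q\<bar> \<le> 1" if "q \<ge> 0" for q using r1[OF that] by auto
    show "\<bar>q * r' q\<bar> \<le> 1" if "q \<ge> 0" for q using r'1[OF that] by auto
    show "continuous_on {0..} r'"
      unfolding r'_def by (intro continuous_intros) (use D0 in fastforce)
    show "r \<in> borel_measurable borel" "r' \<in> borel_measurable borel"
      unfolding r_def r'_def by measurable
  qed (rule v)
  note st = stein[OF cond]
  have [measurable]: "r \<in> borel_measurable borel" "r' \<in> borel_measurable borel"
    by (fact cond)+
  let ?g = "gauss \<theta> v"
  let ?A = "\<lambda>x. ?g x * (norm (\<theta> - x))\<^sup>2"
  let ?B = "\<lambda>x. ?g x * (r (?q x) * ((x - \<theta>) \<bullet> x) / v)"
  let ?B' = "\<lambda>x. ?g x * (?p * r (?q x) + 2 * ?q x * r' (?q x))"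
  let ?C = "\<lambda>x. ?g x * ((r (?q x))\<^sup>2 * ?q x / v)"
  let ?L = "\<lambda>x. ?g x * (loss ((1 - \<alpha> * s / D x) *\<^sub>R x) \<theta> v + ?p)"
  let ?R = "\<lambda>x. ?g x * (2 * ?p - 2 * (?p * (\<alpha> * s / D x) - 2 * ?q x * (\<alpha> * s / (D x)\<^sup>2)) + (\<alpha> * s / D x)\<^sup>2 * ?q x / v)"
  have iA: "integrable lborel ?A" by (rule integrable_gauss_dist_sq[OF v])
  have iC: "integrable lborel ?C"
  proof (rule Bochner_Integration.integrable_bound)
    show "integrable lborel (\<lambda>x. ?g x * (norm (0 - x))\<^sup>2 / v)"
      using integrable_gauss_dist_sq[OF v, of \<theta> 0] by simp
    show "AE x in lborel. norm (?C x) \<le> norm (?g x * (norm (0 - x))\<^sup>2 / v)"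
    proof (rule AE_I2)
      fix x
      have "(r (?q x))\<^sup>2 \<le> 1" using r1[of "?q x"] by (simp add: abs_square_le_1)
      then have "(r (?q x))\<^sup>2 * ?q x \<le> 1 * ?q x" by (intro mult_right_mono) auto
      then have "?g x * ((r (?q x))\<^sup>2 * ?q x / v) \<le> ?g x * (?q x / v)"
        using v by (intro mult_left_mono divide_right_mono) auto
      then show "norm (?C x) \<le> norm (?g x * (norm (0 - x))\<^sup>2 / v)"
        using v by (simp add: abs_mult)
    qed
  qed measurable
  have ig: "integrable lborel ?g" by (rule integrable_gauss[OF v])
  have Leq: "?L = (\<lambda>x. ?A x / v - 2 * ?B x + ?C x + ?p * ?g x)"
  proof
    fix x
    have E: "(norm ((1 - r (?q x)) *\<^sub>R x - \<theta>))\<^sup>2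
        = (norm (\<theta> - x))\<^sup>2 - 2 * (r (?q x) * ((x - \<theta>) \<bullet> x)) + (r (?q x))\<^sup>2 * ?q x"
      unfolding power2_norm_eq_inner
      by (simp add: inner_simps inner_commute algebra_simps power2_eq_square)
    show "?L x = ?A x / v - 2 * ?B x + ?C x + ?p * ?g x"
      unfolding loss_def rD E by (simp add: add_divide_distrib diff_divide_distrib algebra_simps)
  qed
  have Req: "?R = (\<lambda>x. 2 * ?p * ?g x - 2 * ?B' x + ?C x)"
    unfolding rD by (simp add: fun_eq_iff algebra_simps)
  have lin1: "integrable lborel (\<lambda>x. a x / v - 2 * b x + c x + ?p * d x)"
      "(\<integral>x. a x / v - 2 * b x + c x + ?p * d x \<partial>lborel)
      = (\<integral>x. a x \<partial>lborel) / v - 2 * (\<integral>x. b x \<partial>lborel) + (\<integral>x. c x \<partial>lborel) + ?p * (\<integral>x. d x \<partial>lborel)"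
    if "integrable lborel a" "integrable lborel b" "integrable lborel c" "integrable lborel d"
    for a b c d :: "real ^ 'p \<Rightarrow> real"
    using that by simp_all
  have lin2: "integrable lborel (\<lambda>x. 2 * ?p * d x - 2 * b x + c x)"
      "(\<integral>x. 2 * ?p * d x - 2 * b x + c x \<partial>lborel)
      = 2 * ?p * (\<integral>x. d x \<partial>lborel) - 2 * (\<integral>x. b x \<partial>lborel) + (\<integral>x. c x \<partial>lborel)"
    if "integrable lborel b" "integrable lborel c" "integrable lborel d"
    for b c d :: "real ^ 'p \<Rightarrow> real"
    using that by simp_all
  have iL: "integrable lborel ?L" unfolding Leq by (rule lin1(1)[OF iA st(1) iC ig])
  have iR: "integrable lborel ?R" unfolding Req by (rule lin2(1)[OF st(2) iC ig])
  have "(\<integral>x. ?L x \<partial>lborel) = (\<integral>x. ?A x \<partial>lborel) / v - 2 * (\<integral>x. ?B x \<partial>lborel) + (\<integral>x. ?C x \<partial>lborel) + ?p"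
    using lin1(2)[OF iA st(1) iC ig] unfolding Leq integral_gauss[OF v] by (simp only: mult_1_right)
  also have "(\<integral>x. ?B x \<partial>lborel) = (\<integral>x. ?B' x \<partial>lborel)" by (rule st(3))
  also have "(\<integral>x. ?A x \<partial>lborel) / v = ?p"
    using v by (simp add: integral_gauss_dist_sq[OF v])
  also have "?p - 2 * (\<integral>x. ?B' x \<partial>lborel) + (\<integral>x. ?C x \<partial>lborel) + ?p
      = 2 * ?p - 2 * (\<integral>x. ?B' x \<partial>lborel) + (\<integral>x. ?C x \<partial>lborel)"
    by simp
  also have "\<dots> = (\<integral>x. ?R x \<partial>lborel)"
    using lin2(2)[OF st(2) iC ig] unfolding Req integral_gauss[OF v] by (simp only: mult_1_right)
  finally have eq: "(\<integral>x. ?L x \<partial>lborel) = (\<integral>x. ?R x \<partial>lborel)" .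
  have L0: "0 \<le> loss ((1 - \<alpha> * s / D x) *\<^sub>R x) \<theta> v + ?p" for x
    using v by (simp add: loss_def)
  have R0: "0 \<le> 2 * ?p - 2 * (?p * (\<alpha> * s / D x) - 2 * ?q x * (\<alpha> * s / (D x)\<^sup>2)) + (\<alpha> * s / D x)\<^sup>2 * ?q x / v" for x
  proof -
    have "?p * (\<alpha> * s / D x) \<le> ?p * 1"
      unfolding rD using r1[of "?q x"] by (intro mult_left_mono) auto
    moreover have "0 \<le> 2 * ?q x * (\<alpha> * s / (D x)\<^sup>2)" using \<alpha> s by simp
    moreover have "0 \<le> (\<alpha> * s / D x)\<^sup>2 * ?q x / v" using v by simp
    moreover have "0 \<le> 2 * P - 2 * (a - b) + c" if "a \<le> P * 1" "0 \<le> b" "0 \<le> c" for P a b c :: real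
      using that by simp
    ultimately show ?thesis by blast
  qed
  have "(\<integral>\<^sup>+x. ennreal (?L x) \<partial>lborel) = (\<integral>\<^sup>+x. ennreal (?R x) \<partial>lborel)"
    using eq L0 R0 iL iR by (simp add: nn_integral_eq_integral)
  then show ?thesis
    using L0 R0 by (simp add: ennreal_mult)
qed

text \<open>
  Here \<open>w = \<parallel>x\<parallel>\<^sup>2 / v\<close> and \<open>u = s / v\<close>. The chi-square identity rewrites the quadratic term
  \<open>u h(u)\<close> as \<open>n h + 2 u h'\<close>; after that the integrand is at most \<open>2 p\<close> pointwise,
  where the bound on \<open>\<alpha>\<close> controls the coefficient \<open>\<alpha> (n + 2)\<close> that the identity produces.
\<close>

lemma shrinkage_u_step:
  fixes p :: real
  assumes n: "n > 0" and \<alpha>: "\<alpha> > 0" and w: "w \<ge> 0" and p: "p \<ge> 0"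
    and \<alpha>n: "\<alpha> * (real n + 2) \<le> 2 * (p - 2)"
  defines "D \<equiv> (\<lambda>u. w + (1 + \<alpha>) * u)"
  shows "(\<integral>\<^sup>+u. ennreal (chi_dens n u) * ennreal (2 * p
        - 2 * (p * (\<alpha> * u / D u) - 2 * w * (\<alpha> * u / (D u)\<^sup>2)) + (\<alpha> * u / D u)\<^sup>2 * w) \<partial>lborel)
     \<le> ennreal (2 * p)"
proof -
  define h where "h = (\<lambda>u. \<alpha>\<^sup>2 * u * w / (D u)\<^sup>2)"
  define h' where "h' = (\<lambda>u. \<alpha>\<^sup>2 * w * (w - (1 + \<alpha>) * u) / (D u)^3)"
  let ?G = "\<lambda>u. 2 * p - 2 * (p * (\<alpha> * u / D u) - 2 * w * (\<alpha> * u / (D u)\<^sup>2))"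
  have D0: "D u > 0" if "u > 0" for u
    unfolding D_def using that w \<alpha> by (intro add_nonneg_pos) auto
  have ratio: "0 \<le> u / D u" "u / D u \<le> 1" "0 \<le> w / D u" "w / D u \<le> 1"
    "\<bar>(w - (1 + \<alpha>) * u) / D u\<bar> \<le> 1" "\<alpha> * u / D u \<le> 1" if "u > 0" for u
  proof -
    have "u \<le> D u" "\<alpha> * u \<le> D u" "w \<le> D u" "\<bar>w - (1 + \<alpha>) * u\<bar> \<le> D u"
      unfolding D_def using that w \<alpha> mult_pos_pos[OF \<alpha> that] by (auto simp: algebra_simps abs_le_iff)
    then show "0 \<le> u / D u" "u / D u \<le> 1" "0 \<le> w / D u" "w / D u \<le> 1"
      "\<bar>(w - (1 + \<alpha>) * u) / D u\<bar> \<le> 1" "\<alpha> * u / D u \<le> 1"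
      using D0[OF that] that w by (auto simp: divide_le_eq_1 abs_divide)
  qed
  have hb: "\<bar>h u\<bar> \<le> \<alpha>\<^sup>2" "\<bar>u * h' u\<bar> \<le> \<alpha>\<^sup>2" if u: "u > 0" for u
  proof -
    have 1: "h u = \<alpha>\<^sup>2 * (u / D u * (w / D u))" by (simp add: h_def power2_eq_square)
    have 2: "u * h' u = \<alpha>\<^sup>2 * (u / D u * (w / D u) * ((w - (1 + \<alpha>) * u) / D u))"
      by (simp add: h'_def power2_eq_square power3_eq_cube)
    have 3: "0 \<le> u / D u * (w / D u)" "u / D u * (w / D u) \<le> 1"
      by (intro mult_nonneg_nonneg mult_le_one ratio[OF u])+
    have 4: "\<bar>u / D u * (w / D u) * ((w - (1 + \<alpha>) * u) / D u)\<bar> \<le> 1"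
      using 3 ratio(5)[OF u] unfolding abs_mult[of "u / D u * (w / D u)"] by (intro mult_le_one) linarith+
    show "\<bar>h u\<bar> \<le> \<alpha>\<^sup>2" unfolding 1 abs_mult[of "\<alpha>\<^sup>2"] abs_power2 using 3 by (intro mult_left_le) auto
    show "\<bar>u * h' u\<bar> \<le> \<alpha>\<^sup>2" unfolding 2 abs_mult[of "\<alpha>\<^sup>2"] abs_power2 using 4 by (intro mult_left_le) auto
  qed
  have st: "integrable lborel (\<lambda>u. chi_dens n u * (u * h u))"
    "integrable lborel (\<lambda>u. chi_dens n u * (real n * h u + 2 * (u * h' u)))"
    "(\<integral>u. chi_dens n u * (u * h u) \<partial>lborel) = (\<integral>u. chi_dens n u * (real n * h u + 2 * (u * h' u)) \<partial>lborel)"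
  proof (rule_tac [!] chi_stein[where B = "\<alpha>\<^sup>2"])
    show "(h has_real_derivative h' u) (at u)" if "u > 0" for u
    proof -
      have "(D has_real_derivative (1 + \<alpha>)) (at u)"
        unfolding D_def by (auto intro!: derivative_eq_intros)
      then have "(h has_real_derivative (\<alpha>\<^sup>2 * w * (D u)\<^sup>2 - \<alpha>\<^sup>2 * u * w * (2 * D u * (1 + \<alpha>))) / ((D u)\<^sup>2 * (D u)\<^sup>2)) (at u)"
        using D0[OF that] unfolding h_def
        by (auto intro!: derivative_eq_intros simp: power2_eq_square)
      moreover have "(\<alpha>\<^sup>2 * w * (D u)\<^sup>2 - \<alpha>\<^sup>2 * u * w * (2 * D u * (1 + \<alpha>))) / ((D u)\<^sup>2 * (D u)\<^sup>2) = h' u"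
      proof -
        have E: "w - (1 + \<alpha>) * u = D u - 2 * (1 + \<alpha>) * u" by (simp add: D_def)
        have "D u \<noteq> 0" using D0[OF that] by simp
        then show ?thesis
          unfolding h'_def E by (simp add: field_simps power2_eq_square power3_eq_cube)
      qed
      ultimately show ?thesis by simp
    qed
    then show "(h has_real_derivative h' u) (at u)" "(h has_real_derivative h' u) (at u)" if "u > 0" for u using that by auto
    show c: "continuous_on {0<..} h'"
      unfolding h'_def using D0 by (force intro!: continuous_intros simp: D_def)
    show "continuous_on {0<..} h'" "continuous_on {0<..} h'" by (fact c)+
  qed (use n hb in \<open>auto simp: h_def h'_def D_def\<close>)
  have pt: "?G u + (real n * h u + 2 * (u * h' u)) \<le> 2 * p" if u: "u > 0" for u
  proof -
    \<comment> \<open>The two shares of \<open>D u\<close>; in terms of them the bracket is at most \<open>- 2 p (1 - ?y)\<close>.\<close>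
    let ?y = "w / D u" and ?z = "(1 + \<alpha>) * u / D u"
    have yz: "?y + ?z = 1" using D0[OF u] by (simp add: D_def add_divide_distrib[symmetric])
    have "real n * h u + 2 * (u * h' u) = \<alpha> * u / D u * ?y * (\<alpha> * (real n + 2 * (?y - ?z)))"
      by (simp add: h_def h'_def power2_eq_square power3_eq_cube diff_divide_distrib add_divide_distrib algebra_simps)
    also have "?y - ?z = 1 - 2 * ?z" using yz by linarith
    also have "\<alpha> * (real n + 2 * (1 - 2 * ?z)) = \<alpha> * (real n + 2) - 4 * \<alpha> * ?z"
      by (simp add: algebra_simps)
    finally have 1: "real n * h u + 2 * (u * h' u) = \<alpha> * u / D u * (?y * (\<alpha> * (real n + 2) - 4 * \<alpha> * ?z))"
      by simp
    have "?G u = 2 * p + \<alpha> * u / D u * (- 2 * p + 4 * ?y)"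
      by (simp add: power2_eq_square algebra_simps)
    with 1 have "?G u + (real n * h u + 2 * (u * h' u))
        = 2 * p + \<alpha> * u / D u * ((- 2 * p + 4 * ?y) + ?y * (\<alpha> * (real n + 2) - 4 * \<alpha> * ?z))"
      by (simp only: distrib_left add.assoc)
    moreover have "(- 2 * p + 4 * ?y) + ?y * (\<alpha> * (real n + 2) - 4 * \<alpha> * ?z) \<le> 0"
    proof -
      have y: "0 \<le> ?y" "?y \<le> 1" using ratio[OF u] by auto
      have z: "0 \<le> ?z" using \<alpha> u D0[OF u] by simp
      have "?y * (\<alpha> * (real n + 2) - 4 * \<alpha> * ?z) \<le> ?y * (2 * (p - 2))"
      proof (rule mult_left_mono[OF _ y(1)])
        have "0 \<le> 4 * \<alpha> * ?z" using \<alpha> z by (intro mult_nonneg_nonneg) auto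
        then show "\<alpha> * (real n + 2) - 4 * \<alpha> * ?z \<le> 2 * (p - 2)" using \<alpha>n by linarith
      qed
      moreover have "Y * (2 * (p - 2)) = 2 * (p * Y) - 4 * Y" for Y by (simp add: algebra_simps)
      moreover have "p * ?y \<le> p * 1" using y p by (intro mult_left_mono) auto
      ultimately have "?y * (\<alpha> * (real n + 2) - 4 * \<alpha> * ?z) \<le> 2 * p - 4 * ?y"
        by (smt (verit))
      then show ?thesis by linarith
    qed
    moreover have "0 \<le> \<alpha> * u / D u" using \<alpha> u D0[OF u] by simp
    ultimately show ?thesis by (smt (verit, best) mult_nonneg_nonpos)
  qed
  have G0: "0 \<le> ?G u" if u: "u > 0" for u
  proof -
    have "p * (\<alpha> * u / D u) \<le> p * 1" using ratio(6)[OF u] p by (intro mult_left_mono) auto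
    moreover have "0 \<le> 2 * w * (\<alpha> * u / (D u)\<^sup>2)" using w \<alpha> u by simp
    moreover have "0 \<le> 2 * P - 2 * (a - b)" if "a \<le> P * 1" "0 \<le> b" for P a b :: real
      using that by simp
    ultimately show ?thesis by blast
  qed
  have Gb: "?G u \<le> 2 * p + 4" if u: "u > 0" for u
  proof -
    have "0 \<le> p * (\<alpha> * u / D u)" using \<alpha> u p D0[OF u] by simp
    moreover have "w * (\<alpha> * u / (D u)\<^sup>2) \<le> 1"
    proof -
      have "w * (\<alpha> * u / (D u)\<^sup>2) = w / D u * (\<alpha> * u / D u)" by (simp add: power2_eq_square)
      also have "\<dots> \<le> 1"
        using ratio[OF u] \<alpha> u D0[OF u] by (intro mult_le_one) auto
      finally show ?thesis .
    qed
    moreover have "2 * p - 2 * (a - 2 * w * y) \<le> 2 * p + 4" if "0 \<le> a" "w * y \<le> 1" for a y :: real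
      using that by (simp add: algebra_simps)
    ultimately show ?thesis by blast
  qed
  have [measurable]: "h \<in> borel_measurable borel" "h' \<in> borel_measurable borel" "D \<in> borel_measurable borel"
    unfolding h_def h'_def D_def by measurable
  have chi0: "chi_dens n u = 0" if "\<not> u > 0" for u using that by (simp add: chi_dens_def)
  have iG: "integrable lborel (\<lambda>u. chi_dens n u * ?G u)"
  proof (rule Bochner_Integration.integrable_bound)
    show "integrable lborel (\<lambda>u. chi_dens n u * (2 * p + 4))"
      using integrable_chi_dens[OF n] by simp
    show "AE u in lborel. norm (chi_dens n u * ?G u) \<le> norm (chi_dens n u * (2 * p + 4))"
    proof (rule AE_I2)
      fix u show "norm (chi_dens n u * ?G u) \<le> norm (chi_dens n u * (2 * p + 4))"
        using G0[of u] Gb[of u] p chi0[of u] unfolding norm_mult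
        by (cases "u > 0") (auto intro!: mult_left_mono)
    qed
  qed measurable
  let ?T = "\<lambda>u. ?G u + (\<alpha> * u / D u)\<^sup>2 * w"
  have T: "chi_dens n u * ?T u = chi_dens n u * ?G u + chi_dens n u * (u * h u)" for u
    by (simp add: h_def power2_eq_square algebra_simps)
  have T0: "0 \<le> ?T u" if "u > 0" for u
    using G0[OF that] w by simp
  have "(\<integral>\<^sup>+u. ennreal (chi_dens n u) * ennreal (?T u) \<partial>lborel) = (\<integral>\<^sup>+u. ennreal (chi_dens n u * ?T u) \<partial>lborel)"
    by (intro nn_integral_cong) (metis T0 chi0 chi_dens_nonneg ennreal_0 ennreal_mult mult_zero_left)
  also have "\<dots> = ennreal (\<integral>u. chi_dens n u * ?T u \<partial>lborel)"
  proof (rule nn_integral_eq_integral)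
    show "integrable lborel (\<lambda>u. chi_dens n u * ?T u)" unfolding T using iG st(1) by simp
    show "AE u in lborel. 0 \<le> chi_dens n u * ?T u"
      by (rule AE_I2) (metis T0 chi0 chi_dens_nonneg mult_nonneg_nonneg mult_zero_left order_refl)
  qed
  finally have nn: "(\<integral>\<^sup>+u. ennreal (chi_dens n u) * ennreal (?T u) \<partial>lborel) = ennreal (\<integral>u. chi_dens n u * ?T u \<partial>lborel)" .
  have "(\<integral>u. chi_dens n u * ?T u \<partial>lborel)
      = (\<integral>u. chi_dens n u * ?G u + chi_dens n u * (real n * h u + 2 * (u * h' u)) \<partial>lborel)"
    unfolding T using iG st by simp
  also have "\<dots> \<le> (\<integral>u. chi_dens n u * (2 * p) \<partial>lborel)"
  proof (rule integral_mono)
    show "integrable lborel (\<lambda>u. chi_dens n u * ?G u + chi_dens n u * (real n * h u + 2 * (u * h' u)))"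
      using iG st by simp
    show "integrable lborel (\<lambda>u. chi_dens n u * (2 * p))" using integrable_chi_dens[OF n] by simp
    fix u
    show "chi_dens n u * ?G u + chi_dens n u * (real n * h u + 2 * (u * h' u)) \<le> chi_dens n u * (2 * p)"
      using mult_left_mono[OF pt chi_dens_nonneg, of u n] chi0[of u]
      by (cases "u > 0") (auto simp: distrib_left)
  qed
  also have "\<dots> = 2 * p"
  proof -
    have "(\<integral>u. chi_dens n u \<partial>lborel) = 1"
      using nn_integral_chi_dens[OF n] by (simp add: integral_eq_nn_integral)
    then show ?thesis by simp
  qed
  finally show ?thesis unfolding nn by (rule ennreal_leI)
qed

lemma nn_integral_weighted_swap:
  fixes a :: "'a::euclidean_space \<Rightarrow> ennreal" and b :: "'b::euclidean_space \<Rightarrow> ennreal"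
  assumes [measurable]: "a \<in> borel_measurable borel" "b \<in> borel_measurable borel"
    "case_prod f \<in> borel_measurable (borel \<Otimes>\<^sub>M borel)"
  shows "(\<integral>\<^sup>+x. a x * (\<integral>\<^sup>+y. b y * f x y \<partial>lborel) \<partial>lborel)
    = (\<integral>\<^sup>+y. b y * (\<integral>\<^sup>+x. a x * f x y \<partial>lborel) \<partial>lborel)"
proof -
  have "(\<integral>\<^sup>+x. a x * (\<integral>\<^sup>+y. b y * f x y \<partial>lborel) \<partial>lborel)
      = (\<integral>\<^sup>+x. \<integral>\<^sup>+y. a x * (b y * f x y) \<partial>lborel \<partial>lborel)"
    by (intro nn_integral_cong nn_integral_cmult[symmetric]) measurable
  also have "\<dots> = (\<integral>\<^sup>+y. \<integral>\<^sup>+x. a x * (b y * f x y) \<partial>lborel \<partial>lborel)"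
    by (rule lborel_pair.Fubini'[symmetric]) measurable
  also have "\<dots> = (\<integral>\<^sup>+y. \<integral>\<^sup>+x. b y * (a x * f x y) \<partial>lborel \<partial>lborel)"
    by (simp only: mult.left_commute)
  also have "\<dots> = (\<integral>\<^sup>+y. b y * (\<integral>\<^sup>+x. a x * f x y \<partial>lborel) \<partial>lborel)"
    by (intro nn_integral_cong nn_integral_cmult) measurable
  finally show ?thesis .
qed

lemma estimator_shrinkage:
  "estimator (shrinkage_estimator n :: (real ^ 'p) \<times> real \<Rightarrow> real ^ 'p)"
proof -
  let ?M = "(borel :: (real ^ 'p) measure) \<Otimes>\<^sub>M (restrict_space borel {0<..} :: real measure)"
  have [measurable]: "(\<lambda>z. snd z) \<in> ?M \<rightarrow>\<^sub>M borel"
    by (rule measurable_compose[OF measurable_snd measurable_restrict_space1[OF measurable_ident_sets[OF refl]]])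
  show ?thesis
    unfolding estimator_def shrinkage_estimator_def case_prod_beta by measurable
qed

lemma risk_shrinkage_le:
  fixes \<theta> :: "real ^ 'p"
  assumes n: "n > 0" and v: "v > 0" and p: "CARD('p) > 2"
  shows "risk n \<theta> v (shrinkage_estimator n) \<le> ennreal (real CARD('p))"
proof -
  let ?p = "real CARD('p)"
  define \<alpha> where "\<alpha> = 2 * (?p - 2) / (real n + 2)"
  have \<alpha>: "\<alpha> > 0" "\<alpha> * (real n + 2) \<le> 2 * (?p - 2)"
    using p by (auto simp: \<alpha>_def intro!: divide_pos_pos)
  define D where "D = (\<lambda>(x :: real ^ 'p) s. (norm x)\<^sup>2 + (1 + \<alpha>) * s)"
  define L where "L = (\<lambda>(x :: real ^ 'p) s. loss ((1 - \<alpha> * s / D x s) *\<^sub>R x) \<theta> v)"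
  define R where "R = (\<lambda>(x :: real ^ 'p) s. 2 * ?p
        - 2 * (?p * (\<alpha> * s / D x s) - 2 * (norm x)\<^sup>2 * (\<alpha> * s / (D x s)\<^sup>2))
        + (\<alpha> * s / D x s)\<^sup>2 * (norm x)\<^sup>2 / v)"
  let ?\<delta> = "shrinkage_estimator n :: (real ^ 'p) \<times> real \<Rightarrow> real ^ 'p"
  let ?g = "\<lambda>x. ennreal (gauss \<theta> v x)" and ?c = "\<lambda>u. ennreal (chi_dens n u)"
  have [measurable]: "case_prod D \<in> borel_measurable (borel \<Otimes>\<^sub>M borel)"
    unfolding D_def by measurable
  have [measurable]: "case_prod L \<in> borel_measurable (borel \<Otimes>\<^sub>M borel)"
    unfolding L_def loss_def by measurable
  have [measurable]: "case_prod R \<in> borel_measurable (borel \<Otimes>\<^sub>M borel)"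
    unfolding R_def by measurable
  note [measurable] = borel_measurable_borel_version[OF estimator_shrinkage[of n, where 'p='p]]
  have chi0: "?c u = 0" if "\<not> u > 0" for u using that by (simp add: chi_dens_def)
  have \<delta>: "loss (borel_version ?\<delta> (x, s)) \<theta> v = L x s" if "s > 0" for x s
  proof -
    have "(norm x)\<^sup>2 / s + 1 + \<alpha> = D x s / s"
      using that by (simp add: D_def field_simps)
    then show ?thesis
      using that by (simp add: borel_version_def shrinkage_estimator_def L_def \<alpha>_def)
  qed
  have L0: "0 \<le> L x s" for x s using v by (simp add: L_def loss_def)
  have "risk n \<theta> v ?\<delta> = (\<integral>\<^sup>+x. ?g x * (\<integral>\<^sup>+u. ?c u * ennreal (loss (borel_version ?\<delta> (x, v * u)) \<theta> v) \<partial>lborel) \<partial>lborel)"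
    unfolding risk_eq[OF v n estimator_shrinkage]
    by (rule nn_integral_sample_dens[OF v]) (unfold loss_def, measurable)
  also have "\<dots> = (\<integral>\<^sup>+x. ?g x * (\<integral>\<^sup>+u. ?c u * ennreal (L x (v * u)) \<partial>lborel) \<partial>lborel)"
  proof (rule nn_integral_cong, rule arg_cong2[where f = "(*)", OF refl], rule nn_integral_cong)
    fix x u
    show "?c u * ennreal (loss (borel_version ?\<delta> (x, v * u)) \<theta> v) = ?c u * ennreal (L x (v * u))"
      using chi0[of u] v by (cases "u > 0") (auto simp: \<delta>)
  qed
  finally have risk: "risk n \<theta> v ?\<delta> = (\<integral>\<^sup>+x. ?g x * (\<integral>\<^sup>+u. ?c u * ennreal (L x (v * u)) \<partial>lborel) \<partial>lborel)" .
  have "risk n \<theta> v ?\<delta> + ennreal ?p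
      = (\<integral>\<^sup>+x. ?g x * (\<integral>\<^sup>+u. ?c u * ennreal (L x (v * u)) \<partial>lborel) \<partial>lborel) + (\<integral>\<^sup>+x. ?g x * ennreal ?p \<partial>lborel)"
    unfolding risk by (simp add: nn_integral_multc nn_integral_gauss[OF v])
  also have "\<dots> = (\<integral>\<^sup>+x. ?g x * ((\<integral>\<^sup>+u. ?c u * ennreal (L x (v * u)) \<partial>lborel) + ennreal ?p) \<partial>lborel)"
    unfolding distrib_left by (rule nn_integral_add[symmetric]) measurable
  also have "\<dots> = (\<integral>\<^sup>+x. ?g x * (\<integral>\<^sup>+u. ?c u * ennreal (L x (v * u) + ?p) \<partial>lborel) \<partial>lborel)"
  proof (rule nn_integral_cong, rule arg_cong2[where f = "(*)", OF refl])
    fix x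
    have "(\<integral>\<^sup>+u. ?c u * ennreal (L x (v * u)) \<partial>lborel) + ennreal ?p
        = (\<integral>\<^sup>+u. ?c u * ennreal (L x (v * u)) \<partial>lborel) + (\<integral>\<^sup>+u. ?c u * ennreal ?p \<partial>lborel)"
      by (simp add: nn_integral_multc nn_integral_chi_dens[OF n])
    also have "\<dots> = (\<integral>\<^sup>+u. ?c u * ennreal (L x (v * u)) + ?c u * ennreal ?p \<partial>lborel)"
      by (rule nn_integral_add[symmetric]) measurable
    also have "\<dots> = (\<integral>\<^sup>+u. ?c u * ennreal (L x (v * u) + ?p) \<partial>lborel)"
      using L0 by (simp add: ennreal_plus distrib_left)
    finally show "(\<integral>\<^sup>+u. ?c u * ennreal (L x (v * u)) \<partial>lborel) + ennreal ?p
        = (\<integral>\<^sup>+u. ?c u * ennreal (L x (v * u) + ?p) \<partial>lborel)" .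
  qed
  also have "\<dots> = (\<integral>\<^sup>+u. ?c u * (\<integral>\<^sup>+x. ?g x * ennreal (L x (v * u) + ?p) \<partial>lborel) \<partial>lborel)"
    by (rule nn_integral_weighted_swap) measurable
  also have "\<dots> = (\<integral>\<^sup>+u. ?c u * (\<integral>\<^sup>+x. ?g x * ennreal (R x (v * u)) \<partial>lborel) \<partial>lborel)"
  proof (rule nn_integral_cong)
    fix u
    show "?c u * (\<integral>\<^sup>+x. ?g x * ennreal (L x (v * u) + ?p) \<partial>lborel)
        = ?c u * (\<integral>\<^sup>+x. ?g x * ennreal (R x (v * u)) \<partial>lborel)"
      using chi0[of u] shrinkage_x_step[OF v, of "v * u" \<alpha> \<theta>] v \<alpha>
      by (cases "u > 0") (auto simp: L_def R_def D_def)
  qed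
  also have "\<dots> = (\<integral>\<^sup>+x. ?g x * (\<integral>\<^sup>+u. ?c u * ennreal (R x (v * u)) \<partial>lborel) \<partial>lborel)"
    by (rule nn_integral_weighted_swap[symmetric]) measurable
  also have "\<dots> \<le> (\<integral>\<^sup>+x. ?g x * ennreal (2 * ?p) \<partial>lborel)"
  proof (intro nn_integral_mono mult_left_mono)
    fix x :: "real ^ 'p"
    define w where "w = (norm x)\<^sup>2 / v"
    have D: "D x (v * u) = v * (w + (1 + \<alpha>) * u)" for u
      using v by (simp add: D_def w_def field_simps)
    have "R x (v * u) = 2 * ?p - 2 * (?p * (\<alpha> * u / (w + (1 + \<alpha>) * u))
        - 2 * w * (\<alpha> * u / (w + (1 + \<alpha>) * u)\<^sup>2)) + (\<alpha> * u / (w + (1 + \<alpha>) * u))\<^sup>2 * w" for u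
    proof -
      have "(norm x)\<^sup>2 = v * w" using v by (simp add: w_def)
      moreover have "\<alpha> * (v * u) / (v * E) = \<alpha> * u / E" "2 * (v * w) * (\<alpha> * (v * u) / (v * E)\<^sup>2) = 2 * w * (\<alpha> * u / E\<^sup>2)" for E
        using v by (simp_all add: power2_eq_square)
      ultimately show ?thesis
        unfolding R_def D using v by simp
    qed
    then show "(\<integral>\<^sup>+u. ?c u * ennreal (R x (v * u)) \<partial>lborel) \<le> ennreal (2 * ?p)"
      using shrinkage_u_step[OF n \<alpha>(1), of w ?p] \<alpha> v by (simp add: w_def)
  qed simp
  also have "\<dots> = ennreal ?p + ennreal ?p"
    by (simp add: nn_integral_multc nn_integral_gauss[OF v] ennreal_plus[symmetric] del: ennreal_plus)
  finally have "risk n \<theta> v ?\<delta> + ennreal ?p \<le> ennreal ?p + ennreal ?p" .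
  then show ?thesis
    unfolding add.commute[of "risk n \<theta> v ?\<delta>"] ennreal_add_left_cancel_le by simp
qed

section \<open>Normal priors and minimaxity\<close>

text \<open>
  Exchanging the integrations over \<open>\<theta>\<close> and the data and using Bayes' rule leaves the posterior
  expected loss: squared distance to the posterior mean \<open>(1 - t) x\<close> plus posterior variance. The
  variance term \<open>p (1 - t)\<close> is the same for all estimators.
\<close>

lemma bayes_risk_normal_prior:
  fixes \<delta> :: "(real ^ 'p) \<times> real \<Rightarrow> real ^ 'p"
  assumes n: "n > 0" and v: "v > 0" and t: "0 < t" "t < 1" and \<delta>: "estimator \<delta>"
  shows "(\<integral>\<^sup>+\<theta>. ennreal (gauss 0 (v * (1 - t) / t) \<theta>) * risk n \<theta> v \<delta> \<partial>lborel)
    = (\<integral>\<^sup>+z. ennreal (sample_dens n 0 (v / t) v z)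
          * ennreal ((norm (borel_version \<delta> z - (1 - t) *\<^sub>R fst z))\<^sup>2 / v) \<partial>lborel)
      + ennreal (real CARD('p) * (1 - t))"
proof -
  let ?p = "real CARD('p)" and ?D = "borel_version \<delta>"
  let ?k = "\<lambda>z. sample_dens n (0 :: real ^ 'p) (v / t) v z"
  let ?N = "\<lambda>z. (norm (?D z - (1 - t) *\<^sub>R fst z))\<^sup>2 / v"
  let ?a = "\<lambda>\<theta> :: real ^ 'p. gauss 0 (v * (1 - t) / t) \<theta>"
  note [measurable] = borel_measurable_borel_version[OF \<delta>]
  have [measurable]: "(\<lambda>x :: (real ^ 'p) \<times> ((real ^ 'p) \<times> real). snd x) \<in> lborel \<Otimes>\<^sub>M lborel \<rightarrow>\<^sub>M borel"
    by (rule measurable_compose[OF measurable_snd]) simp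
  have "(\<integral>\<^sup>+\<theta>. ennreal (?a \<theta>) * risk n \<theta> v \<delta> \<partial>lborel)
      = (\<integral>\<^sup>+\<theta>. \<integral>\<^sup>+z. ennreal (?a \<theta>) * (ennreal (sample_dens n \<theta> v v z) * ennreal (loss (?D z) \<theta> v)) \<partial>lborel \<partial>lborel)"
    unfolding risk_eq[OF v n \<delta>] loss_def
    by (intro nn_integral_cong nn_integral_cmult[symmetric]) measurable
  also have "\<dots> = (\<integral>\<^sup>+z. \<integral>\<^sup>+\<theta>. ennreal (?a \<theta>) * (ennreal (sample_dens n \<theta> v v z) * ennreal (loss (?D z) \<theta> v)) \<partial>lborel \<partial>lborel)"
    unfolding loss_def by (rule lborel_pair.Fubini'[symmetric]) measurable
  also have "\<dots> = (\<integral>\<^sup>+z. ennreal (?k z) * ennreal (?N z) + ennreal (?k z) * ennreal (?p * (1 - t)) \<partial>lborel)"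
  proof (rule nn_integral_cong)
    fix z :: "(real ^ 'p) \<times> real"
    let ?g = "\<lambda>\<theta>. gauss ((1 - t) *\<^sub>R fst z) (v * (1 - t)) \<theta>"
    have "(\<integral>\<^sup>+\<theta>. ennreal (?a \<theta>) * (ennreal (sample_dens n \<theta> v v z) * ennreal (loss (?D z) \<theta> v)) \<partial>lborel)
        = (\<integral>\<^sup>+\<theta>. ennreal (?k z / v) * ennreal (?g \<theta> * (norm (?D z - \<theta>))\<^sup>2) \<partial>lborel)"
    proof (rule nn_integral_cong)
      fix \<theta>
      have "?a \<theta> * (sample_dens n \<theta> v v z * loss (?D z) \<theta> v)
          = (?a \<theta> * gauss \<theta> v (fst z)) * (chi_dens n (snd z / v) / v * ((norm (?D z - \<theta>))\<^sup>2 / v))"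
        by (simp add: sample_dens_def loss_def)
      also have "\<dots> = ?k z / v * (?g \<theta> * (norm (?D z - \<theta>))\<^sup>2)"
        unfolding gauss_bayes[OF v t] by (simp add: sample_dens_def)
      finally have eq: "?a \<theta> * (sample_dens n \<theta> v v z * loss (?D z) \<theta> v) = ?k z / v * (?g \<theta> * (norm (?D z - \<theta>))\<^sup>2)" .
      have "ennreal (?a \<theta>) * (ennreal (sample_dens n \<theta> v v z) * ennreal (loss (?D z) \<theta> v))
          = ennreal (?a \<theta> * (sample_dens n \<theta> v v z * loss (?D z) \<theta> v))"
      proof -
        have "0 \<le> loss (?D z) \<theta> v" using v by (simp add: loss_def)
        then show ?thesis using v by (simp add: ennreal_mult)
      qed
      then show "ennreal (?a \<theta>) * (ennreal (sample_dens n \<theta> v v z) * ennreal (loss (?D z) \<theta> v))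
          = ennreal (?k z / v) * ennreal (?g \<theta> * (norm (?D z - \<theta>))\<^sup>2)"
        unfolding eq using v by (subst ennreal_mult[symmetric]) auto
    qed
    also have "\<dots> = ennreal (?k z / v) * ennreal ((norm (?D z - (1 - t) *\<^sub>R fst z))\<^sup>2 + ?p * (v * (1 - t)))"
      using v t by (subst nn_integral_cmult) (auto simp: nn_integral_gauss_dist_sq)
    also have "\<dots> = ennreal (?k z / v * ((norm (?D z - (1 - t) *\<^sub>R fst z))\<^sup>2 + ?p * (v * (1 - t))))"
      using v t by (intro ennreal_mult[symmetric]) auto
    also have "?k z / v * ((norm (?D z - (1 - t) *\<^sub>R fst z))\<^sup>2 + ?p * (v * (1 - t))) = ?k z * (?N z + ?p * (1 - t))"
      using v by (simp add: field_simps)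
    also have "ennreal (?k z * (?N z + ?p * (1 - t))) = ennreal (?k z) * ennreal (?N z) + ennreal (?k z) * ennreal (?p * (1 - t))"
    proof -
      have "0 \<le> ?k z" "0 \<le> ?N z" "0 \<le> ?p * (1 - t)" using v t by auto
      then show ?thesis
        by (simp only: distrib_left ennreal_plus ennreal_mult mult_nonneg_nonneg)
    qed
    finally show "(\<integral>\<^sup>+\<theta>. ennreal (?a \<theta>) * (ennreal (sample_dens n \<theta> v v z) * ennreal (loss (?D z) \<theta> v)) \<partial>lborel)
        = ennreal (?k z) * ennreal (?N z) + ennreal (?k z) * ennreal (?p * (1 - t))" .
  qed
  also have "\<dots> = (\<integral>\<^sup>+z. ennreal (?k z) * ennreal (?N z) \<partial>lborel)
      + (\<integral>\<^sup>+z. ennreal (?k z) * ennreal (?p * (1 - t)) \<partial>lborel)"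
    by (rule nn_integral_add) measurable
  also have "(\<integral>\<^sup>+z. ennreal (?k z) * ennreal (?p * (1 - t)) \<partial>lborel) = ennreal (?p * (1 - t))"
    using v t n by (subst nn_integral_multc) (auto simp: nn_integral_sample_dens_1)
  finally show ?thesis .
qed

text \<open>
  A maximal risk is at least any Bayes risk; with variance \<open>1\<close> and the normal priors above, the
  Bayes risks approach \<open>p\<close>.
\<close>

lemma max_risk_ge:
  fixes \<delta> :: "(real ^ 'p) \<times> real \<Rightarrow> real ^ 'p"
  assumes n: "n > 0" and \<delta>: "estimator \<delta>"
  shows "ennreal (real CARD('p)) \<le> max_risk n \<delta>"
proof (cases "max_risk n \<delta>")
  case (real m)
  have "c * real CARD('p) \<le> m" if c: "0 < c" "c < 1" for c
  proof -
    let ?g = "gauss (0 :: real ^ 'p) (1 * (1 - (1 - c)) / (1 - c))"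
    have "ennreal (real CARD('p) * (1 - (1 - c))) \<le> (\<integral>\<^sup>+\<theta>. ennreal (?g \<theta>) * risk n \<theta> 1 \<delta> \<partial>lborel)"
      using c by (subst bayes_risk_normal_prior[OF n _ _ _ \<delta>]) auto
    also have "\<dots> \<le> (\<integral>\<^sup>+\<theta>. ennreal (?g \<theta>) * max_risk n \<delta> \<partial>lborel)"
      by (intro nn_integral_mono mult_left_mono)
         (auto simp: max_risk_def intro!: SUP_upper2[of "(_, 1)"])
    also have "\<dots> = max_risk n \<delta>"
      using c by (subst nn_integral_multc) (auto simp: nn_integral_gauss)
    finally show ?thesis using real by (simp add: mult.commute)
  qed
  then have "real CARD('p) \<le> m" by (rule field_le_mult_one_interval)
  with real show ?thesis by simp
qed simp

lemma minimax_shrinkage: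
  assumes n: "n > 0" and p: "CARD('p::finite) > 2"
  shows "minimax n (shrinkage_estimator n :: (real ^ 'p) \<times> real \<Rightarrow> real ^ 'p)"
proof -
  let ?\<delta> = "shrinkage_estimator n :: (real ^ 'p) \<times> real \<Rightarrow> real ^ 'p"
  have "max_risk n ?\<delta> \<le> ennreal (real CARD('p))"
    unfolding max_risk_def using risk_shrinkage_le[OF n _ p] by (auto intro!: SUP_least)
  moreover have "ennreal (real CARD('p)) \<le> (INF \<delta>' \<in> {\<delta>' :: (real ^ 'p) \<times> real \<Rightarrow> real ^ 'p. estimator \<delta>'}. max_risk n \<delta>')"
    by (auto intro!: INF_greatest max_risk_ge[OF n])
  moreover have "(INF \<delta>' \<in> {\<delta>' :: (real ^ 'p) \<times> real \<Rightarrow> real ^ 'p. estimator \<delta>'}. max_risk n \<delta>') \<le> max_risk n ?\<delta>"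
    by (rule INF_lower) (simp add: estimator_shrinkage)
  ultimately show ?thesis
    unfolding minimax_def by (auto simp: estimator_shrinkage intro: antisym)
qed

section \<open>The scale-invariant prior and its posterior mean\<close>

lemma nn_integral_exp_neg_abs:
  assumes e: "\<epsilon> > 0"
  shows "(\<integral>\<^sup>+y. ennreal (exp (- \<epsilon> * \<bar>y - c\<bar>)) \<partial>lborel) = ennreal (2 / \<epsilon>)"
proof -
  have half: "(\<integral>\<^sup>+y. ennreal (exp (- y)) * indicator {0..} y \<partial>lborel) = 1"
    using nn_intergal_power_times_exp_Ici[of 0] by simp
  have AE0: "AE y in lborel. y \<noteq> (0 :: real)" by (rule AE_lborel_singleton)
  have "(\<integral>\<^sup>+y. ennreal (exp (- \<bar>y\<bar>)) \<partial>lborel)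
      = (\<integral>\<^sup>+y. ennreal (exp (- y)) * indicator {0..} y + ennreal (exp y) * indicator {0..} (- y) \<partial>lborel)"
    by (rule nn_integral_cong_AE, rule AE_mp[OF AE0], rule AE_I2) (auto simp: indicator_def)
  also have "\<dots> = (\<integral>\<^sup>+y. ennreal (exp (- y)) * indicator {0..} y \<partial>lborel)
      + (\<integral>\<^sup>+y. ennreal (exp y) * indicator {0..} (- y) \<partial>lborel)"
    by (rule nn_integral_add) auto
  also have "(\<integral>\<^sup>+y. ennreal (exp y) * indicator {0..} (- y) \<partial>lborel) = (\<integral>\<^sup>+y. ennreal (exp (- y)) * indicator {0..} y \<partial>lborel)"
    by (subst nn_integral_real_affine[where c = "-1" and t = 0]) auto
  finally have 1: "(\<integral>\<^sup>+y. ennreal (exp (- \<bar>y\<bar>)) \<partial>lborel) = 2"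
    unfolding half by simp
  have "(\<integral>\<^sup>+y. ennreal (exp (- \<epsilon> * \<bar>y - c\<bar>)) \<partial>lborel)
      = ennreal \<bar>1 / \<epsilon>\<bar> * (\<integral>\<^sup>+y. ennreal (exp (- \<epsilon> * \<bar>(c + (1 / \<epsilon>) * y) - c\<bar>)) \<partial>lborel)"
    by (rule nn_integral_real_affine) (use e in auto)
  also have "(\<lambda>y. exp (- \<epsilon> * \<bar>(c + (1 / \<epsilon>) * y) - c\<bar>)) = (\<lambda>y. exp (- \<bar>y\<bar>))"
    using e by (simp add: abs_mult)
  finally show ?thesis
    unfolding 1 using e by (simp add: ennreal_mult[symmetric] ennreal_numeral[symmetric] del: ennreal_numeral)
qed

text \<open>
  In the variable \<open>m = e\<^sup>-\<^sup>y\<close> this is a Gamma integral. Only its finiteness matters below, and that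
  follows from \<open>m\<^sup>k \<le> k! e\<^sup>m\<close>.
\<close>

lemma nn_integral_gumbel_finite:
  assumes N: "N \<ge> 1"
  shows "(\<integral>\<^sup>+y. ennreal (exp (- N * y - exp (- y))) \<partial>lborel) < \<infinity>"
proof -
  obtain k :: nat where k: "N + 1 \<le> real k" using real_arch_simple by blast
  have bound: "exp (- N * y - exp (- y)) \<le> (1 + fact k) * exp (- 1 * \<bar>y - 0\<bar>)" for y :: real
  proof (cases "y \<ge> 0")
    case True
    have "exp (- N * y - exp (- y)) \<le> exp (- y)"
      using True N mult_right_mono[of 1 N y] exp_ge_zero[of "- y"]
      by (simp add: del: exp_ge_zero)
    also have "\<dots> \<le> (1 + fact k) * exp (- y)" by (simp add: mult_le_cancel_right1)
    finally show ?thesis using True by simp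
  next
    case False
    let ?m = "exp (- y)"
    have m: "?m > 1" using False by simp
    have sm: "summable (\<lambda>i. ?m ^ i /\<^sub>R fact i)" by (rule summable_exp_generic)
    have "?m ^ k /\<^sub>R fact k \<le> (\<Sum>i. ?m ^ i /\<^sub>R fact i)"
      using sum_le_suminf[OF sm, of "{k}"] by simp
    then have "?m ^ k \<le> fact k * exp ?m"
      by (simp add: exp_def field_simps)
    moreover have "exp ((N + 1) * (- y)) \<le> exp (real k * (- y))"
      using False k by (simp add: mult_right_mono)
    moreover have "exp (real k * (- y)) = ?m ^ k" by (rule exp_of_nat_mult)
    ultimately have "exp ((N + 1) * (- y)) \<le> fact k * exp ?m" by linarith
    then have "exp ((N + 1) * (- y)) * (exp y * exp (- ?m)) \<le> fact k * exp ?m * (exp y * exp (- ?m))"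
      by (intro mult_right_mono) auto
    also have "fact k * exp ?m * (exp y * exp (- ?m)) = fact k * exp y * (exp ?m * exp (- ?m))"
      by (simp only: mult_ac)
    also have "\<dots> = fact k * exp y" by (simp add: exp_add[symmetric])
    also have "exp ((N + 1) * (- y)) * (exp y * exp (- ?m)) = exp (- N * y - ?m)"
      by (simp add: exp_add[symmetric] algebra_simps)
    finally have "exp (- N * y - ?m) \<le> fact k * exp y" .
    also have "\<dots> \<le> (1 + fact k) * exp y" by (simp add: distrib_right)
    finally show ?thesis using False by simp
  qed
  have "(\<integral>\<^sup>+y. ennreal (exp (- N * y - exp (- y))) \<partial>lborel)
      \<le> (\<integral>\<^sup>+y. ennreal (1 + fact k) * ennreal (exp (- 1 * \<bar>y - 0\<bar>)) \<partial>lborel)"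
    by (intro nn_integral_mono) (subst ennreal_mult[symmetric], use bound in \<open>auto intro!: ennreal_leI\<close>)
  also have "\<dots> = ennreal (1 + fact k) * ennreal (2 / 1)"
    by (subst nn_integral_cmult, measurable) (subst nn_integral_exp_neg_abs, auto)
  also have "\<dots> < \<infinity>" by (simp add: ennreal_mult_less_top)
  finally show ?thesis .
qed

definition beta_weight :: "real \<Rightarrow> real \<Rightarrow> real \<Rightarrow> real" where
  "beta_weight a b t = (if 0 < t \<and> t < 1 then t powr a * (1 - t) powr b else 0)"

lemma beta_weight_nonneg [simp]: "0 \<le> beta_weight a b t"
  by (simp add: beta_weight_def)

lemma borel_measurable_beta_weight [measurable]: "beta_weight a b \<in> borel_measurable borel"
  unfolding beta_weight_def by measurable

lemma nn_integral_beta_weight_finite: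
  assumes "a > -1" "b > -1"
  shows "(\<integral>\<^sup>+t. ennreal (beta_weight a b t) \<partial>lborel) < \<infinity>"
proof -
  have "((\<lambda>t. t powr (a + 1 - 1) * (1 - t) powr (b + 1 - 1)) has_integral Beta (a + 1) (b + 1)) {0..1}"
    by (rule has_integral_Beta_real) (use assms in auto)
  from nn_integral_has_integral_lebesgue[OF _ this]
  have "(\<integral>\<^sup>+t. ennreal (indicator {0..1} t * (t powr a * (1 - t) powr b)) \<partial>lborel) = ennreal (Beta (a + 1) (b + 1))"
    by simp
  moreover have "(\<integral>\<^sup>+t. ennreal (beta_weight a b t) \<partial>lborel)
      \<le> (\<integral>\<^sup>+t. ennreal (indicator {0..1} t * (t powr a * (1 - t) powr b)) \<partial>lborel)"
    by (intro nn_integral_mono ennreal_leI) (auto simp: beta_weight_def)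
  ultimately show ?thesis by (auto intro: le_less_trans)
qed

text \<open>
  The derivative of \<open>t\<^sup>A\<^sup>+\<^sup>1 (1 - t)\<^sup>b\<^sup>+\<^sup>1 (1 + w t)\<^sup>-\<^sup>(\<^sup>A\<^sup>+\<^sup>b\<^sup>+\<^sup>2\<^sup>)\<close> is \<open>k(t)\<close> times a function that is
  affine in \<open>t\<close>: the exponents are matched so that the quadratic terms cancel. The function vanishes
  at both ends of the unit interval, so the integral of the derivative is zero, and this is a linear
  equation for the mean of \<open>t\<close>.
\<close>

lemma beta_balance:
  fixes A b w :: real
  assumes A: "A > -1" and b: "b > -1" and w: "w \<ge> 0"
  defines "k \<equiv> (\<lambda>t. beta_weight A b t * (1 + w * t) powr (- (A + b + 3)))"
    and "\<alpha> \<equiv> (A + 1) / (b + 1)"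
  shows "(\<integral>\<^sup>+t. ennreal (k t) \<partial>lborel) < \<infinity>"
    and "(\<integral>\<^sup>+t. ennreal (k t * t) \<partial>lborel) = ennreal (\<alpha> / (w + 1 + \<alpha>)) * (\<integral>\<^sup>+t. ennreal (k t) \<partial>lborel)"
proof -
  let ?N = "A + b + 3"
  have k0: "0 \<le> k t" "0 \<le> k t * t" for t by (auto simp: k_def beta_weight_def)
  have kb: "k t \<le> beta_weight A b t" "k t * t \<le> beta_weight A b t" for t
  proof -
    have "k t \<le> beta_weight A b t \<and> k t * t \<le> beta_weight A b t" if t: "0 < t" "t < 1"
    proof -
      have "(1 + w * t) powr (- ?N) \<le> 1"
        using powr_mono[of "- ?N" 0 "1 + w * t"] t w A b
        by (auto split: if_splits)
      then have "k t \<le> beta_weight A b t * 1" unfolding k_def by (intro mult_left_mono) auto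
      moreover have "k t * t \<le> k t * 1" using t k0(1) by (intro mult_left_mono) auto
      ultimately show ?thesis by simp
    qed
    then show "k t \<le> beta_weight A b t" "k t * t \<le> beta_weight A b t"
      by (cases "0 < t \<and> t < 1"; force simp: k_def beta_weight_def)+
  qed
  have [measurable]: "k \<in> borel_measurable borel" unfolding k_def by measurable
  have fin: "(\<integral>\<^sup>+t. ennreal (f t) \<partial>lborel) < \<infinity>" if "\<And>t. f t \<le> beta_weight A b t" for f
    by (rule le_less_trans[OF nn_integral_mono nn_integral_beta_weight_finite[OF A b]]) (rule ennreal_leI[OF that])
  show "(\<integral>\<^sup>+t. ennreal (k t) \<partial>lborel) < \<infinity>" by (rule fin[OF kb(1)])
  have i0: "integrable lborel k" using fin[OF kb(1)] k0 by (auto simp: integrable_iff_bounded)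
  have i1: "integrable lborel (\<lambda>t. k t * t)"
    using fin[OF kb(2)] k0(2) unfolding integrable_iff_bounded by auto
  define F where "F = (\<lambda>t. t powr (A + 1) * (1 - t) powr (b + 1) * (1 + w * t) powr (- (A + b + 2)))"
  let ?f = "\<lambda>t. (A + 1) * k t - (A + 1 + (b + 1) * (1 + w)) * (k t * t)"
  have pos: "1 + w * t > 0" if "t \<ge> 0" for t using that w by (simp add: add_pos_nonneg)
  have "(?f has_integral F 1 - F 0) {0..1}"
  proof (rule fundamental_theorem_of_calculus_interior)
    show "continuous_on {0..1} F"
      unfolding F_def using A b pos
      by (intro continuous_intros continuous_on_powr') (auto simp: less_imp_neq[symmetric])
    fix t :: real assume "t \<in> {0<..<1}"
    then have t: "0 < t" "t < 1" "1 + w * t > 0" using pos[of t] by auto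
    have k: "k t = t powr A * (1 - t) powr b * (1 + w * t) powr (- ?N)"
      using t by (simp add: k_def beta_weight_def)
    have e1: "t powr (A + 1) = t powr A * t" using t by (simp add: powr_add)
    have e2: "(1 - t) powr (b + 1) = (1 - t) powr b * (1 - t)" using t by (simp add: powr_add)
    have e3: "(1 + w * t) powr (- (A + b + 2)) = (1 + w * t) powr (- ?N) * (1 + w * t)"
    proof -
      have "- (A + b + 2) = - ?N + 1" by simp
      then show ?thesis using t(3) by (simp only: powr_add) simp
    qed
    have d1: "((\<lambda>t. t powr (A + 1)) has_real_derivative (A + 1) * t powr A) (at t)"
      using has_real_derivative_powr[OF t(1), of "A + 1"] by simp
    have d2: "((\<lambda>t. (1 - t) powr (b + 1)) has_real_derivative (b + 1) * (1 - t) powr b * (- 1)) (at t)"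
    proof (rule DERIV_chain2[where f = "\<lambda>z. z powr (b + 1)" and g = "\<lambda>t. 1 - t"])
      show "((\<lambda>z. z powr (b + 1)) has_real_derivative (b + 1) * (1 - t) powr b) (at (1 - t))"
        using has_real_derivative_powr[of "1 - t" "b + 1"] t by simp
    qed (auto intro!: derivative_eq_intros)
    have d3: "((\<lambda>t. (1 + w * t) powr (- (A + b + 2))) has_real_derivative
        (- (A + b + 2) * (1 + w * t) powr (- ?N)) * w) (at t)"
    proof (rule DERIV_chain2[where f = "\<lambda>x. x powr (- (A + b + 2))" and g = "\<lambda>t. 1 + w * t"])
      show "((\<lambda>x. x powr (- (A + b + 2))) has_real_derivative - (A + b + 2) * (1 + w * t) powr (- ?N)) (at (1 + w * t))"
        using has_real_derivative_powr[OF t(3), of "- (A + b + 2)"] by (simp add: algebra_simps)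
    qed (auto intro!: derivative_eq_intros)
    have "(F has_real_derivative ?f t) (at t)"
      unfolding F_def
      by (rule DERIV_cong[OF DERIV_mult[OF DERIV_mult[OF d1 d2] d3]])
         (unfold e1 e2 e3 k, simp add: algebra_simps)
    then show "(F has_vector_derivative ?f t) (at t)"
      by (simp add: has_real_derivative_iff_has_vector_derivative)
  qed simp
  moreover have "F 1 - F 0 = 0" using A b by (simp add: F_def)
  ultimately have "(?f has_integral 0) {0..1}" by simp
  then have "((\<lambda>t. if t \<in> {0..1} then ?f t else 0) has_integral 0) UNIV"
    by (simp only: has_integral_restrict_UNIV)
  moreover have "(\<lambda>t. if t \<in> {0..1} then ?f t else 0) = ?f"
    by (auto simp: fun_eq_iff k_def beta_weight_def)
  ultimately have "(?f has_integral 0) UNIV" by simp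
  moreover have "(?f has_integral (\<integral>t. ?f t \<partial>lborel)) UNIV"
    using i0 i1 by (intro has_integral_integral_lborel) simp
  ultimately have "(\<integral>t. ?f t \<partial>lborel) = 0" by (rule has_integral_unique[symmetric])
  then have eq: "(A + 1) * (\<integral>t. k t \<partial>lborel) = (A + 1 + (b + 1) * (1 + w)) * (\<integral>t. k t * t \<partial>lborel)"
    using i0 i1 by simp
  have ratio: "\<alpha> / (w + 1 + \<alpha>) = (A + 1) / (A + 1 + (b + 1) * (1 + w))"
  proof -
    have "w + 1 + \<alpha> = (A + 1 + (b + 1) * (1 + w)) / (b + 1)"
      using b by (simp add: \<alpha>_def field_simps)
    then show ?thesis using b by (simp add: \<alpha>_def)
  qed
  have pos': "A + 1 + (b + 1) * (1 + w) > 0"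
  proof -
    have "0 < (b + 1) * (1 + w)" using b w by (intro mult_pos_pos) auto
    then show ?thesis using A by linarith
  qed
  have solve: "x = c / d * y" if "c * y = d * x" "d > 0" for c d x y :: real
    using that by (simp add: field_simps)
  have "(\<integral>t. k t * t \<partial>lborel) = \<alpha> / (w + 1 + \<alpha>) * (\<integral>t. k t \<partial>lborel)"
    unfolding ratio by (rule solve[OF eq pos'])
  moreover have "(\<integral>\<^sup>+t. ennreal (k t * t) \<partial>lborel) = ennreal (\<integral>t. k t * t \<partial>lborel)"
    using i1 k0 by (intro nn_integral_eq_integral) auto
  moreover have "(\<integral>\<^sup>+t. ennreal (k t) \<partial>lborel) = ennreal (\<integral>t. k t \<partial>lborel)"
    using i0 k0 by (intro nn_integral_eq_integral) auto
  moreover have "\<alpha> / (w + 1 + \<alpha>) \<ge> 0" using A b w by (simp add: \<alpha>_def)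
  moreover have "(\<integral>t. k t \<partial>lborel) \<ge> 0" using k0 by simp
  ultimately show "(\<integral>\<^sup>+t. ennreal (k t * t) \<partial>lborel) = ennreal (\<alpha> / (w + 1 + \<alpha>)) * (\<integral>\<^sup>+t. ennreal (k t) \<partial>lborel)"
    by (simp only: ennreal_mult)
qed

text \<open>
  For the latent pair \<open>l = (t, y)\<close>: the prior weight of \<open>t\<close>, times the density of the data with
  \<open>\<theta>\<close> integrated out, times the factor \<open>1 / v = e\<^sup>-\<^sup>y\<close> of the loss. As a function of \<open>l\<close> this is the
  unnormalised loss-weighted posterior for the prior that is uniform in \<open>y\<close>.
\<close>

definition posterior :: "nat \<Rightarrow> real \<Rightarrow> real \<Rightarrow> (real ^ 'p) \<times> real \<Rightarrow> real \<times> real \<Rightarrow> real" where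
  "posterior n a b z l = beta_weight a b (fst l)
     * (sample_dens n 0 (exp (snd l) / fst l) (exp (snd l)) z * exp (- snd l))"

lemma posterior_nonneg [simp]: "0 \<le> posterior n a b z l"
  by (simp add: posterior_def)

lemma borel_measurable_posterior [measurable (raw)]:
  assumes [measurable]: "f \<in> M \<rightarrow>\<^sub>M borel" "g \<in> M \<rightarrow>\<^sub>M borel"
  shows "(\<lambda>x. posterior n a b (f x) (g x)) \<in> borel_measurable M"
proof -
  have [measurable]: "g \<in> M \<rightarrow>\<^sub>M borel \<Otimes>\<^sub>M borel"
    using assms(2) by (simp add: borel_prod)
  show ?thesis unfolding posterior_def by measurable
qed

text \<open>
  The substitution \<open>y \<mapsto> y + ln c\<close> with \<open>c = (s + t \<parallel>x\<parallel>\<^sup>2) / 2\<close> separates \<open>y\<close> from \<open>t\<close>: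
  the uniform prior of \<open>y\<close> is invariant, so only the power \<open>c\<^sup>-\<^sup>N\<close> remains, whose
  dependence on \<open>t\<close> is that of \<open>(1 + w t)\<^sup>-\<^sup>N\<close>.
\<close>

lemma nn_integral_posterior_scale:
  fixes x :: "real ^ 'p"
  assumes s: "s > 0" and n: "n > 0"
  defines "N \<equiv> real CARD('p) / 2 + real n / 2 + 1"
  obtains C :: ennreal where "C < \<infinity>"
    "\<And>t. (\<integral>\<^sup>+y. ennreal (posterior n a b (x, s) (t, y)) \<partial>lborel)
      = C * ennreal (beta_weight (real CARD('p) / 2 + a) b t * (1 + (norm x)\<^sup>2 / s * t) powr (- N))"
proof -
  let ?p = "real CARD('p)"
  let ?q = "(norm x)\<^sup>2"
  let ?Z = "2 powr (real n / 2) * Gamma (real n / 2)"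
  have Z: "?Z > 0" using n by (auto intro!: mult_pos_pos Gamma_real_pos)
  define C1 where "C1 = (2 * pi) powr (- (?p / 2)) / ?Z * s powr (real n / 2 - 1)"
  have C1: "C1 \<ge> 0" using Z by (simp add: C1_def)
  define G where "G = (\<integral>\<^sup>+y. ennreal (exp (- N * y - exp (- y))) \<partial>lborel)"
  have G: "G < \<infinity>" unfolding G_def by (rule nn_integral_gumbel_finite) (simp add: N_def)
  define C where "C = ennreal (C1 * (s / 2) powr (- N)) * G"
  have "(\<integral>\<^sup>+y. ennreal (posterior n a b (x, s) (t, y)) \<partial>lborel)
      = C * ennreal (beta_weight (?p / 2 + a) b t * (1 + ?q / s * t) powr (- N))" for t
  proof (cases "0 < t \<and> t < 1")
    case True
    then have t: "0 < t" "t < 1" by auto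
    define c where "c = (s + t * ?q) / 2"
    have c: "c > 0" using s t by (simp add: c_def add_pos_nonneg)
    have eq: "posterior n a b (x, s) (t, y) = C1 * beta_weight (?p / 2 + a) b t * exp (- N * y - c * exp (- y))" for y
    proof -
      have ey: "exp y powr r = exp (r * y)" for r by (simp add: powr_def)
      have 1: "(2 * pi * (exp y / t)) powr (- (?p / 2)) = (2 * pi) powr (- (?p / 2)) * exp (- (?p / 2) * y) * t powr (?p / 2)"
      proof -
        have "(2 * pi * (exp y / t)) powr (- (?p / 2)) = (2 * pi) powr (- (?p / 2)) * (exp y powr (- (?p / 2)) / t powr (- (?p / 2)))"
          using t by (simp only: powr_mult[of "2 * pi"] powr_divide)
        also have "exp y powr (- (?p / 2)) / t powr (- (?p / 2)) = exp (- (?p / 2) * y) * t powr (?p / 2)"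
          unfolding ey powr_minus[of t] by (simp only: divide_inverse inverse_inverse_eq)
        finally show ?thesis by (simp only: mult.assoc)
      qed
      have 2: "(s / exp y) powr (real n / 2 - 1) = s powr (real n / 2 - 1) * exp (- (real n / 2 - 1) * y)"
        unfolding powr_divide ey by (simp only: divide_inverse exp_minus[symmetric] mult_minus_left)
      have 3: "?q / (2 * (exp y / t)) = t * ?q / 2 * exp (- y)" "s / exp y / 2 = s / 2 * exp (- y)"
        by (simp_all add: exp_minus field_simps)
      have "posterior n a b (x, s) (t, y) = (t powr a * (1 - t) powr b)
          * ((2 * pi) powr (- (?p / 2)) * exp (- (?p / 2) * y) * t powr (?p / 2) * exp (- (t * ?q / 2 * exp (- y)))
          * (s powr (real n / 2 - 1) * exp (- (real n / 2 - 1) * y) * exp (- (s / 2 * exp (- y))) / ?Z * exp (- y)) * exp (- y))"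
      proof -
        have "s / exp y > 0" using s by simp
        then have "chi_dens n (s / exp y) / exp y
            = s powr (real n / 2 - 1) * exp (- (real n / 2 - 1) * y) * exp (- (s / 2 * exp (- y))) / ?Z * exp (- y)"
          unfolding chi_dens_def 2 3(2) by (simp only: if_True divide_inverse exp_minus)
        moreover have "gauss 0 (exp y / t) x
            = (2 * pi) powr (- (?p / 2)) * exp (- (?p / 2) * y) * t powr (?p / 2) * exp (- (t * ?q / 2 * exp (- y)))"
          unfolding gauss_def diff_0_right 1 3(1) ..
        moreover have "beta_weight a b t = t powr a * (1 - t) powr b"
          using t by (simp add: beta_weight_def)
        ultimately show ?thesis
          unfolding posterior_def sample_dens_def fst_conv snd_conv by (simp only:)
      qed
      also have "\<dots> = C1 * ((t powr a * t powr (?p / 2)) * (1 - t) powr b)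
          * (exp (- (?p / 2) * y) * exp (- (t * ?q / 2 * exp (- y))) * exp (- (real n / 2 - 1) * y) * exp (- (s / 2 * exp (- y))) * exp (- y) * exp (- y))"
        unfolding C1_def by (simp only: divide_inverse mult_ac)
      also have "t powr a * t powr (?p / 2) = t powr (?p / 2 + a)"
        by (simp add: powr_add[symmetric] add.commute)
      also have "exp (- (?p / 2) * y) * exp (- (t * ?q / 2 * exp (- y))) * exp (- (real n / 2 - 1) * y) * exp (- (s / 2 * exp (- y))) * exp (- y) * exp (- y)
          = exp (- N * y - c * exp (- y))"
        unfolding exp_add[symmetric] by (rule arg_cong[of _ _ exp]) (simp add: N_def c_def field_simps)
      finally show ?thesis using t by (simp add: beta_weight_def)
    qed
    let ?B = "beta_weight (?p / 2 + a) b t"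
    have "(\<integral>\<^sup>+y. ennreal (posterior n a b (x, s) (t, y)) \<partial>lborel)
        = (\<integral>\<^sup>+y. ennreal (C1 * ?B) * ennreal (exp (- N * y - c * exp (- y))) \<partial>lborel)"
      unfolding eq using C1 by (intro nn_integral_cong ennreal_mult) auto
    also have "\<dots> = ennreal (C1 * ?B) * (\<integral>\<^sup>+y. ennreal (exp (- N * y - c * exp (- y))) \<partial>lborel)"
      by (rule nn_integral_cmult) measurable
    also have "(\<integral>\<^sup>+y. ennreal (exp (- N * y - c * exp (- y))) \<partial>lborel)
        = ennreal \<bar>1\<bar> * (\<integral>\<^sup>+y. ennreal (exp (- N * (ln c + 1 * y) - c * exp (- (ln c + 1 * y)))) \<partial>lborel)"
      by (rule nn_integral_real_affine) auto
    also have "\<dots> = (\<integral>\<^sup>+y. ennreal (c powr (- N)) * ennreal (exp (- N * y - exp (- y))) \<partial>lborel)"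
    proof -
      have "exp (- N * (ln c + 1 * y) - c * exp (- (ln c + 1 * y))) = c powr (- N) * exp (- N * y - exp (- y))" for y
      proof -
        have "c * exp (- (ln c + 1 * y)) = exp (- y)"
          using c by (simp add: exp_diff exp_minus exp_add field_simps)
        then show ?thesis
          using c by (simp add: powr_def exp_add[symmetric] algebra_simps)
      qed
      then show ?thesis by (simp add: ennreal_mult)
    qed
    also have "\<dots> = ennreal (c powr (- N)) * G"
      unfolding G_def by (rule nn_integral_cmult) measurable
    also have "c powr (- N) = (s / 2) powr (- N) * (1 + ?q / s * t) powr (- N)"
    proof -
      have "c = (s / 2) * (1 + ?q / s * t)" using s by (simp add: c_def field_simps)
      then show ?thesis by (simp only: powr_mult)
    qed
    also have "ennreal (C1 * ?B) * (ennreal ((s / 2) powr (- N) * (1 + ?q / s * t) powr (- N)) * G)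
        = C * ennreal (?B * (1 + ?q / s * t) powr (- N))"
    proof -
      have "ennreal (C1 * ?B) * ennreal ((s / 2) powr (- N) * (1 + ?q / s * t) powr (- N))
          = ennreal (C1 * (s / 2) powr (- N)) * ennreal (?B * (1 + ?q / s * t) powr (- N))"
        using C1 by (simp add: ennreal_mult[symmetric] mult_ac)
      then show ?thesis unfolding C_def by (simp only: mult_ac)
    qed
    finally show ?thesis .
  qed (auto simp: posterior_def beta_weight_def)
  moreover have "C < \<infinity>" unfolding C_def using G by (simp add: ennreal_mult_less_top)
  ultimately show ?thesis using that by blast
qed

lemma posterior_balance:
  fixes x :: "real ^ 'p"
  assumes s: "s > 0" and n: "n > 0" and a: "a > -1" and b: "b > -1" "b = real n / 2 - a - 2"
  defines "\<alpha> \<equiv> (real CARD('p) / 2 + a + 1) / (b + 1)"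
  shows "(\<integral>\<^sup>+l. ennreal (posterior n a b (x, s) l) \<partial>lborel) < \<infinity>"
    and "(\<integral>\<^sup>+l. ennreal (posterior n a b (x, s) l) * ennreal (fst l) \<partial>lborel)
      = ennreal (\<alpha> / ((norm x)\<^sup>2 / s + 1 + \<alpha>)) * (\<integral>\<^sup>+l. ennreal (posterior n a b (x, s) l) \<partial>lborel)"
proof -
  let ?A = "real CARD('p) / 2 + a" and ?w = "(norm x)\<^sup>2 / s"
  let ?N = "real CARD('p) / 2 + real n / 2 + 1"
  let ?k = "\<lambda>t. beta_weight ?A b t * (1 + ?w * t) powr (- ?N)"
  have A: "?A > -1" using a by (simp add: add_nonneg_pos)
  have N: "?N = ?A + b + 3" using b by simp
  have w: "?w \<ge> 0" using s by simp
  obtain C where C: "C < \<infinity>" and inner: "\<And>t. (\<integral>\<^sup>+y. ennreal (posterior n a b (x, s) (t, y)) \<partial>lborel) = C * ennreal (?k t)"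
    using nn_integral_posterior_scale[OF s n, of a b x] by blast
  have M: "(\<integral>\<^sup>+l. ennreal (posterior n a b (x, s) l) * f (fst l) \<partial>lborel) = C * (\<integral>\<^sup>+t. ennreal (?k t) * f t \<partial>lborel)"
    if [measurable]: "f \<in> borel_measurable borel" for f
  proof -
    have "(\<integral>\<^sup>+l. ennreal (posterior n a b (x, s) l) * f (fst l) \<partial>lborel)
        = (\<integral>\<^sup>+l. ennreal (posterior n a b (x, s) l) * f (fst l) \<partial>(lborel \<Otimes>\<^sub>M lborel))"
      by (simp add: lborel_prod)
    also have "\<dots> = (\<integral>\<^sup>+t. \<integral>\<^sup>+y. ennreal (posterior n a b (x, s) (t, y)) * f (fst (t, y)) \<partial>lborel \<partial>lborel)"
    proof (rule lborel.nn_integral_fst[symmetric])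
      have [measurable]: "(\<lambda>l. l) \<in> lborel \<Otimes>\<^sub>M lborel \<rightarrow>\<^sub>M (borel :: (real \<times> real) measure)"
        by (simp add: lborel_prod)
      show "(\<lambda>l. ennreal (posterior n a b (x, s) l) * f (fst l)) \<in> borel_measurable (lborel \<Otimes>\<^sub>M lborel)"
        by measurable
    qed
    also have "\<dots> = (\<integral>\<^sup>+t. C * (ennreal (?k t) * f t) \<partial>lborel)"
    proof (rule nn_integral_cong)
      fix t
      have "(\<integral>\<^sup>+y. ennreal (posterior n a b (x, s) (t, y)) * f t \<partial>lborel) = (\<integral>\<^sup>+y. ennreal (posterior n a b (x, s) (t, y)) \<partial>lborel) * f t"
      proof (rule nn_integral_multc)
        have "(\<lambda>y. (t, y)) \<in> borel \<rightarrow>\<^sub>M (borel :: (real \<times> real) measure)"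
          by (intro borel_measurable_continuous_onI continuous_intros)
        then have [measurable]: "(\<lambda>y. (t, y)) \<in> lborel \<rightarrow>\<^sub>M (borel :: (real \<times> real) measure)"
          by simp
        show "(\<lambda>y. ennreal (posterior n a b (x, s) (t, y))) \<in> borel_measurable lborel" by measurable
      qed
      then show "(\<integral>\<^sup>+y. ennreal (posterior n a b (x, s) (t, y)) * f (fst (t, y)) \<partial>lborel) = C * (ennreal (?k t) * f t)"
        by (simp add: inner mult.assoc)
    qed
    also have "\<dots> = C * (\<integral>\<^sup>+t. ennreal (?k t) * f t \<partial>lborel)"
      by (rule nn_integral_cmult) measurable
    finally show ?thesis .
  qed
  have M0: "(\<integral>\<^sup>+l. ennreal (posterior n a b (x, s) l) \<partial>lborel) = C * (\<integral>\<^sup>+t. ennreal (?k t) \<partial>lborel)"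
    using M[of "\<lambda>_. 1"] by simp
  note bal = beta_balance[OF A b(1) w, folded N]
  show "(\<integral>\<^sup>+l. ennreal (posterior n a b (x, s) l) \<partial>lborel) < \<infinity>"
    unfolding M0 using C bal(1) by (simp add: ennreal_mult_less_top)
  have "(\<integral>\<^sup>+t. ennreal (?k t) * ennreal t \<partial>lborel) = (\<integral>\<^sup>+t. ennreal (?k t * t) \<partial>lborel)"
    by (intro nn_integral_cong) (auto simp: beta_weight_def ennreal_mult)
  then show "(\<integral>\<^sup>+l. ennreal (posterior n a b (x, s) l) * ennreal (fst l) \<partial>lborel)
      = ennreal (\<alpha> / (?w + 1 + \<alpha>)) * (\<integral>\<^sup>+l. ennreal (posterior n a b (x, s) l) \<partial>lborel)"
    unfolding M0 using M[of ennreal] bal(2) by (simp add: \<alpha>_def mult.left_commute)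
qed

section \<open>Comparison of posterior risks under a cut-off scale prior\<close>

text \<open>
  In the application \<open>\<Delta>\<close> is the difference of the two estimates, \<open>(1 - \<tau>) x\<close> is the estimate of the
  shrinkage estimator, \<open>h\<close> is the cut-off prior density and \<open>h\<^sub>0\<close> its value at a centre chosen from the data. The cross
  term \<open>2 h (t - \<tau>) (\<Delta> \<bullet> x)\<close> of the expanded square is split as \<open>h = h\<^sub>0 + (h - h\<^sub>0)\<close>; the first part averages to
  zero over the posterior, and the second one is absorbed by completing a square. The terms with \<open>h\<^sub>0\<close>
  stay on both sides of the inequality, so that no subtraction is needed under the integral.
\<close>

lemma recentred_comparison_pointwise:
  fixes \<Delta> x :: "'a::real_inner"
  assumes h: "h > 0"
  shows "h * (norm \<Delta>)\<^sup>2 / 2 + h * ((t - \<tau>)\<^sup>2 * (norm x)\<^sup>2) + 2 * h0 * (\<Delta> \<bullet> x) * t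
    \<le> h * (norm (\<Delta> + (t - \<tau>) *\<^sub>R x))\<^sup>2 + 2 * ((norm x)\<^sup>2 * (t - \<tau>)\<^sup>2 * ((h - h0)\<^sup>2 / h)) + 2 * h0 * (\<Delta> \<bullet> x) * \<tau>"
proof -
  have sq: "(norm (\<Delta> + k *\<^sub>R x))\<^sup>2 = (norm \<Delta>)\<^sup>2 + 2 * k * (\<Delta> \<bullet> x) + k\<^sup>2 * (norm x)\<^sup>2" for k
    unfolding power2_norm_eq_inner by (simp add: inner_simps inner_commute power2_eq_square algebra_simps)
  \<comment> \<open>The square to be completed is \<open>h / 2\<close> times that of \<open>\<Delta> + ?e\<close>.\<close>
  let ?e = "(2 * (h - h0) * (t - \<tau>) / h) *\<^sub>R x"
  have "0 \<le> h / 2 * (norm (\<Delta> + ?e))\<^sup>2" using h by simp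
  also have "(norm (\<Delta> + ?e))\<^sup>2 = (norm \<Delta>)\<^sup>2 + 2 * (2 * (h - h0) * (t - \<tau>) / h) * (\<Delta> \<bullet> x)
      + (2 * (h - h0) * (t - \<tau>) / h)\<^sup>2 * (norm x)\<^sup>2"
    by (rule sq)
  also have "h / 2 * \<dots> = h / 2 * (norm \<Delta>)\<^sup>2 + 2 * (h - h0) * (t - \<tau>) * (\<Delta> \<bullet> x)
      + 2 * ((norm x)\<^sup>2 * (t - \<tau>)\<^sup>2 * ((h - h0)\<^sup>2 / h))"
    using h by (simp add: field_simps power2_eq_square)
  finally have 1: "0 \<le> h / 2 * (norm \<Delta>)\<^sup>2 + 2 * (h - h0) * (t - \<tau>) * (\<Delta> \<bullet> x)
      + 2 * ((norm x)\<^sup>2 * (t - \<tau>)\<^sup>2 * ((h - h0)\<^sup>2 / h))" .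
  show ?thesis using 1 unfolding sq by (simp add: algebra_simps)
qed

text \<open>
  The integrated form: \<open>\<tau>\<close> is the mean of \<open>t\<close> under the weight \<open>P\<close>, so the two terms with
  \<open>h\<^sub>0\<close> have equal finite integrals and cancel. What is left says that, up to the excess term with
  \<open>(h - h\<^sub>0)\<^sup>2 / h\<close>, moving the estimate by \<open>\<Delta>\<close> costs at least half of its squared length.
\<close>

lemma recentred_comparison:
  fixes \<Delta> x :: "'a::euclidean_space" and P h t :: "'l \<Rightarrow> real"
  assumes [measurable]: "P \<in> borel_measurable M" "h \<in> borel_measurable M" "t \<in> borel_measurable M"
    and P: "\<And>l. P l \<ge> 0" and h: "\<And>l. h l > 0" and t: "\<And>l. P l > 0 \<Longrightarrow> t l \<ge> 0"
    and h0: "h0 \<ge> 0" and \<tau>: "\<tau> \<ge> 0"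
    and fin: "(\<integral>\<^sup>+l. ennreal (P l) \<partial>M) < \<infinity>"
    and mean: "(\<integral>\<^sup>+l. ennreal (P l) * ennreal (t l) \<partial>M) = ennreal \<tau> * (\<integral>\<^sup>+l. ennreal (P l) \<partial>M)"
  shows "(\<integral>\<^sup>+l. ennreal (P l * (h l * (norm \<Delta>)\<^sup>2 / 2)) \<partial>M) + (\<integral>\<^sup>+l. ennreal (P l * (h l * ((t l - \<tau>)\<^sup>2 * (norm x)\<^sup>2))) \<partial>M)
    \<le> (\<integral>\<^sup>+l. ennreal (P l * (h l * (norm (\<Delta> + (t l - \<tau>) *\<^sub>R x))\<^sup>2)) \<partial>M)
      + (\<integral>\<^sup>+l. ennreal (P l * (2 * ((norm x)\<^sup>2 * (t l - \<tau>)\<^sup>2 * ((h l - h0)\<^sup>2 / h l)))) \<partial>M)"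
proof -
  define \<kappa> where "\<kappa> = 2 * h0 * \<bar>\<Delta> \<bullet> x\<bar>"
  have \<kappa>: "\<kappa> \<ge> 0" using h0 by (simp add: \<kappa>_def)
  let ?a = "\<lambda>l. h l * (norm \<Delta>)\<^sup>2 / 2" and ?b = "\<lambda>l. h l * ((t l - \<tau>)\<^sup>2 * (norm x)\<^sup>2)"
  let ?c = "\<lambda>l. h l * (norm (\<Delta> + (t l - \<tau>) *\<^sub>R x))\<^sup>2"
  let ?d = "\<lambda>l. 2 * ((norm x)\<^sup>2 * (t l - \<tau>)\<^sup>2 * ((h l - h0)\<^sup>2 / h l))"
  let ?I = "\<lambda>f. \<integral>\<^sup>+l. ennreal (P l * f l) \<partial>M"
  have h': "h l \<ge> 0" for l using h[of l] by simp
  have sum3: "?I (\<lambda>l. f l + g l + k l) = ?I f + ?I g + ?I k"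
    if [measurable]: "f \<in> borel_measurable M" "g \<in> borel_measurable M" "k \<in> borel_measurable M"
      and nn: "\<And>l. P l > 0 \<Longrightarrow> f l \<ge> 0" "\<And>l. P l > 0 \<Longrightarrow> g l \<ge> 0" "\<And>l. P l > 0 \<Longrightarrow> k l \<ge> 0" for f g k
  proof -
    have "ennreal (P l * (f l + g l + k l)) = ennreal (P l * f l) + ennreal (P l * g l) + ennreal (P l * k l)" for l
    proof (cases "P l > 0")
      case True
      then have "0 \<le> P l * f l" "0 \<le> P l * g l" "0 \<le> P l * k l" using nn by auto
      then show ?thesis by (simp add: distrib_left flip: ennreal_plus)
    next
      case False
      then have "P l = 0" using P[of l] by linarith
      then show ?thesis by simp
    qed
    then show ?thesis by (simp add: nn_integral_add)
  qed
  have c1: "?I (\<lambda>l. \<kappa> * \<tau>) = ennreal (\<kappa> * \<tau>) * (\<integral>\<^sup>+l. ennreal (P l) \<partial>M)"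
  proof -
    have "?I (\<lambda>l. \<kappa> * \<tau>) = (\<integral>\<^sup>+l. ennreal (\<kappa> * \<tau>) * ennreal (P l) \<partial>M)"
      using P \<kappa> \<tau> by (intro nn_integral_cong) (simp add: ennreal_mult[symmetric] mult_ac)
    also have "\<dots> = ennreal (\<kappa> * \<tau>) * (\<integral>\<^sup>+l. ennreal (P l) \<partial>M)" by (rule nn_integral_cmult) measurable
    finally show ?thesis .
  qed
  have c2: "?I (\<lambda>l. \<kappa> * t l) = ennreal (\<kappa> * \<tau>) * (\<integral>\<^sup>+l. ennreal (P l) \<partial>M)"
  proof -
    have "?I (\<lambda>l. \<kappa> * t l) = (\<integral>\<^sup>+l. ennreal \<kappa> * (ennreal (P l) * ennreal (t l)) \<partial>M)"
    proof (rule nn_integral_cong)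
      fix l
      show "ennreal (P l * (\<kappa> * t l)) = ennreal \<kappa> * (ennreal (P l) * ennreal (t l))"
      proof (cases "P l > 0")
        case True
        then show ?thesis using \<kappa> t[of l] by (simp add: ennreal_mult[symmetric] mult_ac)
      next
        case False
        then have "P l = 0" using P[of l] by linarith
        then show ?thesis by simp
      qed
    qed
    also have "\<dots> = ennreal \<kappa> * (\<integral>\<^sup>+l. ennreal (P l) * ennreal (t l) \<partial>M)" by (rule nn_integral_cmult) measurable
    finally show ?thesis unfolding mean using \<kappa> \<tau> by (simp add: ennreal_mult mult.assoc)
  qed
  have fin': "ennreal (\<kappa> * \<tau>) * (\<integral>\<^sup>+l. ennreal (P l) \<partial>M) \<noteq> \<infinity>"
    using fin by (simp add: ennreal_mult_eq_top_iff)
  let ?m = "ennreal (\<kappa> * \<tau>) * (\<integral>\<^sup>+l. ennreal (P l) \<partial>M)"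
  have "?I ?a + ?I ?b + ?m \<le> ?I ?c + ?I ?d + ?m"
  \<comment> \<open>The terms with \<open>h0\<close> are kept on the sides on which their coefficient is non-negative.\<close>
  proof (cases "\<Delta> \<bullet> x \<ge> 0")
    case True
    then have \<kappa>': "2 * h0 * (\<Delta> \<bullet> x) = \<kappa>" by (simp add: \<kappa>_def)
    have "?I (\<lambda>l. ?a l + ?b l + \<kappa> * t l) \<le> ?I (\<lambda>l. ?c l + ?d l + \<kappa> * \<tau>)"
      using recentred_comparison_pointwise[OF h, of _ \<Delta> _ \<tau> x h0] P unfolding \<kappa>'
      by (intro nn_integral_mono ennreal_leI mult_left_mono) auto
    moreover have "?I (\<lambda>l. ?a l + ?b l + \<kappa> * t l) = ?I ?a + ?I ?b + ?m"
      unfolding c2[symmetric] by (rule sum3) (use h' \<kappa> t in auto)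
    moreover have "?I (\<lambda>l. ?c l + ?d l + \<kappa> * \<tau>) = ?I ?c + ?I ?d + ?m"
      unfolding c1[symmetric] by (rule sum3) (use h' \<kappa> \<tau> in auto)
    ultimately show ?thesis by simp
  next
    case False
    then have \<kappa>': "2 * h0 * (\<Delta> \<bullet> x) = - \<kappa>" by (simp add: \<kappa>_def)
    have "?a l + ?b l + \<kappa> * \<tau> \<le> ?c l + ?d l + \<kappa> * t l" for l
      using recentred_comparison_pointwise[OF h, of l \<Delta> "t l" \<tau> x h0] unfolding \<kappa>' by linarith
    then have "?I (\<lambda>l. ?a l + ?b l + \<kappa> * \<tau>) \<le> ?I (\<lambda>l. ?c l + ?d l + \<kappa> * t l)"
      using P by (intro nn_integral_mono ennreal_leI mult_left_mono)
    moreover have "?I (\<lambda>l. ?a l + ?b l + \<kappa> * \<tau>) = ?I ?a + ?I ?b + ?m"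
      unfolding c1[symmetric] by (rule sum3) (use h' \<kappa> \<tau> in auto)
    moreover have "?I (\<lambda>l. ?c l + ?d l + \<kappa> * t l) = ?I ?c + ?I ?d + ?m"
      unfolding c2[symmetric] by (rule sum3) (use h' \<kappa> t in auto)
    ultimately show ?thesis by simp
  qed
  then show ?thesis
    using fin' by (simp add: add.commute[of _ ?m] ennreal_add_left_cancel_le)
qed

text \<open>
  With \<open>g = ln (h y / h c)\<close> the left-hand side is \<open>h c (e\<^sup>g - 1)\<^sup>2 e\<^sup>-\<^sup>g\<close>, and
  \<open>\<bar>g\<bar> \<le> \<epsilon> \<bar>y - c\<bar>\<close>. The factor \<open>\<epsilon>\<^sup>2\<close> is the gain; the exponentials on the right become
  \<open>u + 1 / u\<close> for the chi-square variable \<open>u = s / v\<close>, whose moments are finite.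
\<close>

lemma exp_neg_abs_slowly_varying:
  fixes y c \<epsilon> :: real
  assumes \<epsilon>: "0 < \<epsilon>" "\<epsilon> \<le> 1 / 2"
  defines "h \<equiv> (\<lambda>y. exp (- \<epsilon> * \<bar>y\<bar>))"
  shows "(h y - h c)\<^sup>2 / h y \<le> 16 * \<epsilon>\<^sup>2 * (exp (c - y) + exp (y - c)) * h c"
proof -
  define g where "g = \<epsilon> * (\<bar>c\<bar> - \<bar>y\<bar>)"
  define d where "d = \<bar>y - c\<bar>"
  have g: "\<bar>g\<bar> \<le> \<epsilon> * d"
    using \<epsilon> unfolding g_def d_def abs_mult by (intro mult_mono) auto
  have hy: "h y = h c * exp g"
    by (simp add: h_def g_def exp_add[symmetric] algebra_simps)
  have hc: "h c > 0" by (simp add: h_def)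
  have "(h y - h c)\<^sup>2 / h y = h c * ((exp g - 1)\<^sup>2 * exp (- g))"
    unfolding hy using hc by (simp add: power2_eq_square exp_minus field_simps)
  also have "(exp g - 1)\<^sup>2 * exp (- g) \<le> g\<^sup>2 * exp \<bar>g\<bar>"
  proof -
    have pos: "(exp r - 1)\<^sup>2 * exp (- r) \<le> r\<^sup>2 * exp r" if "r \<ge> 0" for r :: real
    proof -
      have "1 - exp (- r) \<le> r" "0 \<le> 1 - exp (- r)" using exp_ge_add_one_self[of "- r"] that by auto
      then have "(1 - exp (- r))\<^sup>2 \<le> r\<^sup>2" by (intro power_mono) auto
      then have "(1 - exp (- r))\<^sup>2 * exp r \<le> r\<^sup>2 * exp r" by (intro mult_right_mono) auto
      moreover have "(exp r - 1)\<^sup>2 * exp (- r) = (1 - exp (- r))\<^sup>2 * exp r"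
        by (simp add: power2_eq_square algebra_simps exp_minus)
      ultimately show ?thesis by simp
    qed
    have "(exp (- r) - 1)\<^sup>2 * exp r = (exp r - 1)\<^sup>2 * exp (- r)" for r :: real
      by (simp add: power2_eq_square algebra_simps exp_minus)
    then show ?thesis
      using pos[of g] pos[of "- g"] by (cases "g \<ge> 0") auto
  qed
  also have "g\<^sup>2 * exp \<bar>g\<bar> \<le> (\<epsilon> * d)\<^sup>2 * exp (d / 2)"
  proof (intro mult_mono)
    show "g\<^sup>2 \<le> (\<epsilon> * d)\<^sup>2" using power_mono[OF g, of 2] by simp
    have "\<epsilon> * d \<le> 1 / 2 * d" using \<epsilon> by (intro mult_right_mono) (auto simp: d_def)
    then show "exp \<bar>g\<bar> \<le> exp (d / 2)" using g by simp
  qed auto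
  also have "(\<epsilon> * d)\<^sup>2 * exp (d / 2) \<le> 16 * \<epsilon>\<^sup>2 * exp d"
  proof -
    have "d / 4 \<le> exp (d / 4)" using exp_ge_add_one_self[of "d / 4"] by linarith
    then have "(d / 4)\<^sup>2 \<le> (exp (d / 4))\<^sup>2" by (intro power_mono) (auto simp: d_def)
    then have "d\<^sup>2 \<le> 16 * exp (d / 2)" by (simp add: power_divide exp_double[symmetric])
    then have "\<epsilon>\<^sup>2 * d\<^sup>2 * exp (d / 2) \<le> \<epsilon>\<^sup>2 * (16 * exp (d / 2)) * exp (d / 2)"
      by (intro mult_right_mono mult_left_mono) auto
    also have "\<dots> = 16 * \<epsilon>\<^sup>2 * (exp (d / 2) * exp (d / 2))" by simp
    also have "exp (d / 2) * exp (d / 2) = exp d" by (simp add: exp_add[symmetric])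
    finally show ?thesis by (simp add: power_mult_distrib)
  qed
  also have "16 * \<epsilon>\<^sup>2 * exp d \<le> 16 * \<epsilon>\<^sup>2 * (exp (c - y) + exp (y - c))"
    by (intro mult_left_mono) (auto simp: d_def abs_if)
  finally show ?thesis using hc by (simp add: mult_ac)
qed

section \<open>Excess risk under the cut-off prior\<close>

definition scale_cutoff :: "real \<Rightarrow> real \<Rightarrow> real" where
  "scale_cutoff \<epsilon> y = exp (- \<epsilon> * \<bar>y\<bar>)"

lemma scale_cutoff_pos [simp]: "0 < scale_cutoff \<epsilon> y"
  by (simp add: scale_cutoff_def)

lemma scale_cutoff_nonneg [simp]: "0 \<le> scale_cutoff \<epsilon> y"
  by (simp add: scale_cutoff_def)

lemma borel_measurable_scale_cutoff [measurable]: "scale_cutoff \<epsilon> \<in> borel_measurable borel"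
  unfolding scale_cutoff_def by measurable

lemma nn_integral_scale_cutoff:
  "\<epsilon> > 0 \<Longrightarrow> (\<integral>\<^sup>+y. ennreal (scale_cutoff \<epsilon> (y + c)) \<partial>lborel) = ennreal (2 / \<epsilon>)"
  using nn_integral_exp_neg_abs[of \<epsilon> "- c"] by (simp add: scale_cutoff_def)

lemma nn_integral_lborel_pair:
  fixes f :: "'a::euclidean_space \<times> 'b::euclidean_space \<Rightarrow> ennreal"
  assumes "f \<in> borel_measurable borel"
  shows "(\<integral>\<^sup>+l. f l \<partial>lborel) = (\<integral>\<^sup>+t. \<integral>\<^sup>+y. f (t, y) \<partial>lborel \<partial>lborel)"
proof -
  have "f \<in> borel_measurable (lborel \<Otimes>\<^sub>M lborel)" using assms by (simp add: lborel_prod)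
  from lborel.nn_integral_fst[OF this] show ?thesis by (simp add: lborel_prod)
qed

lemma nn_integral_chi_moments_finite:
  assumes n: "n \<ge> 3" and p: "p \<ge> 0" and c: "c \<ge> 0"
  shows "(\<integral>\<^sup>+u. ennreal (chi_dens n u * ((p + c * u) * (u + 1 / u))) \<partial>lborel) < \<infinity>"
proof -
  let ?M = "\<lambda>m. \<integral>\<^sup>+u. ennreal (chi_dens n u * u powr m) \<partial>lborel"
  have M: "?M m < \<infinity>" if "m \<ge> -1" for m
    using n that by (subst nn_integral_chi_dens_powr) auto
  have "(\<integral>\<^sup>+u. ennreal (chi_dens n u * ((p + c * u) * (u + 1 / u))) \<partial>lborel)
      = (\<integral>\<^sup>+u. ennreal p * ennreal (chi_dens n u * u powr 1) + ennreal p * ennreal (chi_dens n u * u powr (-1))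
        + ennreal c * ennreal (chi_dens n u * u powr 2) + ennreal c * ennreal (chi_dens n u * u powr 0) \<partial>lborel)"
  proof (rule nn_integral_cong)
    fix u
    show "ennreal (chi_dens n u * ((p + c * u) * (u + 1 / u)))
      = ennreal p * ennreal (chi_dens n u * u powr 1) + ennreal p * ennreal (chi_dens n u * u powr (-1))
        + ennreal c * ennreal (chi_dens n u * u powr 2) + ennreal c * ennreal (chi_dens n u * u powr 0)"
    proof (cases "u > 0")
      case True
      have "u powr 2 = u * u" using True by (simp add: powr_numeral power2_eq_square)
      then have "chi_dens n u * ((p + c * u) * (u + 1 / u)) = p * (chi_dens n u * u powr 1)
          + p * (chi_dens n u * u powr (-1)) + c * (chi_dens n u * u powr 2) + c * (chi_dens n u * u powr 0)"
        using True by (simp add: powr_minus field_simps)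
      then show ?thesis
        using p c by (simp only: ennreal_plus ennreal_mult mult_nonneg_nonneg add_nonneg_nonneg chi_dens_nonneg powr_ge_zero)
    qed (simp add: chi_dens_def)
  qed
  also have "\<dots> = ennreal p * ?M 1 + ennreal p * ?M (-1) + ennreal c * ?M 2 + ennreal c * ?M 0"
    by (simp add: nn_integral_add nn_integral_cmult)
  also have "\<dots> < \<infinity>"
    using M[of 1] M[of "-1"] M[of 2] M[of 0] by (simp add: ennreal_mult_less_top)
  finally show ?thesis .
qed

text \<open>
  The cut-off is recentred at \<open>y = ln s\<close>, the natural guess of the log-scale from the data. For fixed
  \<open>(t, y)\<close> the data are \<open>x \<sim> N(0, v / t)\<close> and \<open>s = v u\<close>, so that the excess reduces to
  \<open>\<epsilon>\<^sup>2\<close> times moments of \<open>u\<close> times \<open>h(y + ln u)\<close>. Integrating over \<open>y\<close> last gives \<open>2 / \<epsilon>\<close> for every \<open>u\<close>, by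
  translation invariance, and one factor \<open>\<epsilon>\<close> survives.
\<close>

lemma excess_risk_bound:
  fixes a b \<alpha> :: real
  assumes n: "n \<ge> 3" and a: "a > -1" and b: "b > -1" and \<alpha>: "\<alpha> > 0"
  defines "\<tau> \<equiv> (\<lambda>z :: (real ^ 'p) \<times> real. \<alpha> / ((norm (fst z))\<^sup>2 / snd z + 1 + \<alpha>))"
  obtains K where "K < \<infinity>"
    "\<And>\<epsilon>. 0 < \<epsilon> \<Longrightarrow> \<epsilon> \<le> 1 / 2 \<Longrightarrow>
      (\<integral>\<^sup>+z. \<integral>\<^sup>+l. ennreal (posterior n a b z l * (2 * ((norm (fst z))\<^sup>2 * (fst l - \<tau> z)\<^sup>2
        * ((scale_cutoff \<epsilon> (snd l) - scale_cutoff \<epsilon> (ln (snd z)))\<^sup>2 / scale_cutoff \<epsilon> (snd l))))) \<partial>lborel \<partial>lborel)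
      \<le> K * ennreal \<epsilon>"
proof -
  let ?p = "real CARD('p)"
  let ?B = "\<integral>\<^sup>+t. ennreal (beta_weight a b t) \<partial>lborel"
  let ?m = "\<lambda>u. (?p + \<alpha>\<^sup>2 * u) * (u + 1 / u)"
  let ?C = "\<integral>\<^sup>+u. ennreal (chi_dens n u * ?m u) \<partial>lborel"
  have B: "?B < \<infinity>" by (rule nn_integral_beta_weight_finite[OF a b])
  have C: "?C < \<infinity>" by (rule nn_integral_chi_moments_finite[OF n]) auto
  have n0: "n > 0" using n by simp
  have [measurable]: "\<tau> \<in> borel_measurable borel" unfolding \<tau>_def by measurable
  show ?thesis
  proof (rule that)
    show "?B * (64 * ?C) < \<infinity>" using B C by (simp add: ennreal_mult_less_top)
    fix \<epsilon> :: real assume \<epsilon>: "0 < \<epsilon>" "\<epsilon> \<le> 1 / 2"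
    let ?h = "scale_cutoff \<epsilon>"
    let ?F = "\<lambda>z l. posterior n a b z l * (2 * ((norm (fst z))\<^sup>2 * (fst l - \<tau> z)\<^sup>2
        * ((?h (snd l) - ?h (ln (snd z)))\<^sup>2 / ?h (snd l))))"
    let ?f = "\<lambda>l z. beta_weight a b (fst l) * (32 * \<epsilon>\<^sup>2 * (exp (- snd l) * (((fst l)\<^sup>2 * (norm (fst z))\<^sup>2 + \<alpha>\<^sup>2 * snd z)
        * (snd z / exp (snd l) + exp (snd l) / snd z)) * ?h (ln (snd z))))"
    have pt: "?F z l \<le> sample_dens n 0 (exp (snd l) / fst l) (exp (snd l)) z * ?f l z" for z :: "(real ^ 'p) \<times> real" and l
    proof (cases "0 < fst l \<and> fst l < 1 \<and> snd z > 0")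
      case True
      obtain x s where z: "z = (x, s)" by force
      obtain t y where l: "l = (t, y)" by force
      have t: "0 < t" "t < 1" and s: "s > 0" using True by (auto simp: z l)
      let ?q = "(norm x)\<^sup>2"
      define w where "w = ?q / s"
      have w: "w \<ge> 0" "?q = s * w" using s by (auto simp: w_def)
      have \<tau>z: "\<tau> z = \<alpha> / (w + 1 + \<alpha>)" by (simp add: \<tau>_def z w_def)
      have \<tau>0: "\<tau> z \<ge> 0" unfolding \<tau>z using \<alpha> w by simp
      have "w \<le> (w + 1 + \<alpha>)\<^sup>2"
      proof -
        have "w \<le> 1 * (w + 1 + \<alpha>)" using \<alpha> by simp
        also have "\<dots> \<le> (w + 1 + \<alpha>) * (w + 1 + \<alpha>)" using \<alpha> w by (intro mult_right_mono) auto
        finally show ?thesis by (simp add: power2_eq_square)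
      qed
      then have "w * (\<tau> z)\<^sup>2 \<le> \<alpha>\<^sup>2"
        unfolding \<tau>z using \<alpha> w by (simp add: power_divide divide_le_eq mult.commute mult_left_mono)
      then have "s * (w * (\<tau> z)\<^sup>2) \<le> s * \<alpha>\<^sup>2" using s by (intro mult_left_mono) auto
      then have q\<tau>: "?q * (\<tau> z)\<^sup>2 \<le> \<alpha>\<^sup>2 * s" unfolding w(2) by (simp add: mult_ac)
      have "(t - \<tau> z)\<^sup>2 \<le> t\<^sup>2 + (\<tau> z)\<^sup>2" using t \<tau>0 by (simp add: power2_diff)
      then have "?q * (t - \<tau> z)\<^sup>2 \<le> ?q * (t\<^sup>2 + (\<tau> z)\<^sup>2)" by (intro mult_left_mono) auto
      also have "\<dots> \<le> t\<^sup>2 * ?q + \<alpha>\<^sup>2 * s" using q\<tau> by (simp add: algebra_simps)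
      finally have 1: "?q * (t - \<tau> z)\<^sup>2 \<le> t\<^sup>2 * ?q + \<alpha>\<^sup>2 * s" .
      have 2: "(?h y - ?h (ln s))\<^sup>2 / ?h y \<le> 16 * \<epsilon>\<^sup>2 * (s / exp y + exp y / s) * ?h (ln s)"
        using exp_neg_abs_slowly_varying[OF \<epsilon>, of y "ln s"] s
        by (simp add: scale_cutoff_def exp_diff)
      have "?q * (t - \<tau> z)\<^sup>2 * ((?h y - ?h (ln s))\<^sup>2 / ?h y)
          \<le> (t\<^sup>2 * ?q + \<alpha>\<^sup>2 * s) * (16 * \<epsilon>\<^sup>2 * (s / exp y + exp y / s) * ?h (ln s))"
        using s by (intro mult_mono 1 2) auto
      then have "posterior n a b z l * (2 * (?q * (t - \<tau> z)\<^sup>2 * ((?h y - ?h (ln s))\<^sup>2 / ?h y)))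
          \<le> posterior n a b z l * (2 * ((t\<^sup>2 * ?q + \<alpha>\<^sup>2 * s) * (16 * \<epsilon>\<^sup>2 * (s / exp y + exp y / s) * ?h (ln s))))"
        by (intro mult_left_mono) auto
      also have "\<dots> = sample_dens n 0 (exp (snd l) / fst l) (exp (snd l)) z * ?f l z"
      proof -
        have gen: "2 * (X * (16 * e * Y * H)) = 32 * e * (X * Y * H)" for X e Y H :: real by simp
        show ?thesis unfolding gen posterior_def z l fst_conv snd_conv by (simp only: mult_ac)
      qed
      finally show ?thesis by (simp add: z l)
    next
      case False
      then have "posterior n a b z l = 0 \<and> (beta_weight a b (fst l) = 0 \<or> sample_dens n 0 (exp (snd l) / fst l) (exp (snd l)) z = 0)"
        by (auto simp: posterior_def beta_weight_def sample_dens_def chi_dens_def zero_less_divide_iff)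
      then show ?thesis by auto
    qed
    have inner: "(\<integral>\<^sup>+z. ennreal (?F z (t, y)) \<partial>lborel)
        \<le> ennreal (beta_weight a b t) * (\<integral>\<^sup>+u. ennreal (32 * \<epsilon>\<^sup>2 * (chi_dens n u * ?m u)) * ennreal (?h (y + ln u)) \<partial>lborel)" for t y
    proof (cases "0 < t \<and> t < 1")
      case True
      then have t: "0 < t" "t < 1" by auto
      let ?v = "exp y"
      let ?D = "\<lambda>x u. 32 * \<epsilon>\<^sup>2 * (((t\<^sup>2 * (norm (x :: real ^ 'p))\<^sup>2) / ?v + \<alpha>\<^sup>2 * u) * (u + 1 / u)) * ?h (y + ln u)"
      have "(\<integral>\<^sup>+z. ennreal (?F z (t, y)) \<partial>lborel)
          \<le> (\<integral>\<^sup>+z. ennreal (sample_dens n (0 :: real ^ 'p) (?v / t) ?v z) * ennreal (?f (t, y) z) \<partial>lborel)"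
      proof (rule nn_integral_mono)
        fix z :: "(real ^ 'p) \<times> real"
        have "ennreal (?F z (t, y)) \<le> ennreal (sample_dens n 0 (?v / t) ?v z * ?f (t, y) z)"
          using pt[of z "(t, y)"] by (intro ennreal_leI) (simp only: fst_conv snd_conv)
        also have "\<dots> = ennreal (sample_dens n (0 :: real ^ 'p) (?v / t) ?v z) * ennreal (?f (t, y) z)"
          by (rule ennreal_mult') simp
        finally show "ennreal (?F z (t, y)) \<le> ennreal (sample_dens n (0 :: real ^ 'p) (?v / t) ?v z) * ennreal (?f (t, y) z)" .
      qed
      also have "\<dots> = (\<integral>\<^sup>+x. ennreal (gauss (0 :: real ^ 'p) (?v / t) x) * (\<integral>\<^sup>+u. ennreal (chi_dens n u) * ennreal (?f (t, y) (x, ?v * u)) \<partial>lborel) \<partial>lborel)"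
        by (rule nn_integral_sample_dens) (simp, measurable)
      also have "\<dots> = (\<integral>\<^sup>+x. ennreal (gauss (0 :: real ^ 'p) (?v / t) x) * (\<integral>\<^sup>+u. ennreal (chi_dens n u) * ennreal (beta_weight a b t * ?D x u) \<partial>lborel) \<partial>lborel)"
      proof (rule nn_integral_cong, rule arg_cong2[where f = "(*)", OF refl], rule nn_integral_cong)
        fix x :: "real ^ 'p" and u
        show "ennreal (chi_dens n u) * ennreal (?f (t, y) (x, ?v * u)) = ennreal (chi_dens n u) * ennreal (beta_weight a b t * ?D x u)"
        proof (cases "u > 0")
          case True
          have ln: "ln (?v * u) = y + ln u" using True by (simp add: ln_mult)
          have "exp (- y) * ((t\<^sup>2 * (norm x)\<^sup>2 + \<alpha>\<^sup>2 * (?v * u)) * (?v * u / ?v + ?v / (?v * u)))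
              = ((t\<^sup>2 * (norm x)\<^sup>2) / ?v + \<alpha>\<^sup>2 * u) * (u + 1 / u)"
            using True by (simp add: exp_minus field_simps)
          then have "exp (- y) * ((t\<^sup>2 * (norm x)\<^sup>2 + \<alpha>\<^sup>2 * (?v * u)) * (?v * u / ?v + ?v / (?v * u)) * ?h (y + ln u))
              = ((t\<^sup>2 * (norm x)\<^sup>2) / ?v + \<alpha>\<^sup>2 * u) * (u + 1 / u) * ?h (y + ln u)"
            by (metis mult.assoc)
          then show ?thesis unfolding fst_conv snd_conv ln by (simp only: mult.assoc)
        qed (simp add: chi_dens_def)
      qed
      also have "\<dots> = (\<integral>\<^sup>+u. ennreal (chi_dens n u) * (\<integral>\<^sup>+x. ennreal (gauss (0 :: real ^ 'p) (?v / t) x) * ennreal (beta_weight a b t * ?D x u) \<partial>lborel) \<partial>lborel)"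
        by (rule nn_integral_weighted_swap) measurable
      also have "\<dots> \<le> (\<integral>\<^sup>+u. ennreal (beta_weight a b t) * (ennreal (32 * \<epsilon>\<^sup>2 * (chi_dens n u * ?m u)) * ennreal (?h (y + ln u))) \<partial>lborel)"
      proof (rule nn_integral_mono)
        fix u
        show "ennreal (chi_dens n u) * (\<integral>\<^sup>+x. ennreal (gauss (0 :: real ^ 'p) (?v / t) x) * ennreal (beta_weight a b t * ?D x u) \<partial>lborel)
          \<le> ennreal (beta_weight a b t) * (ennreal (32 * \<epsilon>\<^sup>2 * (chi_dens n u * ?m u)) * ennreal (?h (y + ln u)))"
        proof (cases "u > 0")
          case u: True
          let ?r = "beta_weight a b t * (32 * \<epsilon>\<^sup>2 * (u + 1 / u) * ?h (y + ln u))"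
          have r: "?r \<ge> 0" using u by simp
          let ?g = "gauss (0 :: real ^ 'p) (?v / t)"
          have "(\<integral>\<^sup>+x. ennreal (?g x) * ennreal (beta_weight a b t * ?D x u) \<partial>lborel)
              = (\<integral>\<^sup>+x. ennreal ?r * (ennreal (t\<^sup>2 / ?v) * ennreal (?g x * (norm x)\<^sup>2) + ennreal (\<alpha>\<^sup>2 * u) * ennreal (?g x)) \<partial>lborel)"
          proof (rule nn_integral_cong)
            fix x
            have "?g x * (beta_weight a b t * ?D x u) = ?r * (t\<^sup>2 / ?v * (?g x * (norm x)\<^sup>2) + \<alpha>\<^sup>2 * u * ?g x)"
            proof -
              have "g * (B * (32 * e * ((T * N / V + c) * W) * H)) = B * (32 * e * W * H) * (T / V * (g * N) + c * g)"
                for g B e T N V c W H :: real by (simp add: algebra_simps)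
              then show ?thesis .
            qed
            moreover have "ennreal (?g x) * ennreal (beta_weight a b t * ?D x u) = ennreal (?g x * (beta_weight a b t * ?D x u))"
              by (rule ennreal_mult'[symmetric]) simp
            moreover have "ennreal (?r * (t\<^sup>2 / ?v * (?g x * (norm x)\<^sup>2) + \<alpha>\<^sup>2 * u * ?g x))
                = ennreal ?r * (ennreal (t\<^sup>2 / ?v) * ennreal (?g x * (norm x)\<^sup>2) + ennreal (\<alpha>\<^sup>2 * u) * ennreal (?g x))"
            proof -
              have "0 \<le> t\<^sup>2 / ?v" "0 \<le> ?g x * (norm x)\<^sup>2" "0 \<le> \<alpha>\<^sup>2 * u" "0 \<le> ?g x" using u by auto
              with r show ?thesis by (simp only: ennreal_mult ennreal_plus mult_nonneg_nonneg add_nonneg_nonneg)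
            qed
            ultimately show "ennreal (?g x) * ennreal (beta_weight a b t * ?D x u)
              = ennreal ?r * (ennreal (t\<^sup>2 / ?v) * ennreal (?g x * (norm x)\<^sup>2) + ennreal (\<alpha>\<^sup>2 * u) * ennreal (?g x))" by (simp only:)
          qed
          also have "\<dots> = ennreal ?r * (ennreal (t\<^sup>2 / ?v) * ennreal (?p * (?v / t)) + ennreal (\<alpha>\<^sup>2 * u))"
            using t by (simp add: nn_integral_cmult nn_integral_add nn_integral_gauss nn_integral_gauss_norm_sq)
          also have "\<dots> = ennreal (?r * (t * ?p + \<alpha>\<^sup>2 * u))"
          proof -
            have "t\<^sup>2 / ?v * (?p * (?v / t)) = t * ?p" using t by (simp add: power2_eq_square)
            moreover have "ennreal (t\<^sup>2 / ?v) * ennreal (?p * (?v / t)) = ennreal (t\<^sup>2 / ?v * (?p * (?v / t)))"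
              using t by (intro ennreal_mult[symmetric]) auto
            moreover have "0 \<le> t * ?p" "0 \<le> \<alpha>\<^sup>2 * u" using t u by auto
            ultimately show ?thesis using r by (simp only: ennreal_mult ennreal_plus add_nonneg_nonneg)
          qed
          also have "\<dots> \<le> ennreal (?r * (?p + \<alpha>\<^sup>2 * u))"
            using t r by (intro ennreal_leI mult_left_mono add_right_mono) (auto intro: mult_left_le_one_le)
          finally have "ennreal (chi_dens n u) * (\<integral>\<^sup>+x. ennreal (?g x) * ennreal (beta_weight a b t * ?D x u) \<partial>lborel)
              \<le> ennreal (chi_dens n u) * ennreal (?r * (?p + \<alpha>\<^sup>2 * u))" by (rule mult_left_mono) simp
          also have "\<dots> = ennreal (chi_dens n u * (?r * (?p + \<alpha>\<^sup>2 * u)))"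
            by (rule ennreal_mult'[symmetric]) simp
          also have "chi_dens n u * (?r * (?p + \<alpha>\<^sup>2 * u)) = beta_weight a b t * (32 * \<epsilon>\<^sup>2 * (chi_dens n u * ?m u) * ?h (y + ln u))"
            by (simp only: mult_ac)
          also have "ennreal \<dots> = ennreal (beta_weight a b t) * (ennreal (32 * \<epsilon>\<^sup>2 * (chi_dens n u * ?m u)) * ennreal (?h (y + ln u)))"
          proof -
            have "0 \<le> 32 * \<epsilon>\<^sup>2 * (chi_dens n u * ?m u)" using u by simp
            then show ?thesis by (simp only: ennreal_mult mult_nonneg_nonneg beta_weight_nonneg scale_cutoff_nonneg)
          qed
          finally show ?thesis .
        qed (simp add: chi_dens_def)
      qed
      also have "\<dots> = ennreal (beta_weight a b t) * (\<integral>\<^sup>+u. ennreal (32 * \<epsilon>\<^sup>2 * (chi_dens n u * ?m u)) * ennreal (?h (y + ln u)) \<partial>lborel)"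
        by (rule nn_integral_cmult) measurable
      finally show ?thesis .
    qed (auto simp: posterior_def beta_weight_def)
    have y_int: "(\<integral>\<^sup>+y. \<integral>\<^sup>+u. ennreal (32 * \<epsilon>\<^sup>2 * (chi_dens n u * ?m u)) * ennreal (?h (y + ln u)) \<partial>lborel \<partial>lborel) = 64 * ?C * ennreal \<epsilon>"
    proof -
      have "(\<integral>\<^sup>+y. \<integral>\<^sup>+u. ennreal (32 * \<epsilon>\<^sup>2 * (chi_dens n u * ?m u)) * ennreal (?h (y + ln u)) \<partial>lborel \<partial>lborel)
          = (\<integral>\<^sup>+u. \<integral>\<^sup>+y. ennreal (32 * \<epsilon>\<^sup>2 * (chi_dens n u * ?m u)) * ennreal (?h (y + ln u)) \<partial>lborel \<partial>lborel)"
        by (rule lborel_pair.Fubini') measurable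
      also have "\<dots> = (\<integral>\<^sup>+u. ennreal (64 * \<epsilon>) * ennreal (chi_dens n u * ?m u) \<partial>lborel)"
      proof (rule nn_integral_cong)
        fix u
        have "(\<integral>\<^sup>+y. ennreal (32 * \<epsilon>\<^sup>2 * (chi_dens n u * ?m u)) * ennreal (?h (y + ln u)) \<partial>lborel)
            = ennreal (32 * \<epsilon>\<^sup>2 * (chi_dens n u * ?m u)) * ennreal (2 / \<epsilon>)"
          by (subst nn_integral_cmult) (use \<epsilon> in \<open>auto simp: nn_integral_scale_cutoff\<close>)
        also have "\<dots> = ennreal (32 * \<epsilon>\<^sup>2 * (chi_dens n u * ?m u) * (2 / \<epsilon>))"
          using \<epsilon> by (intro ennreal_mult''[symmetric]) auto
        also have "32 * \<epsilon>\<^sup>2 * (chi_dens n u * ?m u) * (2 / \<epsilon>) = 64 * \<epsilon> * (chi_dens n u * ?m u)"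
          using \<epsilon> by (simp add: power2_eq_square)
        also have "ennreal (64 * \<epsilon> * (chi_dens n u * ?m u)) = ennreal (64 * \<epsilon>) * ennreal (chi_dens n u * ?m u)"
          using \<epsilon> by (intro ennreal_mult') auto
        finally show "(\<integral>\<^sup>+y. ennreal (32 * \<epsilon>\<^sup>2 * (chi_dens n u * ?m u)) * ennreal (?h (y + ln u)) \<partial>lborel)
            = ennreal (64 * \<epsilon>) * ennreal (chi_dens n u * ?m u)" .
      qed
      also have "\<dots> = ennreal (64 * \<epsilon>) * ?C" by (rule nn_integral_cmult) measurable
      also have "\<dots> = 64 * ?C * ennreal \<epsilon>" using \<epsilon> by (simp add: ennreal_mult mult_ac)
      finally show ?thesis .
    qed
    have "(\<integral>\<^sup>+z. \<integral>\<^sup>+l. ennreal (?F z l) \<partial>lborel \<partial>lborel) = (\<integral>\<^sup>+l. \<integral>\<^sup>+z. ennreal (?F z l) \<partial>lborel \<partial>lborel)"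
      by (rule lborel_pair.Fubini') measurable
    also have "\<dots> = (\<integral>\<^sup>+t. \<integral>\<^sup>+y. \<integral>\<^sup>+z. ennreal (?F z (t, y)) \<partial>lborel \<partial>lborel \<partial>lborel)"
      by (rule nn_integral_lborel_pair) measurable
    also have "\<dots> \<le> (\<integral>\<^sup>+t. \<integral>\<^sup>+y. ennreal (beta_weight a b t)
        * (\<integral>\<^sup>+u. ennreal (32 * \<epsilon>\<^sup>2 * (chi_dens n u * ?m u)) * ennreal (?h (y + ln u)) \<partial>lborel) \<partial>lborel \<partial>lborel)"
      by (intro nn_integral_mono inner)
    also have "\<dots> = (\<integral>\<^sup>+t. ennreal (beta_weight a b t) * (64 * ?C * ennreal \<epsilon>) \<partial>lborel)"
      unfolding y_int[symmetric] by (intro nn_integral_cong nn_integral_cmult) measurable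
    also have "\<dots> = ?B * (64 * ?C * ennreal \<epsilon>)" by (rule nn_integral_multc) measurable
    also have "\<dots> = ?B * (64 * ?C) * ennreal \<epsilon>" by (simp only: mult.assoc)
    finally show "(\<integral>\<^sup>+z. \<integral>\<^sup>+l. ennreal (?F z l) \<partial>lborel \<partial>lborel) \<le> ?B * (64 * ?C) * ennreal \<epsilon>" .
  qed
qed

section \<open>Admissibility\<close>

text \<open>
  The average of \<open>bayes_risk_normal_prior\<close> over \<open>(t, y)\<close>. Because the last term is common to all
  estimators and finite, inequalities between Bayes risks pass to the first term alone.
\<close>

lemma integrated_risk:
  fixes \<delta> :: "(real ^ 'p) \<times> real \<Rightarrow> real ^ 'p"
  assumes n: "n > 0" and \<delta>: "estimator \<delta>"
  shows "(\<integral>\<^sup>+l. ennreal (beta_weight a b (fst l) * scale_cutoff \<epsilon> (snd l))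
        * (\<integral>\<^sup>+\<theta>. ennreal (gauss 0 (exp (snd l) * (1 - fst l) / fst l) \<theta>) * risk n \<theta> (exp (snd l)) \<delta> \<partial>lborel) \<partial>lborel)
    = (\<integral>\<^sup>+z. \<integral>\<^sup>+l. ennreal (posterior n a b z l * (scale_cutoff \<epsilon> (snd l)
          * (norm (borel_version \<delta> z - (1 - fst l) *\<^sub>R fst z))\<^sup>2)) \<partial>lborel \<partial>lborel)
      + (\<integral>\<^sup>+l. ennreal (beta_weight a b (fst l) * scale_cutoff \<epsilon> (snd l)) * ennreal (real CARD('p) * (1 - fst l)) \<partial>lborel)"
proof -
  note [measurable] = borel_measurable_borel_version[OF \<delta>]
  let ?w = "\<lambda>l. beta_weight a b (fst l) * scale_cutoff \<epsilon> (snd l)"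
  let ?N = "\<lambda>l z. (norm (borel_version \<delta> z - (1 - fst l) *\<^sub>R fst z))\<^sup>2"
  let ?V = "\<lambda>l. ennreal (real CARD('p) * (1 - fst l))"
  let ?P = "\<lambda>l z. posterior n a b z l * (scale_cutoff \<epsilon> (snd l) * ?N l z)"
  have pt: "ennreal (?w l) * (\<integral>\<^sup>+\<theta>. ennreal (gauss 0 (exp (snd l) * (1 - fst l) / fst l) \<theta>) * risk n \<theta> (exp (snd l)) \<delta> \<partial>lborel)
      = (\<integral>\<^sup>+z. ennreal (?P l z) \<partial>lborel) + ennreal (?w l) * ?V l" for l
  proof (cases "0 < fst l \<and> fst l < 1")
    case True
    obtain t y where l: "l = (t, y)" by force
    have t: "0 < t" "t < 1" using True by (auto simp: l)
    have "ennreal (?w l) * (\<integral>\<^sup>+z. ennreal (sample_dens n 0 (exp y / t) (exp y) z) * ennreal (?N l z / exp y) \<partial>lborel)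
        = (\<integral>\<^sup>+z. ennreal (?w l) * (ennreal (sample_dens n 0 (exp y / t) (exp y) z) * ennreal (?N l z / exp y)) \<partial>lborel)"
      by (rule nn_integral_cmult[symmetric]) measurable
    also have "\<dots> = (\<integral>\<^sup>+z. ennreal (?P l z) \<partial>lborel)"
    proof (rule nn_integral_cong)
      fix z
      have "?P l z = ?w l * (sample_dens n 0 (exp y / t) (exp y) z * (?N l z / exp y))"
        by (simp add: posterior_def l exp_minus field_simps)
      moreover have "0 \<le> ?w l" "0 \<le> sample_dens n 0 (exp y / t) (exp y) z" "0 \<le> ?N l z / exp y" by auto
      ultimately show "ennreal (?w l) * (ennreal (sample_dens n 0 (exp y / t) (exp y) z) * ennreal (?N l z / exp y)) = ennreal (?P l z)"
        by (simp only: ennreal_mult mult_nonneg_nonneg)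
    qed
    finally show ?thesis
      unfolding l fst_conv snd_conv bayes_risk_normal_prior[OF n exp_gt_zero t \<delta>] distrib_left by (simp only:)
  qed (auto simp: beta_weight_def posterior_def)
  have "(\<integral>\<^sup>+l. ennreal (?w l) * (\<integral>\<^sup>+\<theta>. ennreal (gauss 0 (exp (snd l) * (1 - fst l) / fst l) \<theta>) * risk n \<theta> (exp (snd l)) \<delta> \<partial>lborel) \<partial>lborel)
      = (\<integral>\<^sup>+l. (\<integral>\<^sup>+z. ennreal (?P l z) \<partial>lborel) + ennreal (?w l) * ?V l \<partial>lborel)"
    unfolding pt ..
  also have "\<dots> = (\<integral>\<^sup>+l. \<integral>\<^sup>+z. ennreal (?P l z) \<partial>lborel \<partial>lborel) + (\<integral>\<^sup>+l. ennreal (?w l) * ?V l \<partial>lborel)"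
    by (rule nn_integral_add) measurable
  also have "(\<integral>\<^sup>+l. \<integral>\<^sup>+z. ennreal (?P l z) \<partial>lborel \<partial>lborel) = (\<integral>\<^sup>+z. \<integral>\<^sup>+l. ennreal (?P l z) \<partial>lborel \<partial>lborel)"
    by (rule lborel_pair.Fubini') measurable
  finally show ?thesis .
qed

lemma nn_integral_prior_finite:
  assumes "a > -1" "b > -1" "\<epsilon> > 0"
  shows "(\<integral>\<^sup>+l. ennreal (beta_weight a b (fst l) * scale_cutoff \<epsilon> (snd l)) \<partial>lborel) < \<infinity>"
proof -
  have "(\<integral>\<^sup>+l. ennreal (beta_weight a b (fst l) * scale_cutoff \<epsilon> (snd l)) \<partial>lborel)
      = (\<integral>\<^sup>+t. \<integral>\<^sup>+y. ennreal (beta_weight a b t) * ennreal (scale_cutoff \<epsilon> y) \<partial>lborel \<partial>lborel)"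
    by (subst nn_integral_lborel_pair) (auto simp: ennreal_mult)
  also have "\<dots> = (\<integral>\<^sup>+t. ennreal (beta_weight a b t) * ennreal (2 / \<epsilon>) \<partial>lborel)"
    using nn_integral_scale_cutoff[OF assms(3), of 0] by (simp add: nn_integral_cmult)
  also have "\<dots> = (\<integral>\<^sup>+t. ennreal (beta_weight a b t) \<partial>lborel) * ennreal (2 / \<epsilon>)"
    by (rule nn_integral_multc) measurable
  also have "\<dots> < \<infinity>"
    using nn_integral_beta_weight_finite[OF assms(1,2)] by (simp add: ennreal_mult_less_top)
  finally show ?thesis .
qed

text \<open>
  Blyth's method without the Bayes estimators of the cut-off priors. Domination passes to Bayes
  risks and hence to the integrals of \<open>\<parallel>\<delta> - (1 - t) x\<parallel>\<^sup>2\<close>. The comparison at each data point, integrated, bounds half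
  of the weighted squared distance of the two estimators by the difference of these integrals, which is not
  positive, plus the excess. The bounded risk is what makes the integrals finite and the cancellation legitimate.
\<close>

lemma integrated_distance_bound:
  fixes \<delta>0 \<delta> :: "(real ^ 'p) \<times> real \<Rightarrow> real ^ 'p"
  assumes n: "n \<ge> 3" and a: "a > -1" and b: "b > -1" "b = real n / 2 - a - 2"
  defines "\<alpha> \<equiv> (real CARD('p) / 2 + a + 1) / (b + 1)"
  assumes \<delta>0: "estimator \<delta>0" "\<And>x s. s > 0 \<Longrightarrow> \<delta>0 (x, s) = (1 - \<alpha> / ((norm x)\<^sup>2 / s + 1 + \<alpha>)) *\<^sub>R x"
    and bounded: "R < \<infinity>" "\<And>\<theta> v. v > 0 \<Longrightarrow> risk n \<theta> v \<delta>0 \<le> R"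
    and \<delta>: "estimator \<delta>" and dom: "\<And>\<theta> v. v > 0 \<Longrightarrow> risk n \<theta> v \<delta> \<le> risk n \<theta> v \<delta>0"
  obtains K where "K < \<infinity>"
    "\<And>\<epsilon>. 0 < \<epsilon> \<Longrightarrow> \<epsilon> \<le> 1 / 2 \<Longrightarrow>
      (\<integral>\<^sup>+z. \<integral>\<^sup>+l. ennreal (posterior n a b z l * (scale_cutoff \<epsilon> (snd l)
        * (norm (borel_version \<delta> z - borel_version \<delta>0 z))\<^sup>2 / 2)) \<partial>lborel \<partial>lborel) \<le> K * ennreal \<epsilon>"
proof -
  have "real CARD('p) / 2 > 0" by simp
  then have \<alpha>: "\<alpha> > 0" unfolding \<alpha>_def using a b(1) by (intro divide_pos_pos) linarith+
  have n0: "n > 0" using n by simp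
  define \<tau> where "\<tau> = (\<lambda>z :: (real ^ 'p) \<times> real. \<alpha> / ((norm (fst z))\<^sup>2 / snd z + 1 + \<alpha>))"
  obtain K where K: "K < \<infinity>" and excess: "\<And>\<epsilon>. 0 < \<epsilon> \<Longrightarrow> \<epsilon> \<le> 1 / 2 \<Longrightarrow>
      (\<integral>\<^sup>+z. \<integral>\<^sup>+l. ennreal (posterior n a b z l * (2 * ((norm (fst z))\<^sup>2 * (fst l - \<tau> z)\<^sup>2
        * ((scale_cutoff \<epsilon> (snd l) - scale_cutoff \<epsilon> (ln (snd z)))\<^sup>2 / scale_cutoff \<epsilon> (snd l))))) \<partial>lborel \<partial>lborel)
      \<le> K * ennreal \<epsilon>"
    using excess_risk_bound[OF n a b(1) \<alpha>] unfolding \<tau>_def by blast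
  have [measurable]: "\<tau> \<in> borel_measurable borel" unfolding \<tau>_def by measurable
  note [measurable] = borel_measurable_borel_version[OF \<delta>0(1)] borel_measurable_borel_version[OF \<delta>]
  let ?D = "borel_version \<delta>" and ?S = "borel_version \<delta>0"
  have main: "(\<integral>\<^sup>+z. \<integral>\<^sup>+l. ennreal (posterior n a b z l * (scale_cutoff \<epsilon> (snd l)
        * (norm (?D z - ?S z))\<^sup>2 / 2)) \<partial>lborel \<partial>lborel) \<le> K * ennreal \<epsilon>"
    if \<epsilon>: "0 < \<epsilon>" "\<epsilon> \<le> 1 / 2" for \<epsilon>
  proof -
    let ?h = "scale_cutoff \<epsilon>"
    let ?w = "\<lambda>l. beta_weight a b (fst l) * ?h (snd l)"
    let ?A = "\<lambda>d z. \<integral>\<^sup>+l. ennreal (posterior n a b z l * (?h (snd l) * (norm (d z - (1 - fst l) *\<^sub>R fst z))\<^sup>2)) \<partial>lborel"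
    let ?J = "\<lambda>z. \<integral>\<^sup>+l. ennreal (posterior n a b z l * (?h (snd l) * (norm (?D z - ?S z))\<^sup>2 / 2)) \<partial>lborel"
    let ?E = "\<lambda>z. \<integral>\<^sup>+l. ennreal (posterior n a b z l * (2 * ((norm (fst z))\<^sup>2 * (fst l - \<tau> z)\<^sup>2
        * ((?h (snd l) - ?h (ln (snd z)))\<^sup>2 / ?h (snd l))))) \<partial>lborel"
    let ?B = "\<lambda>d. \<integral>\<^sup>+l. ennreal (?w l) * (\<integral>\<^sup>+\<theta>. ennreal (gauss (0 :: real ^ 'p) (exp (snd l) * (1 - fst l) / fst l) \<theta>) * risk n \<theta> (exp (snd l)) d \<partial>lborel) \<partial>lborel"
    let ?V = "\<integral>\<^sup>+l. ennreal (?w l) * ennreal (real CARD('p) * (1 - fst l)) \<partial>lborel"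
    have W: "(\<integral>\<^sup>+l. ennreal (?w l) \<partial>lborel) < \<infinity>" by (rule nn_integral_prior_finite[OF a b(1) \<epsilon>(1)])
    have "?B \<delta>0 \<le> (\<integral>\<^sup>+l. ennreal (?w l) * R \<partial>lborel)"
    proof (rule nn_integral_mono)
      fix l
      show "ennreal (?w l) * (\<integral>\<^sup>+\<theta>. ennreal (gauss (0 :: real ^ 'p) (exp (snd l) * (1 - fst l) / fst l) \<theta>) * risk n \<theta> (exp (snd l)) \<delta>0 \<partial>lborel)
          \<le> ennreal (?w l) * R"
      proof (cases "0 < fst l \<and> fst l < 1")
        case True
        let ?g = "gauss (0 :: real ^ 'p) (exp (snd l) * (1 - fst l) / fst l)"
        have "(\<integral>\<^sup>+\<theta>. ennreal (?g \<theta>) * risk n \<theta> (exp (snd l)) \<delta>0 \<partial>lborel) \<le> (\<integral>\<^sup>+\<theta>. ennreal (?g \<theta>) * R \<partial>lborel)"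
          by (intro nn_integral_mono mult_left_mono bounded) auto
        also have "\<dots> = R" using True by (subst nn_integral_multc) (auto simp: nn_integral_gauss)
        finally show ?thesis by (rule mult_left_mono) simp
      qed (auto simp: beta_weight_def)
    qed
    also have "\<dots> = (\<integral>\<^sup>+l. ennreal (?w l) \<partial>lborel) * R" by (rule nn_integral_multc) measurable
    also have "\<dots> < \<infinity>" using W bounded(1) by (simp add: ennreal_mult_less_top)
    finally have B0: "?B \<delta>0 < \<infinity>" .
    have "?B \<delta> \<le> ?B \<delta>0"
      by (intro nn_integral_mono mult_left_mono dom) auto
    then have "(\<integral>\<^sup>+z. ?A ?D z \<partial>lborel) + ?V \<le> (\<integral>\<^sup>+z. ?A ?S z \<partial>lborel) + ?V"
      by (simp only: integrated_risk[OF n0 \<delta>] integrated_risk[OF n0 \<delta>0(1)])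
    moreover have B0': "(\<integral>\<^sup>+z. ?A ?S z \<partial>lborel) + ?V < \<infinity>"
      using B0 by (simp only: integrated_risk[OF n0 \<delta>0(1)])
    ultimately have AA: "(\<integral>\<^sup>+z. ?A ?D z \<partial>lborel) \<le> (\<integral>\<^sup>+z. ?A ?S z \<partial>lborel)"
      by (auto simp: add.commute[of _ ?V] ennreal_add_left_cancel_le)
    have A0: "(\<integral>\<^sup>+z. ?A ?S z \<partial>lborel) < \<infinity>" using B0' by simp
    have pt: "?J z + ?A ?S z \<le> ?A ?D z + ?E z" for z
    proof (cases "snd z > 0")
      case True
      obtain x s where z: "z = (x, s)" by force
      have s: "s > 0" using True by (simp add: z)
      let ?P = "posterior n a b (x, s)"
      have d0: "?S z = (1 - \<tau> z) *\<^sub>R x" using s by (simp add: borel_version_def z \<tau>_def \<delta>0(2))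
      have \<tau>: "\<tau> z \<ge> 0" unfolding \<tau>_def z using \<alpha> s by simp
      note bal = posterior_balance[OF s n0 a b, of x, folded \<alpha>_def]
      have mean: "(\<integral>\<^sup>+l. ennreal (?P l) * ennreal (fst l) \<partial>lborel) = ennreal (\<tau> z) * (\<integral>\<^sup>+l. ennreal (?P l) \<partial>lborel)"
        using bal(2) by (simp add: \<tau>_def z)
      have "(\<integral>\<^sup>+l. ennreal (?P l * (?h (snd l) * (norm (?D z - ?S z))\<^sup>2 / 2)) \<partial>lborel)
          + (\<integral>\<^sup>+l. ennreal (?P l * (?h (snd l) * ((fst l - \<tau> z)\<^sup>2 * (norm x)\<^sup>2))) \<partial>lborel)
        \<le> (\<integral>\<^sup>+l. ennreal (?P l * (?h (snd l) * (norm ((?D z - ?S z) + (fst l - \<tau> z) *\<^sub>R x))\<^sup>2)) \<partial>lborel)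
          + (\<integral>\<^sup>+l. ennreal (?P l * (2 * ((norm x)\<^sup>2 * (fst l - \<tau> z)\<^sup>2 * ((?h (snd l) - ?h (ln s))\<^sup>2 / ?h (snd l))))) \<partial>lborel)"
      proof (rule recentred_comparison[OF _ _ _ _ _ _ _ \<tau> bal(1) mean])
        show "\<And>l. 0 < ?P l \<Longrightarrow> 0 \<le> fst l"
          by (auto simp: posterior_def beta_weight_def split: if_splits)
      qed auto
      moreover have "(norm (?S z - (1 - fst l) *\<^sub>R x))\<^sup>2 = (fst l - \<tau> z)\<^sup>2 * (norm x)\<^sup>2" for l :: "real \<times> real"
      proof -
        have "?S z - (1 - fst l) *\<^sub>R x = (fst l - \<tau> z) *\<^sub>R x"
          unfolding d0 by (simp add: algebra_simps)
        then show ?thesis by (simp add: power_mult_distrib)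
      qed
      moreover have "(?D z - ?S z) + (fst l - \<tau> z) *\<^sub>R x = ?D z - (1 - fst l) *\<^sub>R x" for l :: "real \<times> real"
        unfolding d0 by (simp add: algebra_simps)
      ultimately show ?thesis by (simp only: z fst_conv snd_conv)
    next
      case False
      then have "posterior n a b z l = 0" for l
        by (auto simp: posterior_def sample_dens_def chi_dens_def zero_less_divide_iff)
      then show ?thesis by simp
    qed
    have sum1: "(\<integral>\<^sup>+z. ?J z \<partial>lborel) + (\<integral>\<^sup>+z. ?A ?S z \<partial>lborel) = (\<integral>\<^sup>+z. ?J z + ?A ?S z \<partial>lborel)"
      by (rule nn_integral_add[symmetric]) measurable
    have sum2: "(\<integral>\<^sup>+z. ?A ?D z + ?E z \<partial>lborel) = (\<integral>\<^sup>+z. ?A ?D z \<partial>lborel) + (\<integral>\<^sup>+z. ?E z \<partial>lborel)"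
      by (rule nn_integral_add) measurable
    have mono: "(\<integral>\<^sup>+z. ?J z + ?A ?S z \<partial>lborel) \<le> (\<integral>\<^sup>+z. ?A ?D z + ?E z \<partial>lborel)"
      by (rule nn_integral_mono) (rule pt)
    have step: "(\<integral>\<^sup>+z. ?J z \<partial>lborel) + (\<integral>\<^sup>+z. ?A ?S z \<partial>lborel)
        \<le> (\<integral>\<^sup>+z. ?A ?S z \<partial>lborel) + (\<integral>\<^sup>+z. ?E z \<partial>lborel)"
      unfolding sum1 by (rule order.trans[OF mono[unfolded sum2] add_right_mono[OF AA]])
    have "x \<le> y" if "x + c \<le> c + y" "c < \<infinity>" for x y c :: ennreal
      using that by (auto simp: add.commute[of x] ennreal_add_left_cancel_le)
    from this[OF step A0] have "(\<integral>\<^sup>+z. ?J z \<partial>lborel) \<le> (\<integral>\<^sup>+z. ?E z \<partial>lborel)" .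
    then show ?thesis
      using excess[OF \<epsilon>] by (rule order.trans)
  qed
  show ?thesis by (rule that[OF K main])
qed

lemma risk_cong_AE:
  assumes v: "v > 0" and n: "n > 0" and \<delta>: "estimator \<delta>" "estimator \<delta>'"
    and eq: "AE z in lborel. snd z > 0 \<longrightarrow> borel_version \<delta> z = borel_version \<delta>' z"
  shows "risk n \<theta> v \<delta> = risk n \<theta> v \<delta>'"
  unfolding risk_eq[OF v n \<delta>(1)] risk_eq[OF v n \<delta>(2)]
proof (rule nn_integral_cong_AE, rule AE_mp[OF eq], rule AE_I2, rule impI)
  fix z assume "snd z > 0 \<longrightarrow> borel_version \<delta> z = borel_version \<delta>' z"
  then show "ennreal (sample_dens n \<theta> v v z) * ennreal (loss (borel_version \<delta> z) \<theta> v)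
      = ennreal (sample_dens n \<theta> v v z) * ennreal (loss (borel_version \<delta>' z) \<theta> v)"
    using v by (cases "snd z > 0") (auto simp: sample_dens_def chi_dens_def zero_less_divide_iff)
qed

text \<open>
  The distance bound holds for every \<open>\<epsilon>\<close>, while the cut-off densities increase as \<open>\<epsilon>\<close> decreases;
  so the distance for \<open>\<epsilon> = 1 / 2\<close> is below every multiple of \<open>\<epsilon>\<close> and therefore zero.
\<close>

lemma admissible_shrinkage:
  assumes n: "n \<ge> 3" and p: "real CARD('p::finite) > 4 * real n / (real n - 2)"
  shows "admissible n (shrinkage_estimator n :: (real ^ 'p) \<times> real \<Rightarrow> real ^ 'p)"
proof -
  let ?p = "real CARD('p)" and ?n = "real n"
  let ?\<delta>0 = "shrinkage_estimator n :: (real ^ 'p) \<times> real \<Rightarrow> real ^ 'p"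
  have n3: "?n \<ge> 3" "n > 0" using n by auto
  have pn: "?p * (?n - 2) > 4 * ?n" using p n3 by (simp add: divide_less_eq)
  have "4 < 4 * ?n / (?n - 2)" using n3 by (simp add: less_divide_eq)
  with p have p4: "?p > 4" by linarith
  \<comment> \<open>The root of \<open>(p + k) / (n - k) = \<alpha>\<close>, where \<open>k = 2 a + 2\<close>.\<close>
  define k where "k = (?p * (?n - 2) - 4 * ?n) / (?n + 2 * ?p - 2)"
  have den: "?n + 2 * ?p - 2 > 0" using n3 p4 by linarith
  have k0: "k > 0" using pn den by (simp add: k_def)
  have kn: "k < ?n"
  proof -
    have "?n * (?n + 2 * ?p - 2) - (?p * (?n - 2) - 4 * ?n) = ?n * ?n + ?p * ?n + 2 * ?n + 2 * ?p"
      by (simp add: algebra_simps)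
    moreover have "?p * ?n > 0" "?n * ?n > 0" using p4 n3 by auto
    ultimately have "?p * (?n - 2) - 4 * ?n < ?n * (?n + 2 * ?p - 2)"
      using p4 n3 by linarith
    then show ?thesis using den by (simp add: k_def divide_less_eq)
  qed
  define a where "a = k / 2 - 1"
  define b where "b = ?n / 2 - a - 2"
  have a: "a > -1" using k0 by (simp add: a_def)
  have b: "b > -1" using kn by (simp add: b_def a_def)
  have \<alpha>: "(?p / 2 + a + 1) / (b + 1) = 2 * (?p - 2) / (?n + 2)"
  proof -
    have "k * (?n + 2 * ?p - 2) = ?p * (?n - 2) - 4 * ?n" using den by (simp add: k_def)
    then have "(?p + k) * (?n + 2) = 2 * (?p - 2) * (?n - k)" by (simp add: algebra_simps)
    then have "(?p + k) / (?n - k) = 2 * (?p - 2) / (?n + 2)"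
      using kn n3 by (simp add: frac_eq_eq)
    moreover have "(?p / 2 + a + 1) / (b + 1) = (?p + k) / (?n - k)"
      using kn by (simp add: a_def b_def field_simps)
    ultimately show ?thesis by simp
  qed
  have p2: "CARD('p) > 2" using p4 by linarith
  have eq: "risk n \<theta> v \<delta> = risk n \<theta> v ?\<delta>0"
    if \<delta>: "estimator \<delta>" and dom: "\<forall>\<theta>. \<forall>v>0. risk n \<theta> v \<delta> \<le> risk n \<theta> v ?\<delta>0" and v: "v > 0" for \<delta> \<theta> v
  proof -
    note [measurable] = borel_measurable_borel_version[OF \<delta>] borel_measurable_borel_version[OF estimator_shrinkage[of n, where 'p='p]]
    let ?I = "\<lambda>\<epsilon> l z. ennreal (posterior n a b z l * (scale_cutoff \<epsilon> (snd l) * (norm (borel_version \<delta> z - borel_version ?\<delta>0 z))\<^sup>2 / 2))"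
    obtain K where K: "K < \<infinity>"
      and bound: "\<And>\<epsilon>. 0 < \<epsilon> \<Longrightarrow> \<epsilon> \<le> 1 / 2 \<Longrightarrow> (\<integral>\<^sup>+z. \<integral>\<^sup>+l. ?I \<epsilon> l z \<partial>lborel \<partial>lborel) \<le> K * ennreal \<epsilon>"
    proof (rule integrated_distance_bound[OF n a b b_def estimator_shrinkage _ _ _ \<delta>, where R = "ennreal ?p"])
      show "?\<delta>0 (x, s) = (1 - (?p / 2 + a + 1) / (b + 1) / ((norm x)\<^sup>2 / s + 1 + (?p / 2 + a + 1) / (b + 1))) *\<^sub>R x"
        if "s > 0" for x s unfolding \<alpha> by (simp add: shrinkage_estimator_def)
      show "risk n \<theta> v ?\<delta>0 \<le> ennreal ?p" if "v > 0" for \<theta> v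
        by (rule risk_shrinkage_le[OF n3(2) that p2])
    qed (use dom in auto)
    let ?J = "\<integral>\<^sup>+z. \<integral>\<^sup>+l. ?I (1 / 2) l z \<partial>lborel \<partial>lborel"
    have le: "?J \<le> K * ennreal \<epsilon>" if \<epsilon>: "0 < \<epsilon>" "\<epsilon> \<le> 1 / 2" for \<epsilon>
    proof -
      have "scale_cutoff (1 / 2) y \<le> scale_cutoff \<epsilon> y" for y
        using \<epsilon> mult_right_mono[of \<epsilon> "1 / 2" "\<bar>y\<bar>"] by (simp add: scale_cutoff_def)
      then have "?J \<le> (\<integral>\<^sup>+z. \<integral>\<^sup>+l. ?I \<epsilon> l z \<partial>lborel \<partial>lborel)"
        by (intro nn_integral_mono ennreal_leI mult_left_mono divide_right_mono mult_right_mono) auto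
      with bound[OF \<epsilon>] show ?thesis by (rule order.trans[rotated])
    qed
    have "?J = 0"
    proof (cases K)
      case (real c)
      have J: "?J \<le> ennreal (c * \<epsilon>)" if "0 < \<epsilon>" "\<epsilon> \<le> 1 / 2" for \<epsilon>
        using le[OF that] real that by (simp add: ennreal_mult)
      have "?J \<le> 0"
      proof (rule tendsto_lowerbound)
        have "((\<lambda>\<epsilon>. c * \<epsilon>) \<longlongrightarrow> c * 0) (at_right 0)" by (intro tendsto_intros)
        then show "((\<lambda>\<epsilon>. ennreal (c * \<epsilon>)) \<longlongrightarrow> 0) (at_right 0)"
          using tendsto_ennrealI[of "\<lambda>\<epsilon>. c * \<epsilon>" "c * 0"] by simp
        show "\<forall>\<^sub>F \<epsilon> in at_right 0. ?J \<le> ennreal (c * \<epsilon>)"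
          unfolding eventually_at_right_field using J by (intro exI[of _ "1 / 2"]) auto
      qed simp
      then show ?thesis by simp
    qed (use K in auto)
    then have "(\<integral>\<^sup>+l. \<integral>\<^sup>+z. ?I (1 / 2) l z \<partial>lborel \<partial>lborel) = 0"
      by (subst lborel_pair.Fubini') measurable
    then have AE: "AE l in lborel. (\<integral>\<^sup>+z. ?I (1 / 2) l z \<partial>lborel) = 0"
      by (subst (asm) nn_integral_0_iff_AE) auto
    \<comment> \<open>A single latent value with \<open>0 < t < 1\<close> suffices, because its weight is positive at all data with \<open>s > 0\<close>.\<close>
    obtain l where l: "l \<in> box (0, 0) (1 :: real, 1 :: real)" "(\<integral>\<^sup>+z. ?I (1 / 2) l z \<partial>lborel) = 0"
    proof (rule ccontr)
      assume "\<not> thesis"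
      with that have no: "\<And>l. l \<in> box (0, 0) (1 :: real, 1 :: real) \<Longrightarrow> (\<integral>\<^sup>+z. ?I (1 / 2) l z \<partial>lborel) \<noteq> 0" by blast
      have "AE l in lborel. l \<notin> box (0, 0) (1 :: real, 1 :: real)"
        by (rule AE_mp[OF AE], intro AE_I2 impI notI) (use no in blast)
      then have "emeasure lborel (box (0, 0) (1 :: real, 1 :: real)) = 0"
        by (subst (asm) AE_iff_measurable[of "box (0, 0) (1 :: real, 1 :: real)"]) auto
      moreover have "emeasure lborel (box (0, 0) (1 :: real, 1 :: real)) = 1"
        by (subst emeasure_lborel_box) (auto simp: Basis_prod_def)
      ultimately show False by simp
    qed
    have t: "0 < fst l" "fst l < 1"
      using l(1) by (cases l; auto simp: mem_box Basis_prod_def)+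
    have "AE z in lborel. ?I (1 / 2) l z = 0"
      using l(2) by (subst (asm) nn_integral_0_iff_AE) auto
    then have "AE z in lborel. snd z > 0 \<longrightarrow> borel_version \<delta> z = borel_version ?\<delta>0 z"
    proof (rule AE_mp, intro AE_I2 impI)
      fix z assume z: "?I (1 / 2) l z = 0" "snd z > 0"
      have "posterior n a b z l > 0"
        using t z(2) n3 by (auto simp: posterior_def beta_weight_def sample_dens_def gauss_pos chi_dens_pos
            intro!: mult_pos_pos divide_pos_pos)
      moreover have "posterior n a b z l * (scale_cutoff (1 / 2) (snd l) * (norm (borel_version \<delta> z - borel_version ?\<delta>0 z))\<^sup>2 / 2) \<le> 0"
        using z(1) by (simp add: ennreal_eq_0_iff)
      ultimately have "scale_cutoff (1 / 2) (snd l) * (norm (borel_version \<delta> z - borel_version ?\<delta>0 z))\<^sup>2 / 2 \<le> 0"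
        by (simp only: mult_le_0_iff) auto
      then have "(norm (borel_version \<delta> z - borel_version ?\<delta>0 z))\<^sup>2 \<le> 0"
        using scale_cutoff_pos[of "1 / 2" "snd l"] by (auto simp: mult_le_0_iff)
      then show "borel_version \<delta> z = borel_version ?\<delta>0 z" by simp
    qed
    then show ?thesis by (rule risk_cong_AE[OF v n3(2) \<delta> estimator_shrinkage])
  qed
  show ?thesis
    unfolding admissible_def using estimator_shrinkage eq by (metis less_irrefl)
qed

theorem corollary3p1:
  fixes n :: nat
  assumes "n \<ge> 3"
    and "real CARD('p::finite) > 4 * real n / (real n - 2)"
  shows "admissible n (shrinkage_estimator n :: (real ^ 'p) \<times> real \<Rightarrow> real ^ 'p) \<and>
         minimax n (shrinkage_estimator n :: (real ^ 'p) \<times> real \<Rightarrow> real ^ 'p)"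
proof
  show "admissible n (shrinkage_estimator n :: (real ^ 'p) \<times> real \<Rightarrow> real ^ 'p)"
    by (rule admissible_shrinkage[OF assms])
  have "2 < 4 * real n / (real n - 2)" using assms(1) by (simp add: less_divide_eq)
  with assms(2) have "CARD('p) > 2" by linarith
  then show "minimax n (shrinkage_estimator n :: (real ^ 'p) \<times> real \<Rightarrow> real ^ 'p)"
    using assms(1) by (intro minimax_shrinkage) auto
qed

end
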